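(* Let $m$ be a positive integer, $q=2^{2m+1}$ and $q_0=2^m$. Let $S_m$ be the Suzuki curve, i.e. the smooth projective curve over $\mathbb{F}_q$ given by the homogeneous equation $W^{q_0}(Z^q+ZW^{q-1})=Y^{q_0}(Y^q+YW^{q-1})$, with affine model $z^q+z=y^{q_0}(y^q+y)$. Let $g(m)=q_0(q-1)$ be the genus of $S_m$ and let $a(m)$ be the $a$-number of $S_m$. Then \[ a(m)=\frac{q_0(q_0+1)(2q_0+1)}{6}. \] In particular, \[ \frac{1}{6}<\frac{a(m)}{g(m)}<\frac{1}{6}+\frac{1}{2^{m+1}}. \]
   Context: The $a$-number of a smooth projective connected curve $X$ over a field of characteristic $p$ is $\dim_{\overline{\mathbb{F}}_p}\mathrm{Hom}(\alpha_p,\mathrm{Jac}(X)[p])$, where $\alpha_p$ is the kernel of Frobenius on the additive group scheme $\mathbb{G}_a$; equivalently, it is the dimension of the kernel of the Cartier operator acting on the space $H^0(X_{\overline{\mathbb{F}}_p},\Omega^1)$ of regular differential $1$-forms. *)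

theory Defs
  imports
    "HOL-Algebra.Algebra"
    "HOL-Algebra.Algebraic_Closure_Type"
    "HOL-Library.Poly_Mapping"
    "HOL-Library.Z2"
    "Jordan_Normal_Form.Missing_VectorSpace"
begin

text \<open>
  A smooth projective connected curve over an algebraically closed field \<open>k\<close> is handled through
  its function field \<open>F\<close>. Both \<open>k\<close> and \<open>F\<close> are subsets of an ambient field type; the closed points
  of the curve are the valuation rings of \<open>F\<close> over \<open>k\<close>, and each of them is the local ring at the
  corresponding point.
\<close>

abbreviation as_ring :: "'a::field set \<Rightarrow> 'a ring"
  where "as_ring S \<equiv> ring_of_type_algebra\<lparr>carrier := S\<rparr>"

definition valuation_ring :: "'a::field set \<Rightarrow> 'a set \<Rightarrow> 'a set \<Rightarrow> bool"
  where "valuation_ring k F A \<longleftrightarrow>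
    subring A (as_ring F) \<and> k \<subseteq> A \<and> A \<noteq> F \<and> (\<forall>x\<in>F. x \<in> A \<or> inverse x \<in> A)"

text \<open>
  The free \<open>F\<close>-module on symbols \<open>[x]\<close> for \<open>x \<in> F\<close>; the symbol \<open>[x]\<close> with coefficient \<open>f\<close> is
  \<open>Poly_Mapping.single x f\<close>. The ring multiplication and unit of the record play no role
  for a module.
\<close>

definition formal_differentials :: "'a::field set \<Rightarrow> ('a, 'a \<Rightarrow>\<^sub>0 'a) module"
  where "formal_differentials F =
    \<lparr>carrier = {w. Poly_Mapping.keys w \<subseteq> F \<and> Poly_Mapping.range w \<subseteq> F},
     monoid.mult = (\<lambda>_ _. 0), one = 0, ring.zero = 0, add = (+),
     module.smult = (\<lambda>f. Poly_Mapping.map ((*) f))\<rparr>"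

definition kaehler_relations :: "'a::field set \<Rightarrow> 'a set \<Rightarrow> ('a \<Rightarrow>\<^sub>0 'a) set"
  where "kaehler_relations k F =
    module.span (as_ring F) (formal_differentials F)
      ({Poly_Mapping.single (x + y) 1 - Poly_Mapping.single x 1 - Poly_Mapping.single y 1
          | x y. x \<in> F \<and> y \<in> F} \<union>
       {Poly_Mapping.single (x * y) 1 - Poly_Mapping.single y x - Poly_Mapping.single x y
          | x y. x \<in> F \<and> y \<in> F} \<union>
       {Poly_Mapping.single c 1 | c. c \<in> k})"

definition kaehler :: "'a::field set \<Rightarrow> 'a set \<Rightarrow> ('a, ('a \<Rightarrow>\<^sub>0 'a) set) module"
  where "kaehler k F =
    (let M = formal_differentials F; N = kaehler_relations k F in
    \<lparr>carrier = a_rcosets\<^bsub>M\<^esub> N,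
     monoid.mult = (\<lambda>_ _. N), one = N, ring.zero = N, add = set_add M,
     module.smult = (\<lambda>f W. \<Union>w\<in>W. N +>\<^bsub>M\<^esub> (f \<odot>\<^bsub>M\<^esub> w))\<rparr>)"

definition kaehler_d :: "'a::field set \<Rightarrow> 'a set \<Rightarrow> 'a \<Rightarrow> ('a \<Rightarrow>\<^sub>0 'a) set"
  where "kaehler_d k F x =
    kaehler_relations k F +>\<^bsub>formal_differentials F\<^esub> Poly_Mapping.single x 1"

text \<open>
  A differential is regular at the point with local ring \<open>A\<close> iff it lies in the image of the
  Kaehler differentials of \<open>A\<close> over \<open>k\<close>, that is, in the \<open>A\<close>-module generated by all \<open>dx\<close> with
  \<open>x \<in> A\<close>.
\<close>

definition regular_differentials :: "'a::field set \<Rightarrow> 'a set \<Rightarrow> ('a \<Rightarrow>\<^sub>0 'a) set set"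
  where "regular_differentials k F =
    {\<omega> \<in> carrier (kaehler k F). \<forall>A. valuation_ring k F A \<longrightarrow>
       \<omega> \<in> module.span (as_ring A) (kaehler k F) (kaehler_d k F ` A)}"

definition curve_genus :: "'a::field set \<Rightarrow> 'a set \<Rightarrow> nat"
  where "curve_genus k F =
    vectorspace.dim (as_ring k) ((kaehler k F)\<lparr>carrier := regular_differentials k F\<rparr>)"

text \<open>
  For a function field in one variable over a perfect field of positive characteristic, these
  properties determine the operator uniquely; the function space is extensional so that the
  description also pins down the values outside the module.
\<close>

definition is_cartier_operator ::
    "'a::field set \<Rightarrow> 'a set \<Rightarrow> (('a \<Rightarrow>\<^sub>0 'a) set \<Rightarrow> ('a \<Rightarrow>\<^sub>0 'a) set) \<Rightarrow> bool"
  where "is_cartier_operator k F C \<longleftrightarrow>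
    (let M = kaehler k F; d = kaehler_d k F; p = CHAR('a) in
      C \<in> carrier M \<rightarrow>\<^sub>E carrier M \<and>
      (\<forall>\<omega>\<in>carrier M. \<forall>\<eta>\<in>carrier M. C (\<omega> \<oplus>\<^bsub>M\<^esub> \<eta>) = C \<omega> \<oplus>\<^bsub>M\<^esub> C \<eta>) \<and>
      (\<forall>f\<in>F. \<forall>\<omega>\<in>carrier M. C (f ^ p \<odot>\<^bsub>M\<^esub> \<omega>) = f \<odot>\<^bsub>M\<^esub> C \<omega>) \<and>
      (\<forall>f\<in>F. C (d f) = \<zero>\<^bsub>M\<^esub>) \<and>
      (\<forall>f\<in>F. C (f ^ (p - 1) \<odot>\<^bsub>M\<^esub> d f) = d f))"

definition cartier :: "'a::field set \<Rightarrow> 'a set \<Rightarrow> ('a \<Rightarrow>\<^sub>0 'a) set \<Rightarrow> ('a \<Rightarrow>\<^sub>0 'a) set"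
  where "cartier k F = (THE C. is_cartier_operator k F C)"

definition a_number :: "'a::field set \<Rightarrow> 'a set \<Rightarrow> nat"
  where "a_number k F =
    vectorspace.dim (as_ring k)
      ((kaehler k F)\<lparr>carrier :=
         {\<omega> \<in> regular_differentials k F. cartier k F \<omega> = \<zero>\<^bsub>kaehler k F\<^esub>}\<rparr>)"

text \<open>
  The ambient field is an algebraic closure of the rational function field in the coordinate \<open>y\<close>
  over the algebraic closure of \<open>GF(2)\<close>. The homogeneous plane equation has a singular
  point at infinity; the Suzuki curve is the smooth projective curve with the same function field,
  which is generated over the constants by \<open>y\<close> and a root \<open>z\<close> of the affine equation.
  All roots differ by constants (elements of \<open>GF(q)\<close>), so they generate the same field.
\<close>

type_synonym suzuki_ambient = "bit alg_closure poly fract alg_closure"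

definition const_embedding :: "bit alg_closure \<Rightarrow> suzuki_ambient"
  where "const_embedding c = to_ac (to_fract [:c:])"

definition constant_field :: "suzuki_ambient set"
  where "constant_field = range const_embedding"

definition coord_y :: suzuki_ambient
  where "coord_y = to_ac (to_fract [:0, 1:])"

definition suzuki_equation :: "nat \<Rightarrow> suzuki_ambient \<Rightarrow> bool"
  where "suzuki_equation m z \<longleftrightarrow>
    (let q = 2 ^ (2 * m + 1); q0 = 2 ^ m in
      z ^ q + z = coord_y ^ q0 * (coord_y ^ q + coord_y))"

definition suzuki_function_field :: "suzuki_ambient \<Rightarrow> suzuki_ambient set"
  where "suzuki_function_field z =
    generate_field ring_of_type_algebra (constant_field \<union> {coord_y, z})"

lemma suzuki_equation_solvable: "\<exists>z. suzuki_equation m z"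
proof -
  define q :: nat where "q = 2 ^ (2 * m + 1)"
  define c where "c = coord_y ^ 2 ^ m * (coord_y ^ q + coord_y)"
  let ?P = "Polynomial.monom 1 q + [:- c, 1:]"
  have q: "q > 1" unfolding q_def by (rule one_less_power) auto
  have "Polynomial.degree ?P = q"
    using q by (subst degree_add_eq_left) (auto simp: Polynomial.degree_monom_eq)
  then obtain z where "poly ?P z = 0"
    using alg_closed_imp_poly_has_root[of ?P] q by auto
  then have "z ^ q + z = c" by (simp add: Polynomial.poly_monom algebra_simps)
  then show ?thesis unfolding suzuki_equation_def q_def c_def Let_def by blast
qed

end

theory Submission
  imports Defs
begin

text \<open>
  Put \<open>h\<^sub>1 = z\<^bsup>2q0\<^esup> + y\<^bsup>2q0+1\<^esup>\<close> and \<open>h\<^sub>2 = y h\<^sub>1 + z\<^sup>2\<close>. At a place where \<open>y\<close> is not regular,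
  \<open>t = h\<^sub>1 / h\<^sub>2\<close> is a uniformizer, and \<open>y, z, h\<^sub>1, h\<^sub>2\<close> have poles of orders
  \<open>q, q + q0, q + 2q0, q + 2q0 + 1\<close>. The monomials \<open>y\<^sup>a z\<^sup>b h\<^sub>1\<^sup>c h\<^sub>2\<^sup>d\<close> with \<open>b \<le> 1\<close> and
  \<open>c, d < q0\<close> span \<open>R = k[y, z]\<close> and have distinct pole orders, so the functions in \<open>R\<close> with a
  pole of order at most \<open>n\<close> have an explicit basis. At every other place \<open>y - \<alpha>\<close> is a uniformizer
  for some constant \<open>\<alpha>\<close>, and \<open>R\<close> is integrally closed; as \<open>dt = h\<^sub>2\<^bsup>2q0-2\<^esup> dy\<close>, the regular
  differentials are the \<open>f dy\<close> with \<open>f \<in> R\<close> of pole order at most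
  \<open>2g - 2 = (2q0 - 2)(q + 2q0 + 1)\<close>. In characteristic two the function field is
  \<open>F = F\<^sup>2 \<oplus> F\<^sup>2 y\<close> and the Cartier operator maps \<open>(a\<^sup>2 + b\<^sup>2 y) dy\<close> to \<open>b dy\<close>, so its kernel
  consists of the \<open>a\<^sup>2 dy\<close> with \<open>a\<close> of pole order at most \<open>g - 1\<close>. Counting exponents gives \<open>g\<close> and
  the \<open>a\<close>-number.
\<close>

subsection \<open>Subrings and subfields of a field type\<close>

text \<open>On the curve z + y^(q0+1) and y^q0 z + h1 are q0-th powers, and h1 and h2 are their
  q0-th roots. These two identities do three jobs: they bound the exponents of h1 and h2 in the
  monomials, they give the pole orders (2-power roots of leading terms can be taken in
  characteristic two), and they make the numerator of dt/dy a power of h2. The genus is defined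
  through regular differentials, so both invariants are counted from the same monomial bases,
  without Riemann-Roch. The obstacle is that regularity is a condition at all valuation rings at
  once. Enough of them must exist, which is a maximality argument; elements regular at all finite
  places must lie in R, which rests on reduced fibres of y; and each place must have a local
  generator of the differentials. In place of integer valuations, elements are compared by their
  leading terms, up to factors congruent to 1. That y is not a square, on which the description of
  differentials and of the Cartier operator depends, comes from the uniformizer at infinity.\<close>

definition closed_ring :: "'a::field set \<Rightarrow> bool"
  where "closed_ring S \<longleftrightarrow> 1 \<in> S \<and> (\<forall>x\<in>S. \<forall>y\<in>S. x - y \<in> S \<and> x * y \<in> S)"

definition closed_field :: "'a::field set \<Rightarrow> bool"
  where "closed_field S \<longleftrightarrow> closed_ring S \<and> (\<forall>x\<in>S. inverse x \<in> S)"

lemma closed_fieldD: "closed_field S \<Longrightarrow> closed_ring S"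
  by (simp add: closed_field_def)

lemma closed_field_inverse: "closed_field S \<Longrightarrow> x \<in> S \<Longrightarrow> inverse x \<in> S"
  by (simp add: closed_field_def)

context
  fixes S :: "'a::field set"
  assumes S: "closed_ring S"
begin

lemma closed_ring_1: "1 \<in> S" and closed_ring_diff: "x \<in> S \<Longrightarrow> y \<in> S \<Longrightarrow> x - y \<in> S"
  and closed_ring_mult: "x \<in> S \<Longrightarrow> y \<in> S \<Longrightarrow> x * y \<in> S"
  using S by (auto simp: closed_ring_def)

lemma closed_ring_0: "0 \<in> S"
  using closed_ring_diff[OF closed_ring_1 closed_ring_1] by simp

lemma closed_ring_uminus: "x \<in> S \<Longrightarrow> - x \<in> S"
  using closed_ring_diff[OF closed_ring_0] by fastforce

lemma closed_ring_add: "x \<in> S \<Longrightarrow> y \<in> S \<Longrightarrow> x + y \<in> S"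
  using closed_ring_diff[OF _ closed_ring_uminus] by fastforce

lemma closed_ring_power: "x \<in> S \<Longrightarrow> x ^ n \<in> S"
  by (induction n) (auto simp: closed_ring_1 closed_ring_mult)

lemma closed_ring_sum: "(\<And>i. i \<in> I \<Longrightarrow> f i \<in> S) \<Longrightarrow> sum f I \<in> S"
  by (induction I rule: infinite_finite_induct) (auto simp: closed_ring_0 closed_ring_add)

lemmas closed_ring_intros = closed_ring_0 closed_ring_1 closed_ring_diff closed_ring_mult
  closed_ring_uminus closed_ring_add closed_ring_power closed_ring_sum

end

lemma closed_field_divide: "closed_field S \<Longrightarrow> x \<in> S \<Longrightarrow> y \<in> S \<Longrightarrow> x / y \<in> S"
  by (simp add: divide_inverse closed_field_def closed_ring_mult)

definition polys_over :: "'a::field set \<Rightarrow> 'a poly set"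
  where "polys_over A = {p. \<forall>i. poly.coeff p i \<in> A}"

definition adjoin :: "'a::field set \<Rightarrow> 'a \<Rightarrow> 'a set"
  where "adjoin A x = (\<lambda>p. poly p x) ` polys_over A"

context
  fixes A :: "'a::field set"
  assumes A: "closed_ring A"
begin

lemma polys_over_add: "p \<in> polys_over A \<Longrightarrow> r \<in> polys_over A \<Longrightarrow> p + r \<in> polys_over A"
  and polys_over_diff: "p \<in> polys_over A \<Longrightarrow> r \<in> polys_over A \<Longrightarrow> p - r \<in> polys_over A"
  and polys_over_mult: "p \<in> polys_over A \<Longrightarrow> r \<in> polys_over A \<Longrightarrow> p * r \<in> polys_over A"
  and polys_over_monom: "a \<in> A \<Longrightarrow> Polynomial.monom a n \<in> polys_over A"
  by (auto simp: polys_over_def Polynomial.coeff_mult Polynomial.coeff_monom intro!: closed_ring_intros[OF A])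

lemma polys_over_poly: "p \<in> polys_over A \<Longrightarrow> x \<in> A \<Longrightarrow> poly p x \<in> A"
  by (auto simp: polys_over_def poly_altdef intro!: closed_ring_intros[OF A])

lemma closed_ring_adjoin: "closed_ring (adjoin A x)"
proof -
  have "1 \<in> adjoin A x"
    unfolding adjoin_def using polys_over_monom[OF closed_ring_1[OF A], of 0]
    by (force simp: image_iff)
  moreover have "poly p x - poly r x \<in> adjoin A x" "poly p x * poly r x \<in> adjoin A x"
    if "p \<in> polys_over A" "r \<in> polys_over A" for p r
    using polys_over_diff[OF that] polys_over_mult[OF that]
    by (auto simp: adjoin_def image_iff simp flip: poly_diff poly_mult)
  ultimately show ?thesis
    unfolding closed_ring_def by (auto simp: adjoin_def)
qed

lemma adjoin_superset: "A \<subseteq> adjoin A x"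
proof
  fix a assume "a \<in> A"
  then have "poly (Polynomial.monom a 0) x \<in> adjoin A x"
    unfolding adjoin_def by (intro imageI polys_over_monom)
  then show "a \<in> adjoin A x" by (simp add: Polynomial.poly_monom)
qed

lemma adjoin_self: "x \<in> adjoin A x"
proof -
  have "poly (Polynomial.monom 1 1) x \<in> adjoin A x"
    unfolding adjoin_def by (intro imageI polys_over_monom closed_ring_1 A)
  then show ?thesis by (simp add: Polynomial.poly_monom)
qed

lemma adjoin_subset: 
  assumes "closed_ring F" "A \<subseteq> F" "x \<in> F" shows "adjoin A x \<subseteq> F"
  using assms by (auto simp: adjoin_def polys_over_def poly_altdef intro!: closed_ring_intros[OF assms(1)])

end

subsection \<open>Existence of valuation rings\<close>

text \<open>Multiplying \<open>v = \<Sum> c\<^sub>j x\<^sup>-\<^sup>j\<close> by \<open>u x\<^sup>n\<close> expresses \<open>x\<^sup>n\<close> by lower powers of \<open>x\<close>, with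
  coefficients in \<open>u A\<close>.\<close>

lemma power_reduction:
  fixes A :: "'a::field set"
  assumes A: "closed_ring A" and u: "u \<in> A" "u \<noteq> 0" and x: "x \<noteq> 0"
    and unit: "\<And>b. b \<in> A \<Longrightarrow> 1 + u * b \<noteq> 0 \<and> inverse (1 + u * b) \<in> A"
    and p: "p \<in> polys_over A" "poly p (inverse x) = inverse u"
  obtains Q where "Q \<in> polys_over A" "x ^ Polynomial.degree p = u * poly Q x" 
    "Polynomial.degree Q < Polynomial.degree p \<or> Q = 0"
proof -
  define n where "n = Polynomial.degree p"
  \<comment> \<open>The term with j = 0 would reproduce x^n itself. It is moved to the left, where
    it leaves the unit 1 - u c with c = \<open>poly.coeff p 0\<close>, which is divided out.\<close>
  define e where "e = inverse (1 - u * poly.coeff p 0)"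
  have "- poly.coeff p 0 \<in> A"
    using p by (auto simp: polys_over_def intro: closed_ring_intros[OF A])
  then have e: "e \<in> A" "e * (1 - u * poly.coeff p 0) = 1"
    using unit[of "- poly.coeff p 0"] by (auto simp: e_def)
  define Q where "Q = (\<Sum>j=1..n. Polynomial.monom (e * poly.coeff p j) (n - j))"
  have Q: "Q \<in> polys_over A"
    using p e unfolding Q_def polys_over_def
    by (auto simp: coeff_sum Polynomial.coeff_monom intro!: closed_ring_intros[OF A])
  have "1 = u * (\<Sum>j\<le>n. poly.coeff p j * inverse x ^ j)"
    using p u by (simp add: poly_altdef n_def)
  also have "{..n} = insert 0 {1..n}" by auto
  finally have "1 - u * poly.coeff p 0 = u * (\<Sum>j=1..n. poly.coeff p j * inverse x ^ j)"
    by (simp add: algebra_simps)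
  with e have "1 = e * (u * (\<Sum>j=1..n. poly.coeff p j * inverse x ^ j))" by simp
  then have "x ^ n = x ^ n * (e * (u * (\<Sum>j=1..n. poly.coeff p j * inverse x ^ j)))" by simp
  also have "\<dots> = u * (\<Sum>j=1..n. (e * poly.coeff p j) * (x ^ n * inverse x ^ j))"
    by (simp add: sum_distrib_left mult_ac)
  also have "(\<Sum>j=1..n. (e * poly.coeff p j) * (x ^ n * inverse x ^ j)) = poly Q x"
    unfolding Q_def poly_sum Polynomial.poly_monom
    using x by (intro sum.cong refl) (auto simp: power_diff field_simps)
  finally have "x ^ n = u * poly Q x" .
  moreover have "Polynomial.degree Q < n \<or> Q = 0"
  proof (cases "n = 0")
    case False
    have "Polynomial.degree Q \<le> n - 1"
      unfolding Q_def
      by (intro degree_sum_le order.trans[OF Polynomial.degree_monom_le]) auto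
    with False show ?thesis by auto
  qed (simp add: Q_def)
  ultimately show ?thesis using that Q by (simp add: n_def)
qed

text \<open>A subring that contains B and is maximal among those without \<open>inverse u\<close> is
  a valuation ring. Avoiding \<open>inverse u\<close> takes the place of choosing a prime ideal that
  contains u.\<close>

lemma exists_valuation_ring:
  fixes F B :: "'a::field set"
  assumes F: "closed_field F" and B: "closed_ring B" "B \<subseteq> F" and u: "u \<in> B" "inverse u \<notin> B"
  obtains A where "B \<subseteq> A" "closed_ring A" "A \<subseteq> F" "inverse u \<notin> A" "\<And>x. x \<in> F \<Longrightarrow> x \<in> A \<or> inverse x \<in> A"
proof -
  have u0: "u \<noteq> 0" using u closed_ring_0[OF B(1)] by auto
  define \<S> where "\<S> = {A. B \<subseteq> A \<and> closed_ring A \<and> A \<subseteq> F \<and> inverse u \<notin> A}"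
  have "\<exists>A\<in>\<S>. \<forall>W\<in>\<S>. A \<subseteq> W \<longrightarrow> W = A"
  proof (rule subset_Zorn_nonempty)
    show "\<S> \<noteq> {}" using B u by (auto simp: \<S>_def)
    fix C assume C: "C \<noteq> {}" "subset.chain \<S> C"
    then have sub: "W \<in> \<S>" if "W \<in> C" for W using that by (auto simp: subset_chain_def)
    have "x - y \<in> \<Union>C \<and> x * y \<in> \<Union>C" if xy: "x \<in> \<Union>C" "y \<in> \<Union>C" for x y
    proof -
      obtain W Y where "W \<in> C" "x \<in> W" "Y \<in> C" "y \<in> Y" using xy by auto
      then obtain Z where "Z \<in> C" "x \<in> Z" "y \<in> Z" using C(2) unfolding subset_chain_def by blast
      then show ?thesis using sub[of Z] by (auto simp: \<S>_def closed_ring_def)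
    qed
    moreover obtain W where W: "W \<in> C" using C by auto
    moreover have "1 \<in> W" "B \<subseteq> W" using sub[OF W] by (auto simp: \<S>_def closed_ring_def)
    ultimately have "closed_ring (\<Union>C)" "B \<subseteq> \<Union>C"
      unfolding closed_ring_def by blast+
    then show "\<Union>C \<in> \<S>" using sub by (auto simp: \<S>_def)
  qed
  then obtain A where "A \<in> \<S>" and mx: "\<And>W. W \<in> \<S> \<Longrightarrow> A \<subseteq> W \<Longrightarrow> W = A" by auto
  then have A: "B \<subseteq> A" "closed_ring A" "A \<subseteq> F" "inverse u \<notin> A" by (auto simp: \<S>_def)
  \<comment> \<open>By maximality, adjoining any element outside A must produce
    \<open>inverse u\<close>.\<close>
  have adj: "\<exists>p\<in>polys_over A. poly p x = inverse u" if "x \<in> F" "x \<notin> A" for x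
  proof -
    have "A \<noteq> adjoin A x" using adjoin_self[OF A(2)] that by blast
    moreover have "A \<subseteq> adjoin A x" "B \<subseteq> adjoin A x" "closed_ring (adjoin A x)" "adjoin A x \<subseteq> F"
      using adjoin_superset[OF A(2), of x] closed_ring_adjoin[OF A(2), of x] A
        adjoin_subset[OF A(2) closed_fieldD[OF F] A(3) that(1)] by auto
    ultimately have "inverse u \<in> adjoin A x" using mx[of "adjoin A x"] by (auto simp: \<S>_def)
    then show ?thesis by (auto simp: adjoin_def)
  qed
  have uA: "u \<in> A" using u A by auto
  \<comment> \<open>Put w = 1 + u b. If 1/w were outside A, then 1/u would be a polynomial in 1/w of
    some degree n, so w^n/u would lie in A. As w^n has the form 1 + u b', this gives 1/u in
    A.\<close>
  have unit: "1 + u * b \<noteq> 0 \<and> inverse (1 + u * b) \<in> A" if b: "b \<in> A" for b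
  proof
    show ne: "1 + u * b \<noteq> 0"
    proof
      assume "1 + u * b = 0"
      then have "inverse u = - b" using u0 by (simp add: field_simps eq_neg_iff_add_eq_0)
      then show False using A(4) closed_ring_uminus[OF A(2) b] by simp
    qed
    show "inverse (1 + u * b) \<in> A"
    proof (rule ccontr)
      let ?w = "1 + u * b"
      assume "inverse ?w \<notin> A"
      moreover have wA: "?w \<in> A" using uA b by (intro closed_ring_intros[OF A(2)])
      ultimately obtain p where p: "p \<in> polys_over A" "poly p (inverse ?w) = inverse u"
        using adj[of "inverse ?w"] closed_field_inverse[OF F] A(3) by blast
      let ?n = "Polynomial.degree p"
      have "inverse u * ?w ^ ?n = (\<Sum>i\<le>?n. poly.coeff p i * (inverse ?w ^ i * ?w ^ ?n))"
        using p(2)[symmetric] by (simp add: poly_altdef sum_distrib_left sum_distrib_right mult_ac)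
      also have "\<dots> = (\<Sum>i\<le>?n. poly.coeff p i * ?w ^ (?n - i))"
        using ne by (intro sum.cong refl) (auto simp: power_diff field_simps)
      finally have 1: "inverse u * ?w ^ ?n \<in> A"
        using p(1) wA by (auto simp: polys_over_def intro!: closed_ring_intros[OF A(2)])
      have "\<exists>b'\<in>A. ?w ^ j = 1 + u * b'" for j
      proof (induction j)
        case 0 show ?case using closed_ring_0[OF A(2)] by (intro bexI[of _ 0]) auto
      next
        case (Suc j)
        then obtain b' where "b' \<in> A" "?w ^ j = 1 + u * b'" by auto
        then show ?case using b uA
          by (intro bexI[of _ "b + b' + u * b * b'"]) (auto simp: algebra_simps intro!: closed_ring_intros[OF A(2)])
      qed
      then obtain b' where b': "b' \<in> A" "?w ^ ?n = 1 + u * b'" by blast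
      then have "inverse u = inverse u * ?w ^ ?n - b'" using u0 by (simp add: field_simps)
      then show False using A(4) 1 b' closed_ring_diff[OF A(2)] by metis
    qed
  qed
  \<comment> \<open>Suppose x and 1/x both produce 1/u. The relation in 1/x lets
    \<open>power_reduction\<close> rewrite a power of x by lower ones, which shortens a relation in
    x of least degree.\<close>
  have key: False if x: "x \<noteq> 0" and p: "p \<in> polys_over A" "poly p x = inverse u"
    and p': "p' \<in> polys_over A" "poly p' (inverse x) = inverse u" 
    and le: "Polynomial.degree p' \<le> Polynomial.degree p"
    and least: "\<And>r. r \<in> polys_over A \<Longrightarrow> poly r x = inverse u \<Longrightarrow> Polynomial.degree p \<le> Polynomial.degree r"
  for x p p'
  proof -
    let ?n = "Polynomial.degree p" and ?n' = "Polynomial.degree p'"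
    have n'0: "?n' > 0"
    proof (rule ccontr)
      assume "\<not> ?n' > 0"
      then obtain c where "p' = [:c:]" by (metis degree_eq_zeroE gr0I)
      then show False using p' A(4) by (auto simp: polys_over_def dest!: spec[of _ 0])
    qed
    obtain Q where Q: "Q \<in> polys_over A" "x ^ ?n' = u * poly Q x" 
      "Polynomial.degree Q < ?n' \<or> Q = 0"
      using power_reduction[OF A(2) uA u0 x unit p'] by blast
    \<comment> \<open>The leading power of x in p is replaced by x^(n-n') u Q(x), where n and n' are
      the degrees of p and p'.\<close>
    define r where "r = (p - Polynomial.monom (lead_coeff p) ?n) + Polynomial.monom (lead_coeff p * u) (?n - ?n') * Q"
    have lc: "lead_coeff p \<in> A" using p by (auto simp: polys_over_def)
    then have "r \<in> polys_over A" unfolding r_def using p uA Q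
      by (intro polys_over_add polys_over_diff polys_over_mult polys_over_monom closed_ring_mult A)
    moreover have "poly r x = inverse u"
    proof -
      have "x ^ ?n = x ^ (?n - ?n') * x ^ ?n'" using le by (simp flip: power_add)
      then show ?thesis using p Q by (simp add: r_def Polynomial.poly_monom algebra_simps)
    qed
    ultimately have "?n \<le> Polynomial.degree r" using least by blast
    moreover have "Polynomial.degree (p - Polynomial.monom (lead_coeff p) ?n) \<le> ?n - 1"
    proof (rule degree_le, intro allI impI)
      fix i assume "?n - 1 < i"
      then show "poly.coeff (p - Polynomial.monom (lead_coeff p) ?n) i = 0" 
        by (cases "i = ?n") (auto simp: Polynomial.coeff_monom coeff_eq_0)
    qed
    moreover have "Polynomial.degree (Polynomial.monom (lead_coeff p * u) (?n - ?n') * Q) \<le> ?n - 1"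
    proof (cases "Q = 0")
      case False
      have "Polynomial.degree (Polynomial.monom (lead_coeff p * u) (?n - ?n') * Q) \<le> (?n - ?n') + Polynomial.degree Q"
        by (intro order.trans[OF Polynomial.degree_mult_le] add_mono Polynomial.degree_monom_le order.refl)
      then show ?thesis using False Q le by linarith
    qed simp
    ultimately have "?n \<le> ?n - 1" unfolding r_def by (meson degree_add_le order.trans)
    then show False using n'0 le by linarith
  qed
  have "x \<in> A \<or> inverse x \<in> A" if x: "x \<in> F" for x
  proof (rule ccontr)
    assume *: "\<not> (x \<in> A \<or> inverse x \<in> A)"
    then have "x \<noteq> 0" using closed_ring_0[OF A(2)] by auto
    define P where "P = (\<lambda>x n. \<exists>p\<in>polys_over A. poly p x = inverse u \<and> Polynomial.degree p = n)"
    have LE: "\<exists>p\<in>polys_over A. poly p w = inverse u \<and> (\<forall>r\<in>polys_over A. poly r w = inverse u \<longrightarrow> Polynomial.degree p \<le> Polynomial.degree r)"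
      if "w \<in> F" "w \<notin> A" for w
    proof -
      have "\<exists>n. P w n" using adj[OF that] by (auto simp: P_def)
      then have "P w (LEAST n. P w n)" by (metis LeastI)
      moreover have "(LEAST n. P w n) \<le> Polynomial.degree r" if "r \<in> polys_over A" "poly r w = inverse u" for r
        using that by (intro Least_le) (auto simp: P_def)
      ultimately show ?thesis by (auto simp: P_def)
    qed
    obtain p where p: "p \<in> polys_over A" "poly p x = inverse u"
      "\<And>r. r \<in> polys_over A \<Longrightarrow> poly r x = inverse u \<Longrightarrow> Polynomial.degree p \<le> Polynomial.degree r"
      using LE[OF x] * by blast
    obtain p' where p': "p' \<in> polys_over A" "poly p' (inverse x) = inverse u"
      "\<And>r. r \<in> polys_over A \<Longrightarrow> poly r (inverse x) = inverse u \<Longrightarrow> Polynomial.degree p' \<le> Polynomial.degree r"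
      using LE[OF closed_field_inverse[OF F x]] * by blast
    show False
    proof (cases "Polynomial.degree p' \<le> Polynomial.degree p")
      case True
      then show ?thesis using key[OF \<open>x \<noteq> 0\<close> p(1,2) p'(1,2)] p(3) by blast
    next
      case False
      then show ?thesis using key[of "inverse x" p' p] \<open>x \<noteq> 0\<close> p p' by auto
    qed
  qed
  with A show ?thesis using that by blast
qed

section \<open>Translation between closed subsets of a field type and the ring records of
  HOL-Algebra\<close>

lemma as_ring_simps [simp]:
  "carrier (as_ring S) = S" "\<one>\<^bsub>as_ring S\<^esub> = 1" "\<zero>\<^bsub>as_ring S\<^esub> = 0"
  "x \<otimes>\<^bsub>as_ring S\<^esub> y = x * y" "x \<oplus>\<^bsub>as_ring S\<^esub> y = x + y"
  "x \<otimes>\<^bsub>ring_of_type_algebra\<^esub> y = x * y" "x \<oplus>\<^bsub>ring_of_type_algebra\<^esub> y = x + y"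
  "\<one>\<^bsub>ring_of_type_algebra\<^esub> = 1" "\<zero>\<^bsub>ring_of_type_algebra\<^esub> = 0" "carrier ring_of_type_algebra = UNIV"
  by (simp_all add: ring_of_type_algebra_def)

lemma cring_as_ring: "closed_ring S \<Longrightarrow> cring (as_ring S)"
proof -
  assume S: "closed_ring S"
  have neg: "\<exists>y\<in>S. y + x = 0 \<and> x + y = 0" if "x \<in> S" for x
    using closed_ring_uminus[OF S that] by (intro bexI[of _ "- x"]) auto
  show "cring (as_ring S)"
    by unfold_locales (use neg in \<open>auto simp: Units_def algebra_simps intro: closed_ring_intros[OF S]\<close>)
qed

lemma a_inv_as_ring: "closed_ring S \<Longrightarrow> x \<in> S \<Longrightarrow> \<ominus>\<^bsub>as_ring S\<^esub> x = - x"
proof -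
  assume S: "closed_ring S" "x \<in> S"
  interpret cring "as_ring S" by (rule cring_as_ring) fact
  show ?thesis using S by (intro minus_equality) (auto intro: closed_ring_uminus)
qed

lemma field_as_ring: "closed_field S \<Longrightarrow> field (as_ring S)"
proof -
  assume S: "closed_field S"
  interpret cring "as_ring S" by (rule cring_as_ring[OF closed_fieldD[OF S]])
  show ?thesis
  proof (rule cring_fieldI2)
    fix a assume "a \<in> carrier (as_ring S)" "a \<noteq> \<zero>\<^bsub>as_ring S\<^esub>"
    then show "\<exists>b\<in>carrier (as_ring S). a \<otimes>\<^bsub>as_ring S\<^esub> b = \<one>\<^bsub>as_ring S\<^esub>"
      using closed_field_inverse[OF S] by (intro bexI[of _ "inverse a"]) auto
  qed simp
qed

lemma subring_as_ring_iff:
  assumes "closed_ring F"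
  shows "subring A (as_ring F) \<longleftrightarrow> A \<subseteq> F \<and> closed_ring A"
proof
  interpret cring "as_ring F" by (rule cring_as_ring) fact
  show "A \<subseteq> F \<and> closed_ring A" if A: "subring A (as_ring F)"
  proof -
    have AF: "A \<subseteq> F" and one: "1 \<in> A" using subringE(1,3)[OF A] by auto
    have *: "a - b \<in> A \<and> a * b \<in> A" if "a \<in> A" "b \<in> A" for a b
    proof -
      have "\<ominus>\<^bsub>as_ring F\<^esub> b \<in> A" using subringE(5)[OF A] that by blast
      then have "- b \<in> A" using a_inv_as_ring[OF assms] AF that by auto
      then show ?thesis using subringE(6,7)[OF A] that by fastforce
    qed
    show ?thesis using AF one * by (auto simp: closed_ring_def)
  qed
  show "subring A (as_ring F)" if "A \<subseteq> F \<and> closed_ring A"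
  proof (rule subringI)
    fix h assume "h \<in> A"
    then show "\<ominus>\<^bsub>as_ring F\<^esub> h \<in> A"
      using that a_inv_as_ring[OF assms, of h] closed_ring_uminus[of A h] by auto
  qed (use that in \<open>auto intro: closed_ring_intros\<close>)
qed

subsection \<open>Characteristic two\<close>

context
  assumes char: "CHAR('a::field) = 2"
begin

lemma char2_two: "(2::'a) = 0"
  using of_nat_CHAR[where 'a = 'a] by (simp add: char)

lemma char2_add_self: "(x::'a) + x = 0"
  using char2_two by (metis mult_2 mult_zero_left)

lemma char2_add_self_left: "(x::'a) + (x + b) = b"
  by (simp only: add.assoc[symmetric] char2_add_self add_0)

lemma char2_minus_eq_plus: "(x::'a) - b = x + b"
  using char2_add_self[of b] by (simp add: diff_eq_eq add.assoc)

lemma char2_square_add: "((a::'a) + b)\<^sup>2 = a\<^sup>2 + b\<^sup>2"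
  by (simp add: power2_sum char2_two)

lemma char2_frobenius_add: "((a::'a) + b) ^ (2 ^ n) = a ^ (2 ^ n) + b ^ (2 ^ n)"
proof (induction n)
  case (Suc n)
  have "(a + b) ^ 2 ^ Suc n = ((a + b) ^ 2 ^ n)\<^sup>2" by (simp add: power_mult[symmetric] mult.commute)
  also have "\<dots> = (a ^ 2 ^ n)\<^sup>2 + (b ^ 2 ^ n)\<^sup>2" unfolding Suc by (rule char2_square_add)
  also have "\<dots> = a ^ 2 ^ Suc n + b ^ 2 ^ Suc n" by (simp add: power_mult[symmetric] mult.commute)
  finally show ?case .
qed simp

end

subsection \<open>Valuation rings\<close>

text \<open>Properness of A is left to \<open>valuation_ring_iff\<close> and to the locale of finite
  places; at infinity it follows from y being outside A.\<close>

locale val_ring =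
  fixes F A :: "'a::field set"
  assumes F: "closed_field F" and A: "closed_ring A" "A \<subseteq> F"
    and total: "x \<in> F \<Longrightarrow> x \<in> A \<or> inverse x \<in> A"
begin

text \<open>The maximal ideal of nonunits. Zero is listed separately because
  \<open>inverse 0 = 0\<close> lies in A.\<close>

definition mx :: "'a set"
  where "mx = {x \<in> A. x = 0 \<or> inverse x \<notin> A}"

text \<open>Equality of leading terms: same order and same leading coefficient. It allows orders to
  be compared before any uniformizer is known.\<close>

definition approx :: "'a \<Rightarrow> 'a \<Rightarrow> bool"  (infix \<open>\<asymp>\<close> 50)
  where "x \<asymp> y \<longleftrightarrow> x \<in> F \<and> y \<in> F \<and> x \<noteq> 0 \<and> y \<noteq> 0 \<and> x / y - 1 \<in> mx"

lemmas A_intros = closed_ring_intros[OF A(1)]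
lemmas F_intros = closed_ring_intros[OF closed_fieldD[OF F]] closed_field_inverse[OF F] closed_field_divide[OF F]

lemma mx_subset: "x \<in> mx \<Longrightarrow> x \<in> A"
  by (simp add: mx_def)

lemma one_notin_mx: "1 \<notin> mx"
  by (simp add: mx_def A_intros)

lemma unit_inverse: "x \<in> A \<Longrightarrow> x \<notin> mx \<Longrightarrow> inverse x \<in> A"
  by (auto simp: mx_def)

lemma inverse_in_mx: "x \<in> F \<Longrightarrow> x \<notin> A \<Longrightarrow> inverse x \<in> mx"
  using total[of x] by (auto simp: mx_def)

lemma mx_zero: "0 \<in> mx"
  by (simp add: mx_def A_intros)

lemma mx_mult: "x \<in> mx \<Longrightarrow> a \<in> A \<Longrightarrow> x * a \<in> mx"
proof -
  assume x: "x \<in> mx" and a: "a \<in> A"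
  have "inverse x \<in> A" if "x * a \<noteq> 0" "inverse (x * a) \<in> A"
  proof -
    have "inverse x = a * inverse (x * a)" using that by (simp add: field_simps)
    then show ?thesis using A_intros(4)[OF a that(2)] by metis
  qed
  then show ?thesis using x a by (auto simp: mx_def A_intros)
qed

lemma mx_mult': "x \<in> mx \<Longrightarrow> a \<in> A \<Longrightarrow> a * x \<in> mx"
  by (metis mx_mult mult.commute)

text \<open>One of x/y and y/x lies in A, so the summand that divides the other can be factored
  out.\<close>

lemma mx_add: 
  assumes "x \<in> mx" "y \<in> mx" shows "x + y \<in> mx"
proof (cases "x = 0 \<or> y = 0")
  case False
  have "x / y \<in> F" using assms False A by (auto simp: mx_def intro!: F_intros)
  then consider "x / y \<in> A" | "y / x \<in> A" using total[of "x / y"] by fastforce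
  then show ?thesis
  proof cases
    case 1
    have "x + y = y * (x / y + 1)" using False by (simp add: field_simps)
    then show ?thesis using mx_mult[OF assms(2)] A_intros(6)[OF 1 A_intros(2)] by metis
  next
    case 2
    have "x + y = x * (y / x + 1)" using False by (simp add: field_simps)
    then show ?thesis using mx_mult[OF assms(1)] A_intros(6)[OF 2 A_intros(2)] by metis
  qed
qed (use assms in auto)

lemma mx_uminus: "x \<in> mx \<Longrightarrow> - x \<in> mx"
  using mx_mult[of x "- 1"] by (simp add: A_intros)

lemma mx_diff: "x \<in> mx \<Longrightarrow> y \<in> mx \<Longrightarrow> x - y \<in> mx"
  using mx_add[of x "- y"] mx_uminus by simp

lemma mx_sum: "(\<And>i. i \<in> I \<Longrightarrow> f i \<in> mx) \<Longrightarrow> sum f I \<in> mx"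
  by (induction I rule: infinite_finite_induct) (auto simp: mx_zero mx_add)

lemma mx_power: "x \<in> mx \<Longrightarrow> n > 0 \<Longrightarrow> x ^ n \<in> mx"
  by (cases n) (auto intro!: mx_mult intro: A_intros(7) mx_subset)

lemma mx_prime: "x \<in> A \<Longrightarrow> y \<in> A \<Longrightarrow> x * y \<in> mx \<Longrightarrow> x \<in> mx \<or> y \<in> mx"
proof (rule ccontr)
  assume xy: "x \<in> A" "y \<in> A" "x * y \<in> mx" and "\<not> (x \<in> mx \<or> y \<in> mx)"
  then have "inverse x \<in> A" "y \<notin> mx" "x \<noteq> 0" using unit_inverse mx_zero by auto
  with mx_mult[OF xy(3), of "inverse x"] show False by (simp add: field_simps)
qed

lemma integrally_closed_power: "x \<in> F \<Longrightarrow> x ^ n \<in> A \<Longrightarrow> n > 0 \<Longrightarrow> x \<in> A"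
proof (rule ccontr)
  assume x: "x \<in> F" "x ^ n \<in> A" "n > 0" "x \<notin> A"
  then have "inverse x ^ n \<in> mx" using inverse_in_mx mx_power by blast
  then have "inverse x ^ n * x ^ n \<in> mx" using mx_mult x by blast
  moreover have "x \<noteq> 0" using x A_intros(1) by auto
  ultimately show False using one_notin_mx by (simp flip: power_mult_distrib)
qed

lemma mx_power_iff: "x \<in> F \<Longrightarrow> n > 0 \<Longrightarrow> x ^ n \<in> mx \<longleftrightarrow> x \<in> mx"
proof
  assume x: "x \<in> F" "n > 0" "x ^ n \<in> mx"
  then have xA: "x \<in> A" using integrally_closed_power mx_subset by blast
  show "x \<in> mx"
  proof (rule ccontr)
    assume "x \<notin> mx"
    then have "inverse x ^ n \<in> A" "x \<noteq> 0" using unit_inverse[OF xA] mx_zero by (auto intro: A_intros(7))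
    then have "x ^ n * inverse x ^ n \<in> mx" using mx_mult x by blast
    then show False using one_notin_mx \<open>x \<noteq> 0\<close> by (simp flip: power_mult_distrib)
  qed
qed (use mx_power in auto)

lemma one_plus_mx: "n \<in> mx \<Longrightarrow> 1 + n \<in> A \<and> 1 + n \<noteq> 0 \<and> inverse (1 + n) \<in> A"
proof -
  assume n: "n \<in> mx"
  have nA: "1 + n \<in> A" using n mx_subset A_intros(2,6) by auto
  moreover have "1 + n \<notin> mx" using mx_diff[of "1 + n" n] n one_notin_mx by auto
  ultimately show ?thesis using unit_inverse mx_zero by auto
qed

lemma approxI: "x \<in> F \<Longrightarrow> y \<in> F \<Longrightarrow> y \<noteq> 0 \<Longrightarrow> n \<in> mx \<Longrightarrow> x = y * (1 + n) \<Longrightarrow> x \<asymp> y"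
  using one_plus_mx[of n] by (auto simp: approx_def)

lemma approxE:
  assumes "x \<asymp> y" 
  obtains n where "n \<in> mx" "x = y * (1 + n)" "x \<in> F" "y \<in> F" "x \<noteq> 0" "y \<noteq> 0"
  using assms by (auto simp: approx_def intro!: that[of "x / y - 1"])

lemma approx_refl: "x \<in> F \<Longrightarrow> x \<noteq> 0 \<Longrightarrow> x \<asymp> x"
  by (simp add: approx_def mx_zero)

lemma one_plus_mx_inverse:
  assumes n: "n \<in> mx"
  obtains n' where "n' \<in> mx" "inverse (1 + n) = 1 + n'"
proof
  show "inverse (1 + n) = 1 + (- n * inverse (1 + n))"
    using one_plus_mx[OF n] by (simp add: field_simps)
  show "- n * inverse (1 + n) \<in> mx"
    using mx_mult[OF mx_uminus[OF n]] one_plus_mx[OF n] by blast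
qed

lemma approx_inverse: 
  assumes "x \<asymp> y" shows "inverse x \<asymp> inverse y"
proof -
  obtain n where n: "n \<in> mx" "x = y * (1 + n)" "x \<in> F" "y \<in> F" "x \<noteq> 0" "y \<noteq> 0" 
    using assms by (rule approxE)
  obtain n' where "n' \<in> mx" "inverse (1 + n) = 1 + n'" using one_plus_mx_inverse[OF n(1)] .
  moreover have "inverse x \<in> F" "inverse y \<in> F" "inverse y \<noteq> 0" 
    using F_intros(9)[OF n(3)] F_intros(9)[OF n(4)] n(6) by simp_all
  ultimately show ?thesis using n(2) by (intro approxI[of _ _ n']) simp_all
qed

lemma approx_mult:
  assumes "x \<asymp> y" "x' \<asymp> y'" shows "x * x' \<asymp> y * y'"
proof -
  obtain n where n: "n \<in> mx" "x = y * (1 + n)" "x \<in> F" "y \<in> F" "x \<noteq> 0" "y \<noteq> 0" 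
    using assms(1) by (rule approxE)
  obtain n' where n': "n' \<in> mx" "x' = y' * (1 + n')" "x' \<in> F" "y' \<in> F" "x' \<noteq> 0" "y' \<noteq> 0" 
    using assms(2) by (rule approxE)
  have "n + n' + n * n' \<in> mx" using n(1) n'(1) by (intro mx_add mx_mult mx_subset)
  moreover have "x * x' \<in> F" "y * y' \<in> F" "y * y' \<noteq> 0" 
    using F_intros(4)[OF n(3) n'(3)] F_intros(4)[OF n(4) n'(4)] n(6) n'(6) by simp_all
  moreover have "x * x' = y * y' * (1 + (n + n' + n * n'))"
    unfolding n(2) n'(2) by (simp add: algebra_simps)
  ultimately show ?thesis using approxI by blast
qed

lemma approx_power: "x \<asymp> y \<Longrightarrow> x ^ n \<asymp> y ^ n"
  by (induction n) (simp_all add: approx_refl approx_mult F_intros(2))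

lemma approx_divide: "x \<asymp> y \<Longrightarrow> x' \<asymp> y' \<Longrightarrow> x / x' \<asymp> y / y'"
  by (simp add: divide_inverse approx_mult approx_inverse)

lemma approx_sym: assumes "x \<asymp> y" shows "y \<asymp> x"
proof -
  have *: "x \<in> F" "y \<in> F" "x \<noteq> 0" "y \<noteq> 0" using assms by (auto simp: approx_def)
  have "y * x / x \<asymp> y * x / y"
    using * by (intro approx_divide assms approx_refl) (auto intro: F_intros)
  then show ?thesis using * by simp
qed

lemma approx_trans [trans]: assumes "x \<asymp> y" "y \<asymp> w" shows "x \<asymp> w"
proof -
  have *: "x \<in> F" "y \<in> F" "x \<noteq> 0" "y \<noteq> 0" using assms by (auto simp: approx_def)
  have "x / y * y \<asymp> y / y * w"
    using * by (intro approx_mult approx_divide assms approx_refl)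
  then show ?thesis using * by simp
qed

lemma approx_add:
  assumes "x \<in> F" "y \<in> F" "x \<noteq> 0" "y / x \<in> mx" shows "x + y \<asymp> x"
  using assms by (intro approxI[of _ _ "y / x"]) (auto simp: field_simps intro: F_intros)

lemma approx_in_mx: assumes "x \<asymp> y" shows "x \<in> mx \<longleftrightarrow> y \<in> mx"
proof -
  have "y \<in> mx" if xy: "x \<asymp> y" "x \<in> mx" for x y
  proof -
    obtain n where "n \<in> mx" "y = x * (1 + n)" using approxE[OF approx_sym[OF xy(1)]] by blast
    then show ?thesis using mx_mult[OF xy(2)] one_plus_mx by auto
  qed
  then show ?thesis using assms approx_sym by blast
qed

lemma approx_in_A: assumes "x \<asymp> y" shows "x \<in> A \<longleftrightarrow> y \<in> A"
proof -
  have "y \<in> A" if xy: "x \<asymp> y" "x \<in> A" for x y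
  proof -
    obtain n where "n \<in> mx" "y = x * (1 + n)" using approxE[OF approx_sym[OF xy(1)]] by blast
    then show ?thesis using xy one_plus_mx A_intros(4) by auto
  qed
  then show ?thesis using assms approx_sym by blast
qed

text \<open>In characteristic two (x/y - 1)^(2^n) = (x/y)^(2^n) - 1, and an element with a positive
  power in \<open>mx\<close> lies in \<open>mx\<close>. The orders of z, h1 and h2 are found by
  taking such roots.\<close>

lemma approx_root:
  assumes char: "CHAR('a) = 2" and xy: "x \<in> F" "y \<in> F" and ap: "x ^ (2 ^ n) \<asymp> y ^ (2 ^ n)"
  shows "x \<asymp> y"
proof -
  have ne: "x \<noteq> 0" "y \<noteq> 0" using ap by (auto simp: approx_def power_0_left)
  have "(x / y - 1) ^ (2 ^ n) = (x / y) ^ (2 ^ n) - 1"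
    unfolding char2_minus_eq_plus[OF char] char2_frobenius_add[OF char] by simp
  then have "(x / y - 1) ^ (2 ^ n) \<in> mx" using ap by (simp add: approx_def power_divide)
  then have "x / y - 1 \<in> mx" using mx_power_iff[of "x / y - 1" "2 ^ n"] xy by (auto intro: F_intros)
  then show ?thesis using xy ne by (simp add: approx_def)
qed

end

lemma valuation_ring_iff:
  assumes "closed_field F"
  shows "valuation_ring k F A \<longleftrightarrow> val_ring F A \<and> k \<subseteq> A \<and> A \<noteq> F"
  using assms by (auto simp: valuation_ring_def val_ring_def subring_as_ring_iff[OF closed_fieldD])

subsection \<open>Differentials when \<open>F = F\<^sup>2 \<oplus> F\<^sup>2 y\<close>\<close>

text \<open>The assumptions make 1, y a basis of F over its subfield of squares and let
  differentials vanish on constants. Differentials and the Cartier operator are computed from this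
  alone, without the equation of the curve.\<close>

locale char2_ext =
  fixes k F :: "'a::field set" and y :: 'a
  assumes char: "CHAR('a) = 2" and F: "closed_field F" and k: "closed_field k" "k \<subseteq> F"
    and y: "y \<in> F" "\<And>a. a \<in> F \<Longrightarrow> a\<^sup>2 \<noteq> y"
    and decomp: "\<And>x. x \<in> F \<Longrightarrow> \<exists>a\<in>F. \<exists>b\<in>F. x = a\<^sup>2 + b\<^sup>2 * y"
    and k_square: "\<And>c. c \<in> k \<Longrightarrow> \<exists>e\<in>F. c = e\<^sup>2"
begin

lemmas F_intros = closed_ring_intros[OF closed_fieldD[OF F]] closed_field_inverse[OF F] closed_field_divide[OF F]

lemmas two = char2_two[OF char]
lemmas add_self = char2_add_self[OF char]
lemmas square_add = char2_square_add[OF char]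

text \<open>Different coefficients of y would make y the square of (a + a')/(b + b').\<close>

lemma decomp_unique:
  assumes "a \<in> F" "b \<in> F" "a' \<in> F" "b' \<in> F" "a\<^sup>2 + b\<^sup>2 * y = a'\<^sup>2 + b'\<^sup>2 * y"
  shows "a = a'" "b = b'"
proof -
  have "(a + a')\<^sup>2 + (b + b')\<^sup>2 * y = (a\<^sup>2 + b\<^sup>2 * y) + (a'\<^sup>2 + b'\<^sup>2 * y)"
    by (simp add: square_add algebra_simps)
  then have "(a + a')\<^sup>2 + (b + b')\<^sup>2 * y = 0" unfolding assms(5) add_self .
  then have *: "(a + a')\<^sup>2 = (b + b')\<^sup>2 * y"
    by (metis add_self add.commute add_left_cancel)
  have "b + b' = 0"
  proof (rule ccontr)
    assume "b + b' \<noteq> 0"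
    with * have "((a + a') / (b + b'))\<^sup>2 = y" by (simp add: power_divide)
    moreover have "(a + a') / (b + b') \<in> F" using assms by (intro F_intros)
    ultimately show False using y(2) by blast
  qed
  moreover from this * have "a + a' = 0" by simp
  ultimately show "a = a'" "b = b'" by (metis add_self add.commute add_left_cancel)+
qed

text \<open>Both operators come from this coefficient: its square is dx/dy, and
  \<open>cartier_fib\<close> shows that the Cartier operator sends x dy to \<open>odd_root x\<close>
  dy.\<close>

definition odd_root :: "'a \<Rightarrow> 'a"
  where "odd_root x = (THE b. b \<in> F \<and> (\<exists>a\<in>F. x = a\<^sup>2 + b\<^sup>2 * y))"

lemma odd_root_eq: "a \<in> F \<Longrightarrow> b \<in> F \<Longrightarrow> odd_root (a\<^sup>2 + b\<^sup>2 * y) = b"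
  unfolding odd_root_def by (rule the_equality) (blast, metis decomp_unique(2))

lemma odd_root_F: "x \<in> F \<Longrightarrow> odd_root x \<in> F"
  using decomp[of x] odd_root_eq by metis

lemma odd_root_add: "x \<in> F \<Longrightarrow> x' \<in> F \<Longrightarrow> odd_root (x + x') = odd_root x + odd_root x'"
proof -
  assume "x \<in> F" "x' \<in> F"
  then obtain a b a' b' where *: "a \<in> F" "b \<in> F" "a' \<in> F" "b' \<in> F" "x = a\<^sup>2 + b\<^sup>2 * y" "x' = a'\<^sup>2 + b'\<^sup>2 * y"
    using decomp by meson
  then have "x + x' = (a + a')\<^sup>2 + (b + b')\<^sup>2 * y"
    by (simp add: square_add algebra_simps)
  then show ?thesis using * by (simp add: odd_root_eq F_intros)
qed

lemma odd_root_square_mult: "f \<in> F \<Longrightarrow> x \<in> F \<Longrightarrow> odd_root (f\<^sup>2 * x) = f * odd_root x"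
proof -
  assume f: "f \<in> F" and "x \<in> F"
  then obtain a b where *: "a \<in> F" "b \<in> F" "x = a\<^sup>2 + b\<^sup>2 * y" using decomp by meson
  then have "f\<^sup>2 * x = (f * a)\<^sup>2 + (f * b)\<^sup>2 * y"
    by (simp add: algebra_simps power_mult_distrib)
  then show ?thesis using * f by (simp add: odd_root_eq F_intros)
qed

lemma odd_root_square: "a \<in> F \<Longrightarrow> odd_root (a\<^sup>2) = 0"
  using odd_root_eq[of a 0] by (simp add: F_intros)

lemma odd_root_y: "odd_root y = 1"
  using odd_root_eq[of 0 1] by (simp add: F_intros)

lemma odd_root_eq_0_iff: "x \<in> F \<Longrightarrow> odd_root x = 0 \<longleftrightarrow> (\<exists>a\<in>F. x = a\<^sup>2)"
proof
  assume x: "x \<in> F" "odd_root x = 0"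
  then obtain a b where "a \<in> F" "b \<in> F" "x = a\<^sup>2 + b\<^sup>2 * y" using decomp by meson
  moreover from this x have "b = 0" using odd_root_eq by metis
  ultimately show "\<exists>a\<in>F. x = a\<^sup>2" by auto
next
  show "x \<in> F \<Longrightarrow> \<exists>a\<in>F. x = a\<^sup>2 \<Longrightarrow> odd_root x = 0" using odd_root_square by blast
qed

text \<open>The derivation d/dy, since d(a^2 + b^2 y) = b^2 dy.\<close>

definition D :: "'a \<Rightarrow> 'a" where "D x = (odd_root x)\<^sup>2"

lemma D_F: "x \<in> F \<Longrightarrow> D x \<in> F"
  by (simp add: D_def odd_root_F F_intros)

lemma D_add: "x \<in> F \<Longrightarrow> x' \<in> F \<Longrightarrow> D (x + x') = D x + D x'"
  by (simp add: D_def odd_root_add square_add)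

lemma D_square: "x \<in> F \<Longrightarrow> D (x\<^sup>2) = 0"
  by (simp add: D_def odd_root_square)

lemma D_y: "D y = 1"
  by (simp add: D_def odd_root_y)

lemma D_const: "c \<in> k \<Longrightarrow> D c = 0"
  using k_square[of c] D_square by metis

lemma D_mult: "x \<in> F \<Longrightarrow> x' \<in> F \<Longrightarrow> D (x * x') = x * D x' + x' * D x"
proof -
  assume "x \<in> F" "x' \<in> F"
  then obtain a b a' b' where *: "a \<in> F" "b \<in> F" "a' \<in> F" "b' \<in> F" "x = a\<^sup>2 + b\<^sup>2 * y" "x' = a'\<^sup>2 + b'\<^sup>2 * y"
    using decomp by meson
  then have "x * x' = (a * a' + b * b' * y)\<^sup>2 + (a * b' + a' * b)\<^sup>2 * y"
    by (simp add: square_add algebra_simps power_mult_distrib) (simp add: power2_eq_square)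
  then have "D (x * x') = (a * b' + a' * b)\<^sup>2"
    using * y(1) by (simp add: D_def odd_root_eq F_intros)
  moreover have "D x = b\<^sup>2" "D x' = b'\<^sup>2" using * by (simp_all add: D_def odd_root_eq)
  moreover have "x * b'\<^sup>2 + x' * b\<^sup>2 = a\<^sup>2 * b'\<^sup>2 + a'\<^sup>2 * b\<^sup>2 + 2 * (b\<^sup>2 * b'\<^sup>2 * y)"
    using * by (simp add: algebra_simps)
  ultimately show ?thesis by (simp add: two square_add power_mult_distrib)
qed

lemma D_power_even: "x \<in> F \<Longrightarrow> even n \<Longrightarrow> D (x ^ n) = 0"
  using D_square[of "x ^ (n div 2)"] by (auto simp: F_intros simp flip: power_mult)

section \<open>Identification of the Kaehler differentials with F\<close>

abbreviation "M \<equiv> formal_differentials F"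

abbreviation "sgl \<equiv> Poly_Mapping.single"

text \<open>The coefficient of dy in the differential that w represents. Its kernel will be the
  submodule of relations, so it induces the identification of the quotient with F.\<close>

definition Phi :: "('a \<Rightarrow>\<^sub>0 'a) \<Rightarrow> 'a"
  where "Phi w = (\<Sum>x\<in>Poly_Mapping.keys w. Poly_Mapping.lookup w x * D x)"

lemma Phi_superset: "finite S \<Longrightarrow> Poly_Mapping.keys w \<subseteq> S \<Longrightarrow> Phi w = (\<Sum>x\<in>S. Poly_Mapping.lookup w x * D x)"
  unfolding Phi_def by (intro sum.mono_neutral_left) (auto simp: in_keys_iff)

lemma carrier_M: "w \<in> carrier M \<longleftrightarrow> Poly_Mapping.keys w \<subseteq> F \<and> (\<forall>x. Poly_Mapping.lookup w x \<in> F)"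
proof -
  have "Poly_Mapping.range w \<subseteq> F \<longleftrightarrow> (\<forall>x. Poly_Mapping.lookup w x \<in> F)"
    unfolding Poly_Mapping.range.rep_eq
  proof (intro iffI allI)
    fix x assume "Set.range (Poly_Mapping.lookup w) - {0} \<subseteq> F"
    then show "Poly_Mapping.lookup w x \<in> F" using F_intros(1) by (cases "Poly_Mapping.lookup w x = 0") auto
  qed auto
  then show ?thesis by (simp add: formal_differentials_def)
qed

lemma M_simps [simp]: "w \<oplus>\<^bsub>M\<^esub> w' = w + w'" "\<zero>\<^bsub>M\<^esub> = 0"
  "Poly_Mapping.lookup (f \<odot>\<^bsub>M\<^esub> w) x = f * Poly_Mapping.lookup w x"
  by (auto simp: formal_differentials_def Poly_Mapping.map.rep_eq when_def)

lemma M_add: "w \<in> carrier M \<Longrightarrow> w' \<in> carrier M \<Longrightarrow> w + w' \<in> carrier M"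
  using Poly_Mapping.keys_add[of w w'] by (auto simp: carrier_M lookup_add F_intros)

lemma M_smult: "f \<in> F \<Longrightarrow> w \<in> carrier M \<Longrightarrow> f \<odot>\<^bsub>M\<^esub> w \<in> carrier M"
  by (auto simp: carrier_M F_intros in_keys_iff)

lemma M_uminus: "w \<in> carrier M \<Longrightarrow> - w \<in> carrier M"
  by (auto simp: carrier_M F_intros in_keys_iff)

lemma M_diff: "w \<in> carrier M \<Longrightarrow> w' \<in> carrier M \<Longrightarrow> w - w' \<in> carrier M"
  using M_add[OF _ M_uminus, of w w'] by simp

lemma M_0: "0 \<in> carrier M"
  by (simp add: carrier_M F_intros)

lemma M_single: "x \<in> F \<Longrightarrow> f \<in> F \<Longrightarrow> sgl x f \<in> carrier M"
  by (auto simp: carrier_M lookup_single when_def F_intros)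

lemma M_module: "module (as_ring F) M"
proof (rule moduleI)
  show "cring (as_ring F)" using F by (intro cring_as_ring closed_fieldD)
  show "abelian_group M"
  proof (rule abelian_groupI)
    fix w assume "w \<in> carrier M"
    then show "\<exists>w'\<in>carrier M. w' \<oplus>\<^bsub>M\<^esub> w = \<zero>\<^bsub>M\<^esub>"
      by (intro bexI[of _ "- w"]) (auto simp: M_uminus)
  qed (auto simp: M_add M_0 add.assoc add.commute)
qed (auto simp: M_smult lookup_add algebra_simps intro!: poly_mapping_eqI)

lemma Phi_F: "w \<in> carrier M \<Longrightarrow> Phi w \<in> F"
  by (auto simp: Phi_def carrier_M intro!: F_intros D_F)

lemma Phi_add: "Phi (w + w') = Phi w + Phi w'"
proof -
  let ?S = "Poly_Mapping.keys w \<union> Poly_Mapping.keys w'"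
  have "Phi (w + w') = (\<Sum>x\<in>?S. Poly_Mapping.lookup (w + w') x * D x)"
    using Poly_Mapping.keys_add[of w w'] by (intro Phi_superset) auto
  also have "\<dots> = (\<Sum>x\<in>?S. Poly_Mapping.lookup w x * D x) + (\<Sum>x\<in>?S. Poly_Mapping.lookup w' x * D x)"
    by (simp add: lookup_add algebra_simps sum.distrib)
  also have "\<dots> = Phi w + Phi w'" by (simp flip: Phi_superset)
  finally show ?thesis .
qed

lemma Phi_smult: "Phi (f \<odot>\<^bsub>M\<^esub> w) = f * Phi w"
proof -
  have "Phi (f \<odot>\<^bsub>M\<^esub> w) = (\<Sum>x\<in>Poly_Mapping.keys w. Poly_Mapping.lookup (f \<odot>\<^bsub>M\<^esub> w) x * D x)"
    by (intro Phi_superset) (auto simp: in_keys_iff)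
  then show ?thesis by (simp add: Phi_def sum_distrib_left mult.assoc)
qed

lemma Phi_single: "Phi (sgl x f) = f * D x"
  by (simp add: Phi_def)

lemma Phi_0: "Phi 0 = 0"
  by (simp add: Phi_def)

lemma Phi_diff: "Phi (w - w') = Phi w - Phi w'"
  using Phi_add[of "w - w'" w'] by (simp add: algebra_simps)

text \<open>Modulo the relations, \<open>[a\<^sup>2 + b\<^sup>2 y] = b\<^sup>2 [y]\<close> because \<open>[a\<^sup>2] = 2 a [a] = 0\<close>.\<close>

lemma relations_eq_kernel: "kaehler_relations k F = {w \<in> carrier M. Phi w = 0}"
proof -
  interpret M: module "as_ring F" M by (rule M_module)
  let ?add = "{sgl (x + y) 1 - sgl x 1 - sgl y 1
          | x y. x \<in> F \<and> y \<in> F}"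
  let ?mult = "{sgl (x * y) 1 - sgl y x - sgl x y
          | x y. x \<in> F \<and> y \<in> F}"
  let ?cst = "{sgl c 1 | c. c \<in> k}"
  let ?G = "?add \<union> ?mult \<union> ?cst"
  let ?N = "kaehler_relations k F"
  have N_def: "?N = M.span ?G" unfolding kaehler_relations_def ..
  have G: "?G \<subseteq> carrier M"
    using k by (auto simp: F_intros M_single M_diff)
  have GN: "g \<in> ?N" if "g \<in> ?G" for g
    unfolding N_def using M.in_own_span[OF G] that by blast
  have addN: "sgl (x + x') 1 - sgl x 1 - sgl x' 1 \<in> ?N"
    if "x \<in> F" "x' \<in> F" for x x' by (rule GN, rule UnI1, rule UnI1) (use that in blast)
  have multN: "sgl (x * x') 1 - sgl x' x - sgl x x' \<in> ?N"
    if "x \<in> F" "x' \<in> F" for x x' by (rule GN, rule UnI1, rule UnI2) (use that in blast)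
  have sub: "LinearCombinations.submodule (as_ring F) ?N M"
    unfolding N_def by (rule M.span_is_submodule[OF G])
  have N0: "0 \<in> ?N" using LinearCombinations.submodule.zero_closed[OF sub] by simp
  have NA: "w + w' \<in> ?N" if "w \<in> ?N" "w' \<in> ?N" for w w'
    using LinearCombinations.submodule.m_closed[OF sub] that by simp
  have NS: "f \<odot>\<^bsub>M\<^esub> w \<in> ?N" if "w \<in> ?N" "f \<in> F" for f w
    using LinearCombinations.submodule.smult_closed[OF sub] that by auto
  have NC: "?N \<subseteq> carrier M" using LinearCombinations.submodule.subset[OF sub] .
  have smult_single: "f \<odot>\<^bsub>M\<^esub> sgl x c = sgl x (f * c)" for f x c
    by (rule poly_mapping_eqI) (auto simp: lookup_single when_def)
  have self: "w + w = (0::'a \<Rightarrow>\<^sub>0 'a)" for w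
    by (rule poly_mapping_eqI) (simp only: lookup_add add_self lookup_zero)
  have neg: "- w = (w::'a \<Rightarrow>\<^sub>0 'a)" for w
    using self[of w] by (rule minus_unique)
  have sq: "sgl (a\<^sup>2) 1 \<in> ?N" if "a \<in> F" for a
  proof -
    have "sgl (a * a) 1 - sgl a a - sgl a a \<in> ?N"
      using multN[OF that that] .
    then show ?thesis
      by (simp only: power2_eq_square diff_conv_add_uminus neg add.assoc self add_0_right)
  qed
  have red: "sgl x 1 - sgl y (D x) \<in> ?N" if x: "x \<in> F" for x
  proof -
    obtain a b where ab: "a \<in> F" "b \<in> F" "x = a\<^sup>2 + b\<^sup>2 * y" using decomp[OF x] by blast
    have 1: "sgl (a\<^sup>2 + b\<^sup>2 * y) 1 - sgl (a\<^sup>2) 1 - sgl (b\<^sup>2 * y) 1 \<in> ?N"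
      using ab y by (intro addN F_intros)
    have 2: "sgl (b\<^sup>2 * y) 1 - sgl y (b\<^sup>2) - sgl (b\<^sup>2) y \<in> ?N"
      using ab y by (intro multN F_intros)
    have 3: "y \<odot>\<^bsub>M\<^esub> sgl (b\<^sup>2) 1 \<in> ?N" by (intro NS sq ab y)
    have "D x = b\<^sup>2" using ab by (simp add: D_def odd_root_eq)
    moreover have "sgl x 1 - sgl y (b\<^sup>2) =
        (sgl (a\<^sup>2 + b\<^sup>2 * y) 1 - sgl (a\<^sup>2) 1 - sgl (b\<^sup>2 * y) 1)
        + (sgl (b\<^sup>2 * y) 1 - sgl y (b\<^sup>2) - sgl (b\<^sup>2) y)
        + sgl (a\<^sup>2) 1 + y \<odot>\<^bsub>M\<^esub> sgl (b\<^sup>2) 1"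
      unfolding ab(3) smult_single by simp
    ultimately show ?thesis using NA[OF NA[OF NA[OF 1 2] sq[OF ab(1)]] 3] by (simp only:)
  qed
  have Nsum: "finite S \<Longrightarrow> (\<And>s. s \<in> S \<Longrightarrow> f s \<in> ?N) \<Longrightarrow> sum f S \<in> ?N" for f :: "'a \<Rightarrow> 'a \<Rightarrow>\<^sub>0 'a" and S
    by (induction S rule: finite_induct) (auto simp: N0 NA)
  show ?thesis
  proof (intro equalityI subsetI)
    fix w assume w: "w \<in> {w \<in> carrier M. Phi w = 0}"
    let ?K = "Poly_Mapping.keys w"
    let ?f = "\<lambda>x. Poly_Mapping.lookup w x \<odot>\<^bsub>M\<^esub> (sgl x 1 - sgl y (D x))"
    have "(\<Sum>x\<in>?K. ?f x) \<in> ?N"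
      using w by (intro Nsum NS red) (auto simp: carrier_M)
    \<comment> \<open>The subtracted terms add up to \<open>Phi w\<close> times the symbol of y,
      which vanishes by assumption.\<close>
    moreover have "(\<Sum>x\<in>?K. ?f x) = w"
    proof (rule poly_mapping_eqI)
      fix i
      have "Poly_Mapping.lookup (\<Sum>x\<in>?K. ?f x) i
        = (\<Sum>x\<in>?K. Poly_Mapping.lookup w x * (if x = i then 1 else 0)) - (\<Sum>x\<in>?K. Poly_Mapping.lookup w x * D x) * (if y = i then 1 else 0)"
        by (simp add: lookup_sum lookup_minus lookup_single when_def algebra_simps sum_subtractf sum_distrib_right cong: if_cong)
      also have "(\<Sum>x\<in>?K. Poly_Mapping.lookup w x * D x) = 0" using w by (simp add: Phi_def)
      also have "(\<Sum>x\<in>?K. Poly_Mapping.lookup w x * (if x = i then 1 else 0)) = Poly_Mapping.lookup w i"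
        by (simp add: if_distrib cong: if_cong) (simp add: in_keys_iff)
      finally show "Poly_Mapping.lookup (\<Sum>x\<in>?K. ?f x) i = Poly_Mapping.lookup w i" by simp
    qed
    ultimately show "w \<in> ?N" by simp
  next
    fix w assume "w \<in> ?N"
    moreover have "M.span ?G \<subseteq> {w \<in> carrier M. Phi w = 0}"
    proof (rule M.span_is_subset)
      have "Phi g = 0" if "g \<in> ?G" for g
        using that by (auto simp: Phi_diff Phi_single D_add D_mult D_const)
      then show "?G \<subseteq> {w \<in> carrier M. Phi w = 0}" using G by blast
      show "LinearCombinations.submodule (as_ring F) {w \<in> carrier M. Phi w = 0} M"
        by (rule LinearCombinations.submodule.intro) (auto simp: M_module M_add M_0 M_smult Phi_add Phi_0 Phi_smult)
    qed
    ultimately show "w \<in> {w \<in> carrier M. Phi w = 0}" unfolding N_def by blast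
  qed
qed


text \<open>\<open>fib f\<close> is the coset of \<open>f dy\<close>.\<close>

definition fib :: "'a \<Rightarrow> ('a \<Rightarrow>\<^sub>0 'a) set"
  where "fib f = {w \<in> carrier M. Phi w = f}"

lemma fib_single: "f \<in> F \<Longrightarrow> sgl y f \<in> fib f"
  by (simp add: fib_def M_single y Phi_single D_y)

lemma fib_inject: "f \<in> F \<Longrightarrow> fib f = fib g \<longleftrightarrow> f = g"
  using fib_single[of f] by (auto simp: fib_def)

lemma coset_eq: "w \<in> carrier M \<Longrightarrow> kaehler_relations k F +>\<^bsub>M\<^esub> w = fib (Phi w)"
proof (intro equalityI subsetI)
  fix v assume w: "w \<in> carrier M" and v: "v \<in> kaehler_relations k F +>\<^bsub>M\<^esub> w"
  then show "v \<in> fib (Phi w)"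
    by (auto simp: a_r_coset_def' relations_eq_kernel fib_def M_add Phi_add)
next
  fix v assume w: "w \<in> carrier M" and v: "v \<in> fib (Phi w)"
  then have "v - w \<in> kaehler_relations k F"
    by (simp add: relations_eq_kernel fib_def M_diff Phi_diff)
  then show "v \<in> kaehler_relations k F +>\<^bsub>M\<^esub> w"
    unfolding a_r_coset_def' by (intro UN_I[of "v - w"]) auto
qed

abbreviation "KM \<equiv> kaehler k F"

lemma carrier_kaehler: "carrier KM = fib ` F"
proof -
  have "carrier KM = (\<lambda>w. fib (Phi w)) ` carrier M"
    by (auto simp: kaehler_def Let_def A_RCOSETS_def' coset_eq)
  also have "\<dots> = fib ` F"
  proof (intro equalityI subsetI)
    fix v assume "v \<in> fib ` F"
    then obtain f where "f \<in> F" "v = fib f" by auto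
    then show "v \<in> (\<lambda>w. fib (Phi w)) ` carrier M"
      by (intro image_eqI[of _ _ "sgl y f"]) (auto simp: M_single y Phi_single D_y)
  qed (auto simp: Phi_F)
  finally show ?thesis .
qed

lemma zero_kaehler: "\<zero>\<^bsub>KM\<^esub> = fib 0"
  by (simp add: kaehler_def Let_def relations_eq_kernel fib_def)

lemma add_kaehler: "f \<in> F \<Longrightarrow> g \<in> F \<Longrightarrow> fib f \<oplus>\<^bsub>KM\<^esub> fib g = fib (f + g)"
proof -
  assume f: "f \<in> F" and g: "g \<in> F"
  have "set_add M (fib f) (fib g) = fib (f + g)"
  proof (intro equalityI subsetI)
    fix v assume "v \<in> set_add M (fib f) (fib g)"
    then show "v \<in> fib (f + g)" by (auto simp: set_add_def' fib_def M_add Phi_add)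
  next
    fix v assume "v \<in> fib (f + g)"
    then have "v - sgl y g \<in> fib f"
      by (auto simp: fib_def M_diff M_single y g Phi_diff Phi_single D_y)
    then show "v \<in> set_add M (fib f) (fib g)"
      unfolding set_add_def' by (intro UN_I[of "v - sgl y g"] UN_I[OF fib_single[OF g]]) auto
  qed
  then show ?thesis by (simp add: kaehler_def Let_def)
qed

lemma smult_kaehler: "c \<in> F \<Longrightarrow> f \<in> F \<Longrightarrow> c \<odot>\<^bsub>KM\<^esub> fib f = fib (c * f)"
proof -
  assume c: "c \<in> F" and f: "f \<in> F"
  have "c \<odot>\<^bsub>KM\<^esub> fib f = (\<Union>w\<in>fib f. kaehler_relations k F +>\<^bsub>M\<^esub> (c \<odot>\<^bsub>M\<^esub> w))"
    by (simp add: kaehler_def Let_def)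
  also have "\<dots> = (\<Union>w\<in>fib f. fib (c * f))"
    using c by (intro SUP_cong refl) (auto simp: fib_def coset_eq M_smult Phi_smult)
  also have "\<dots> = fib (c * f)" using fib_single[OF f] by blast
  finally show ?thesis .
qed

lemma kaehler_d_eq: "x \<in> F \<Longrightarrow> kaehler_d k F x = fib (D x)"
  by (simp add: kaehler_d_def coset_eq M_single F_intros Phi_single)

text \<open>The subset W covers two uses: the whole module over a valuation ring, and the k-spaces
  of differentials whose dimension is counted.\<close>

lemma kaehler_module:
  assumes A: "closed_ring A" "A \<subseteq> F" and W: "W \<subseteq> F" "0 \<in> W" "\<And>v w. v \<in> W \<Longrightarrow> w \<in> W \<Longrightarrow> v + w \<in> W"
    "\<And>a w. a \<in> A \<Longrightarrow> w \<in> W \<Longrightarrow> a * w \<in> W"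
  shows "module (as_ring A) (KM\<lparr>carrier := fib ` W\<rparr>)"
proof (rule moduleI)
  have WF: "w \<in> F" if "w \<in> W" for w using W that by blast
  have AF: "a \<in> F" if "a \<in> A" for a using A that by blast
  show "cring (as_ring A)" using A by (intro cring_as_ring)
  show "abelian_group (KM\<lparr>carrier := fib ` W\<rparr>)"
  proof (rule abelian_groupI)
    fix v assume "v \<in> carrier (KM\<lparr>carrier := fib ` W\<rparr>)"
    then obtain w where w: "w \<in> W" "v = fib w" by auto
    then show "\<exists>v'\<in>carrier (KM\<lparr>carrier := fib ` W\<rparr>). v' \<oplus>\<^bsub>KM\<lparr>carrier := fib ` W\<rparr>\<^esub> v = \<zero>\<^bsub>KM\<lparr>carrier := fib ` W\<rparr>\<^esub>"
      by (intro bexI[of _ v]) (auto simp: add_kaehler WF add_self zero_kaehler)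
  qed (use W in \<open>auto simp: add_kaehler WF zero_kaehler F_intros add_ac\<close>)
qed (use W A in \<open>auto simp: add_kaehler smult_kaehler subsetD[OF W(1)] subsetD[OF A(2)] F_intros algebra_simps closed_ring_intros\<close>)

lemma kaehler_module': "closed_ring A \<Longrightarrow> A \<subseteq> F \<Longrightarrow> module (as_ring A) KM"
  using kaehler_module[of A F] by (simp add: F_intros subset_iff flip: carrier_kaehler)

text \<open>With a uniformizer as t this turns regularity of f dy at the place into divisibility of
  f by dt/dy in A.\<close>

lemma span_d_eq:
  assumes A: "closed_ring A" "A \<subseteq> F" and t: "t \<in> A" and gen: "\<And>x. x \<in> A \<Longrightarrow> \<exists>a\<in>A. D x = a * D t"
  shows "module.span (as_ring A) KM (kaehler_d k F ` A) = fib ` {a * D t | a. a \<in> A}"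
proof -
  interpret KM: module "as_ring A" KM by (rule kaehler_module'[OF A])
  have AF: "a \<in> F" if "a \<in> A" for a using A that by blast
  have dA: "kaehler_d k F ` A \<subseteq> carrier KM"
    by (auto simp: kaehler_d_eq AF D_F carrier_kaehler)
  show ?thesis
  proof (intro equalityI)
    have "LinearCombinations.submodule (as_ring A) (fib ` {a * D t | a. a \<in> A}) KM"
    proof (rule LinearCombinations.submodule.intro)
      show "module (as_ring A) KM" by (rule kaehler_module'[OF A])
      show "fib ` {a * D t |a. a \<in> A} \<subseteq> carrier KM" by (auto simp: carrier_kaehler AF D_F t F_intros)
      show "v \<oplus>\<^bsub>KM\<^esub> w \<in> fib ` {a * D t |a. a \<in> A}"
        if "v \<in> fib ` {a * D t |a. a \<in> A}" "w \<in> fib ` {a * D t |a. a \<in> A}" for v w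
      proof -
        obtain a b where "a \<in> A" "b \<in> A" "v = fib (a * D t)" "w = fib (b * D t)" using \<open>v \<in> _\<close> \<open>w \<in> _\<close> by auto
        then show ?thesis
          by (intro image_eqI[of _ _ "(a + b) * D t"])
            (auto simp: add_kaehler AF D_F t F_intros algebra_simps intro!: exI[of _ "a + b"] closed_ring_add[OF A(1)])
      qed
      show "\<zero>\<^bsub>KM\<^esub> \<in> fib ` {a * D t |a. a \<in> A}"
        by (auto simp: zero_kaehler intro!: image_eqI[of _ _ 0] exI[of _ 0] closed_ring_0[OF A(1)])
      show "c \<odot>\<^bsub>KM\<^esub> v \<in> fib ` {a * D t |a. a \<in> A}"
        if "c \<in> carrier (as_ring A)" "v \<in> fib ` {a * D t |a. a \<in> A}" for c v
      proof -
        obtain a where "a \<in> A" "v = fib (a * D t)" "c \<in> A" using \<open>v \<in> _\<close> \<open>c \<in> _\<close> by auto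
        then show ?thesis
          by (intro image_eqI[of _ _ "(c * a) * D t"])
            (auto simp: smult_kaehler AF D_F t F_intros mult.assoc intro!: exI[of _ "c * a"] closed_ring_mult[OF A(1)])
      qed
    qed
    moreover have "kaehler_d k F ` A \<subseteq> fib ` {a * D t | a. a \<in> A}"
      using gen by (fastforce simp: kaehler_d_eq AF)
    ultimately show "KM.span (kaehler_d k F ` A) \<subseteq> fib ` {a * D t | a. a \<in> A}"
      by (intro KM.span_is_subset)
  next
    have "fib (a * D t) \<in> KM.span (kaehler_d k F ` A)" if a: "a \<in> A" for a
    proof -
      have "kaehler_d k F t \<in> KM.span (kaehler_d k F ` A)" using KM.in_own_span[OF dA] t by blast
      then have "a \<odot>\<^bsub>KM\<^esub> kaehler_d k F t \<in> KM.span (kaehler_d k F ` A)"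
        using LinearCombinations.submodule.smult_closed[OF KM.span_is_submodule[OF dA]] a by simp
      then show ?thesis using a t by (simp add: kaehler_d_eq smult_kaehler AF D_F)
    qed
    then show "fib ` {a * D t | a. a \<in> A} \<subseteq> KM.span (kaehler_d k F ` A)" by auto
  qed
qed

text \<open>This reduces both invariants to the size of an index set. The family e is a basis as
  soon as it is independent, because W is its span by definition; independence also makes the
  indexing injective.\<close>

lemma dim_fib_image:
  fixes e :: "'i \<Rightarrow> 'a"
  assumes I: "finite I" and e: "\<And>i. i \<in> I \<Longrightarrow> e i \<in> F"
    and indep: "\<And>c. (\<And>i. i \<in> I \<Longrightarrow> c i \<in> k) \<Longrightarrow> (\<Sum>i\<in>I. c i * e i) = 0 \<Longrightarrow> (\<forall>i\<in>I. c i = 0)"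
    and W: "W = {\<Sum>i\<in>I. c i * e i | c. \<forall>i\<in>I. c i \<in> k}"
  shows "vectorspace.dim (as_ring k) (KM\<lparr>carrier := fib ` W\<rparr>) = card I"
proof -
  let ?V = "KM\<lparr>carrier := fib ` W\<rparr>"
  note k_intros = closed_ring_intros[OF closed_fieldD[OF k(1)]]
  have kF: "c \<in> F" if "c \<in> k" for c using k that by blast
  have WF: "W \<subseteq> F" unfolding W using e kF by (auto intro!: F_intros)
  have V: "module (as_ring k) ?V"
  proof (rule kaehler_module[OF closed_fieldD[OF k(1)] k(2) WF])
    show "0 \<in> W" unfolding W by (rule CollectI, rule exI[of _ "\<lambda>_. 0"]) (auto simp: k_intros)
    fix v w a assume "v \<in> W" "w \<in> W"
    then obtain c d where c: "\<forall>i\<in>I. c i \<in> k" "v = (\<Sum>i\<in>I. c i * e i)" and d: "\<forall>i\<in>I. d i \<in> k" "w = (\<Sum>i\<in>I. d i * e i)"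
      unfolding W by auto
    show "v + w \<in> W" unfolding W using c d
      by (intro CollectI exI[of _ "\<lambda>i. c i + d i"]) (auto simp: sum.distrib algebra_simps k_intros)
    assume "a \<in> k"
    then show "a * w \<in> W" unfolding W using d
      by (intro CollectI exI[of _ "\<lambda>i. a * d i"]) (auto simp: sum_distrib_left algebra_simps k_intros)
  qed
  then interpret V: vectorspace "as_ring k" ?V
    using field_as_ring[OF k(1)] by (simp add: vectorspace_def)
  have eW: "e i \<in> W" if "i \<in> I" for i
    unfolding W using that I
    by (intro CollectI exI[of _ "\<lambda>j. if j = i then 1 else 0"]) (auto simp: k_intros if_distrib if_distribR cong: if_cong)
  have inj: "inj_on (\<lambda>i. fib (e i)) I"
  proof (rule inj_onI, rule ccontr)
    fix i j assume ij: "i \<in> I" "j \<in> I" "fib (e i) = fib (e j)" "i \<noteq> j"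
    then have eq: "e i = e j" using fib_inject e by blast
    \<comment> \<open>A repeated vector would give the relation e i + e j = 0 with coefficients 1,
      as the characteristic is two.\<close>
    let ?c = "\<lambda>l. if l = i \<or> l = j then 1 else 0 :: 'a"
    have "(\<Sum>l\<in>I. ?c l * e l) = (\<Sum>l\<in>{i, j}. e l)"
      using ij I by (intro sum.mono_neutral_cong_right) auto
    also have "\<dots> = 0" using ij eq add_self by simp
    finally have "\<forall>l\<in>I. ?c l = 0" by (intro indep) (auto simp: k_intros(1,2))
    then show False using ij by auto
  qed
  let ?B = "(\<lambda>i. fib (e i)) ` I"
  have finsum: "finsum ?V (\<lambda>i. fib (g i)) J = fib (sum g J)" if "finite J" "\<And>i. i \<in> J \<Longrightarrow> g i \<in> W" for g :: "'i \<Rightarrow> 'a" and J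
    using that
  proof (induction J rule: finite_induct)
    case empty
    then show ?case by (simp add: zero_kaehler)
  next
    case (insert j J)
    have "g j \<in> F" "sum g J \<in> F" using insert WF by (auto intro!: F_intros)
    then have "fib (g j) \<oplus>\<^bsub>?V\<^esub> fib (sum g J) = fib (g j + sum g J)" by (simp add: add_kaehler)
    then show ?case using insert by (subst V.finsum_insert) auto
  qed
  have lincomb: "V.lincomb a ?B = fib (\<Sum>i\<in>I. a (fib (e i)) * e i)" if a: "\<And>i. i \<in> I \<Longrightarrow> a (fib (e i)) \<in> k" for a
  proof -
    have W': "a (fib (e i)) * e i \<in> W" if "i \<in> I" for i
      unfolding W using that I a
      by (intro CollectI exI[of _ "\<lambda>j. if j = i then a (fib (e i)) else 0"])
        (auto simp: k_intros if_distrib if_distribR cong: if_cong)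
    have "V.lincomb a ?B = finsum ?V (\<lambda>v. a v \<odot>\<^bsub>?V\<^esub> v) ?B" by (simp add: V.lincomb_def)
    also have "\<dots> = finsum ?V (\<lambda>i. a (fib (e i)) \<odot>\<^bsub>?V\<^esub> fib (e i)) I"
      using inj a eW W' e kF by (subst V.finsum_reindex) (auto simp: smult_kaehler)
    also have "\<dots> = finsum ?V (\<lambda>i. fib (a (fib (e i)) * e i)) I"
      using a W' e kF by (intro V.finsum_cong') (auto simp: smult_kaehler)
    also have "\<dots> = fib (\<Sum>i\<in>I. a (fib (e i)) * e i)" using I W' by (rule finsum)
    finally show ?thesis .
  qed
  have "V.basis ?B"
  proof (subst V.basis_criterion)
    show "finite ?B" "?B \<subseteq> carrier ?V" using I eW by auto
    show "\<forall>v. v \<in> carrier ?V \<longrightarrow> (\<exists>!a. a \<in> ?B \<rightarrow>\<^sub>E carrier (as_ring k) \<and> V.lincomb a ?B = v)"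
    proof (intro allI impI)
      fix v assume "v \<in> carrier ?V"
      then obtain c where c: "\<forall>i\<in>I. c i \<in> k" "v = fib (\<Sum>i\<in>I. c i * e i)"
        unfolding W by auto
      \<comment> \<open>The coefficients are carried over from indices to vectors and restricted,
        because \<open>V.basis_criterion\<close> speaks of extensional functions.\<close>
      define a where "a = restrict (\<lambda>v. c (the_inv_into I (\<lambda>i. fib (e i)) v)) ?B"
      have a: "a (fib (e i)) = c i" if "i \<in> I" for i
        using that inj by (simp add: a_def the_inv_into_f_f[OF inj])
      show "\<exists>!a. a \<in> ?B \<rightarrow>\<^sub>E carrier (as_ring k) \<and> V.lincomb a ?B = v"
      proof (rule ex1I[of _ a])
        have "a \<in> ?B \<rightarrow>\<^sub>E k" using a c by (intro PiE_I) (auto simp: a_def)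
        moreover have "V.lincomb a ?B = v" using a c by (subst lincomb) auto
        ultimately show "a \<in> ?B \<rightarrow>\<^sub>E carrier (as_ring k) \<and> V.lincomb a ?B = v" by simp
        fix b assume b: "b \<in> ?B \<rightarrow>\<^sub>E carrier (as_ring k) \<and> V.lincomb b ?B = v"
        then have bk: "b (fib (e i)) \<in> k" if "i \<in> I" for i using that by (auto simp: PiE_iff)
        have "fib (\<Sum>i\<in>I. b (fib (e i)) * e i) = fib (\<Sum>i\<in>I. c i * e i)" using b c lincomb[of b] bk by simp
        moreover have "(\<Sum>i\<in>I. b (fib (e i)) * e i) \<in> F" using bk kF e by (auto intro!: F_intros)
        ultimately have "(\<Sum>i\<in>I. b (fib (e i)) * e i) = (\<Sum>i\<in>I. c i * e i)" by (simp add: fib_inject)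
        then have 0: "(\<Sum>i\<in>I. (b (fib (e i)) - c i) * e i) = 0" by (simp add: algebra_simps sum_subtractf)
        have "\<forall>i\<in>I. b (fib (e i)) - c i = 0"
          using bk c(1) by (intro indep[OF _ 0] k_intros(3)) auto
        then have eq: "b (fib (e i)) = c i" if "i \<in> I" for i using that by simp
        show "b = a"
        proof (rule PiE_ext)
          show "b \<in> ?B \<rightarrow>\<^sub>E k" using b by simp
          show "a \<in> ?B \<rightarrow>\<^sub>E k" by fact
        qed (use eq a in auto)
      qed
    qed
  qed
  then have "V.dim = card ?B" using I by (intro V.dim_basis) auto
  then show ?thesis using card_image[OF inj] by simp
qed

text \<open>The operator is given by a definite description, so existence and uniqueness are both
  shown. The conditions force dy to 0 and y dy to dy, and then semilinearity fixes the value at (a^2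
  + b^2 y) dy.\<close>

lemma cartier_fib: "f \<in> F \<Longrightarrow> cartier k F (fib f) = fib (odd_root f)"
proof -
  assume f: "f \<in> F"
  define C where "C = restrict (\<lambda>v. fib (odd_root (THE f. f \<in> F \<and> v = fib f))) (fib ` F)"
  have C: "C (fib f) = fib (odd_root f)" if "f \<in> F" for f
  proof -
    have "(THE g. g \<in> F \<and> fib f = fib g) = f" using that fib_inject by (intro the_equality) auto
    then show ?thesis using that by (simp add: C_def)
  qed
  have "is_cartier_operator k F C"
    unfolding is_cartier_operator_def Let_def char carrier_kaehler
  proof (intro conjI ballI)
    show "C \<in> fib ` F \<rightarrow>\<^sub>E fib ` F"
      using C odd_root_F by (intro PiE_I) (auto, simp_all add: C_def)
    show "C (v \<oplus>\<^bsub>KM\<^esub> w) = C v \<oplus>\<^bsub>KM\<^esub> C w" if "v \<in> fib ` F" "w \<in> fib ` F" for v w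
      using that by (auto simp: C add_kaehler F_intros odd_root_F odd_root_add)
    show "C (f\<^sup>2 \<odot>\<^bsub>KM\<^esub> v) = f \<odot>\<^bsub>KM\<^esub> C v" if "f \<in> F" "v \<in> fib ` F" for f v
      using that by (auto simp: C smult_kaehler F_intros odd_root_F odd_root_square_mult)
    show "C (kaehler_d k F f) = \<zero>\<^bsub>KM\<^esub>" if "f \<in> F" for f
      using that by (simp add: kaehler_d_eq C D_F zero_kaehler) (simp add: D_def odd_root_square odd_root_F)
    show "C (f ^ (2 - 1) \<odot>\<^bsub>KM\<^esub> kaehler_d k F f) = kaehler_d k F f" if f: "f \<in> F" for f
    proof -
      obtain a b where ab: "a \<in> F" "b \<in> F" "f = a\<^sup>2 + b\<^sup>2 * y" using decomp[OF f] by blast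
      then have "odd_root f = b" using odd_root_eq by simp
      \<comment> \<open>With D f = b^2, the product (a^2 + b^2 y) b^2 has odd coefficient b^2, which
        is D f again.\<close>
      then have "f * D f = (a * b)\<^sup>2 + (b\<^sup>2)\<^sup>2 * y"
        unfolding D_def ab(3) by (simp add: algebra_simps power_mult_distrib)
      then have "odd_root (f * D f) = D f"
        using odd_root_eq[of "a * b" "b\<^sup>2"] ab \<open>odd_root f = b\<close> by (simp add: F_intros D_def)
      then show ?thesis using f by (simp add: kaehler_d_eq smult_kaehler D_F C F_intros)
    qed
  qed
  moreover have "C' = C" if C': "is_cartier_operator k F C'" for C'
  proof (rule PiE_ext)
    note props = C'[unfolded is_cartier_operator_def Let_def char carrier_kaehler]
    show "C' \<in> fib ` F \<rightarrow>\<^sub>E fib ` F" using props by blast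
    show "C \<in> fib ` F \<rightarrow>\<^sub>E fib ` F"
      using C odd_root_F by (intro PiE_I) (auto, simp_all add: C_def)
    fix v assume "v \<in> fib ` F"
    then obtain f where f: "f \<in> F" "v = fib f" by auto
    obtain a b where ab: "a \<in> F" "b \<in> F" "f = a\<^sup>2 + b\<^sup>2 * y" using decomp[OF f(1)] by blast
    have dy: "kaehler_d k F y = fib 1" using y by (simp add: kaehler_d_eq D_y)
    have 0: "C' (fib 1) = fib 0" using props y dy by (metis zero_kaehler)
    have 1: "C' (fib y) = fib 1"
    proof -
      have "C' (y ^ (2 - 1) \<odot>\<^bsub>KM\<^esub> kaehler_d k F y) = kaehler_d k F y" using props y by blast
      then show ?thesis using y by (simp add: dy smult_kaehler F_intros)
    qed
    have "C' v = C' (fib (a\<^sup>2 * 1) \<oplus>\<^bsub>KM\<^esub> fib (b\<^sup>2 * y))"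
      using f ab y by (simp add: add_kaehler F_intros)
    also have "\<dots> = C' (fib (a\<^sup>2 * 1)) \<oplus>\<^bsub>KM\<^esub> C' (fib (b\<^sup>2 * y))"
    proof -
      have "fib (a\<^sup>2 * 1) \<in> fib ` F" "fib (b\<^sup>2 * y) \<in> fib ` F" using ab y by (auto intro!: F_intros)
      then show ?thesis using props by blast
    qed
    also have "C' (fib (a\<^sup>2 * 1)) = C' (a\<^sup>2 \<odot>\<^bsub>KM\<^esub> fib 1)"
      using ab by (simp add: smult_kaehler F_intros)
    also have "\<dots> = a \<odot>\<^bsub>KM\<^esub> C' (fib 1)" using props ab F_intros(2) by blast
    also have "C' (fib (b\<^sup>2 * y)) = C' (b\<^sup>2 \<odot>\<^bsub>KM\<^esub> fib y)"
      using ab y by (simp add: smult_kaehler F_intros)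
    also have "\<dots> = b \<odot>\<^bsub>KM\<^esub> C' (fib y)" using props ab y by blast
    finally have "C' v = fib b" using 0 1 ab by (simp add: smult_kaehler add_kaehler F_intros)
    then show "C' v = C v" using f ab by (simp add: C odd_root_eq)
  qed
  ultimately have "cartier k F = C" unfolding cartier_def by (rule the_equality)
  then show ?thesis using C f by simp
qed

end

subsection \<open>Uniformizers\<close>

lemma (in val_ring) powi_in_mx:
  assumes "t \<in> mx" "n > 0" shows "t powi n \<in> mx"
proof -
  have "t powi n = t ^ nat n" using assms by (simp add: power_int_def)
  then show ?thesis using assms mx_power[of t "nat n"] by simp
qed

definition (in val_ring) uniformizer :: "'a \<Rightarrow> bool"
  where "uniformizer t \<longleftrightarrow> t \<in> mx \<and> t \<noteq> 0 \<and>
    (\<forall>f\<in>F. f \<noteq> 0 \<longrightarrow> (\<exists>n u. u \<in> A \<and> u \<notin> mx \<and> f = u * t powi n))"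

text \<open>In \<open>x = a\<^sup>2 + b\<^sup>2 t\<close> the two summands have valuations of different parity.\<close>

lemma (in char2_ext) uniformizer_generates:
  assumes "val_ring F A" and t: "val_ring.uniformizer F A t" and Dt: "D t \<noteq> 0" and x: "x \<in> A"
  shows "\<exists>a\<in>A. D x = a * D t"
proof -
  interpret val_ring F A by fact
  have tm: "t \<in> mx" "t \<noteq> 0" and un: "\<And>f. f \<in> F \<Longrightarrow> f \<noteq> 0 \<Longrightarrow> \<exists>n u. u \<in> A \<and> u \<notin> mx \<and> f = u * t powi n"
    using t by (auto simp: uniformizer_def)
  have tF: "t \<in> F" and xF: "x \<in> F" using tm(1) mx_subset A(2) x by auto
  have ot: "odd_root t \<noteq> 0" using Dt by (auto simp: D_def)
  \<comment> \<open>This b cancels the odd part of x + b^2 t, which is therefore a square. Since D x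
    = b^2 D t, only b in A remains to be shown.\<close>
  define b where "b = odd_root x / odd_root t"
  have bF: "b \<in> F" unfolding b_def using odd_root_F tF xF by (intro F_intros(10)) auto
  have xb: "x + b\<^sup>2 * t \<in> F" using xF bF tF by (intro F_intros)
  have "odd_root (x + b\<^sup>2 * t) = odd_root x + b * odd_root t"
    using xF bF tF by (simp add: odd_root_add odd_root_square_mult F_intros(4,7))
  also have "\<dots> = 0" using ot by (simp add: b_def add_self)
  finally obtain a where a: "a \<in> F" "x + b\<^sup>2 * t = a\<^sup>2" using odd_root_eq_0_iff[OF xb] by blast
  have xeq: "x = a\<^sup>2 + b\<^sup>2 * t"
    unfolding a(2)[symmetric] by (simp only: add.assoc add_self add_0_right)
  have Dx: "D x = b\<^sup>2 * D t" using ot by (simp add: D_def b_def power_divide)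
  have "b \<in> A"
  proof (rule ccontr)
    assume bA: "b \<notin> A"
    then have b0: "b \<noteq> 0" using A_intros(1) by auto
    obtain n u where u: "u \<in> A" "u \<notin> mx" "b = u * t powi n" using un[OF bF b0] by auto
    have n: "n < 0"
    proof (rule ccontr)
      assume "\<not> n < 0"
      then have "t powi n = t ^ nat n" by (simp add: power_int_def)
      then have "b \<in> A" unfolding u(3) using u(1) tm mx_subset by (auto intro!: A_intros(4,7))
      then show False using bA by simp
    qed
    have u2: "u\<^sup>2 \<notin> mx" using mx_power_iff[of u 2] u A(2) by auto
    have u2A: "u\<^sup>2 \<in> A" using u by (intro A_intros(7))
    have bsq: "b\<^sup>2 * t = u\<^sup>2 * t powi (2 * n + 1)"
      unfolding u(3) mult_2 power_int_add_1[OF disjI1[OF tm(2)]] power_int_add[OF disjI1[OF tm(2)]]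
      by (simp add: power2_eq_square mult_ac)
    have tp: "t powi i * t powi j = t powi (i + j)" for i j
      using tm(2) by (intro power_int_add[symmetric] disjI1)
    show False
    proof (cases "a = 0")
      case True
      have "u\<^sup>2 = x * t powi (- (2 * n + 1))"
        unfolding xeq True bsq power_zero_numeral add_0 mult.assoc tp by simp
      then have "u\<^sup>2 \<in> mx" using mx_mult'[OF powi_in_mx[OF tm(1)] x, of "- (2 * n + 1)"] n by simp
      then show False using u2 by simp
    next
      case False
      obtain l w where w: "w \<in> A" "w \<notin> mx" "a = w * t powi l" using un[OF a(1) False] by auto
      have w2: "w\<^sup>2 \<notin> mx" using mx_power_iff[of w 2] w A(2) by auto
      have w2A: "w\<^sup>2 \<in> A" using w by (intro A_intros(7))
      have asq: "a\<^sup>2 = w\<^sup>2 * t powi (2 * l)"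
        unfolding w(3) mult_2 power_int_add[OF disjI1[OF tm(2)]] by (simp add: power2_eq_square mult_ac)
      \<comment> \<open>The orders 2l and 2n+1 differ by parity and the smaller one is negative.
        Dividing by that power of t leaves a square of a unit equal to a difference of two elements
        of \<open>mx\<close>.\<close>
      show False
      proof (cases "2 * l > 2 * n + 1")
        case True
        have "x * t powi (- (2 * n + 1)) = w\<^sup>2 * t powi (2 * l - (2 * n + 1)) + u\<^sup>2"
          unfolding xeq asq bsq distrib_right mult.assoc tp by (simp add: algebra_simps)
        then have "u\<^sup>2 = x * t powi (- (2 * n + 1)) - w\<^sup>2 * t powi (2 * l - (2 * n + 1))" by simp
        moreover have "x * t powi (- (2 * n + 1)) \<in> mx"
          using n by (intro mx_mult'[OF powi_in_mx[OF tm(1)] x]) auto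
        moreover have "w\<^sup>2 * t powi (2 * l - (2 * n + 1)) \<in> mx"
          using True by (intro mx_mult'[OF powi_in_mx[OF tm(1)] w2A]) auto
        ultimately show False using u2 mx_diff by simp
      next
        case ln: False
        have "x * t powi (- (2 * l)) = w\<^sup>2 + u\<^sup>2 * t powi (2 * n + 1 - 2 * l)"
          unfolding xeq asq bsq distrib_right mult.assoc tp by (simp add: algebra_simps)
        then have "w\<^sup>2 = x * t powi (- (2 * l)) - u\<^sup>2 * t powi (2 * n + 1 - 2 * l)" by simp
        moreover have "x * t powi (- (2 * l)) \<in> mx"
          using n ln by (intro mx_mult'[OF powi_in_mx[OF tm(1)] x]) auto
        moreover have "u\<^sup>2 * t powi (2 * n + 1 - 2 * l) \<in> mx"
        proof -
          have "2 * n + 1 - 2 * l > 0" using ln by presburger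
          then show ?thesis by (intro mx_mult'[OF powi_in_mx[OF tm(1)] u2A])
        qed
        ultimately show False using w2 mx_diff by simp
      qed
    qed
  qed
  then show ?thesis using Dx A_intros(7) by (intro bexI[of _ "b\<^sup>2"])
qed

subsection \<open>The affine coordinate ring\<close>

text \<open>\<open>cst\<close> embeds the constants. \<open>algebraic\<close> states that every
  element of the ambient field satisfies a nonzero equation with coefficients in k[y]; denominators
  are already cleared.\<close>

locale suzuki =
  fixes cst :: "'k::alg_closed_field \<Rightarrow> 'a::field" and y z :: 'a and m :: nat
  assumes cst_add: "cst (a + b) = cst a + cst b" and cst_mult: "cst (a * b) = cst a * cst b"
    and cst_1: "cst 1 = 1"
    and char: "CHAR('a) = 2" and m: "m > 0"
    and transc: "p \<noteq> 0 \<Longrightarrow> poly (map_poly cst p) y \<noteq> 0"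
    and algebraic: "\<exists>P. P \<noteq> 0 \<and> poly (map_poly (\<lambda>p. poly (map_poly cst p) y) P) x = 0"
    and eq: "z ^ (2 ^ (2 * m + 1)) + z = y ^ (2 ^ m) * (y ^ (2 ^ (2 * m + 1)) + y)"
begin

definition q0 :: nat where "q0 = 2 ^ m"
definition q :: nat where "q = 2 * q0\<^sup>2"

lemma q0_ge: "q0 \<ge> 2" and q0_even: "even q0" and q_even: "even q"
proof -
  obtain j where "m = Suc j" using m by (cases m) auto
  then have "q0 = 2 * 2 ^ j" unfolding q0_def by simp
  then show "q0 \<ge> 2" "even q0" by simp_all
qed (simp add: q_def)

lemma q_alt: "q = 2 ^ (2 * m + 1)"
  by (simp add: q_def q0_def power_mult[symmetric] mult.commute)

lemma q_gt: "q > q0" "q > 1"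
proof -
  have "2 * q0 \<le> q0 * q0" using q0_ge by simp
  then show "q > q0" "q > 1" using q0_ge unfolding q_def power2_eq_square by linarith+
qed

lemma suzuki_eq: "z ^ q + z = y ^ q0 * (y ^ q + y)"
  using eq by (simp add: q_alt q0_def)

lemmas two = char2_two[OF char]
lemmas add_self = char2_add_self[OF char]
lemmas add_self' = char2_add_self_left[OF char]
lemmas minus_eq_plus = char2_minus_eq_plus[OF char]
lemmas square_add = char2_square_add[OF char]

lemma frob: "((a::'a) + b) ^ q0 = a ^ q0 + b ^ q0"
  unfolding q0_def by (rule char2_frobenius_add[OF char])

lemma cst_0: "cst 0 = 0"
  using cst_add[of 0 0] by (metis add_0 add_cancel_right_right)

lemma cst_uminus: "cst (- a) = - cst a"
  using cst_add[of a "- a"] by (simp add: cst_0 eq_neg_iff_add_eq_0 add.commute)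

lemma cst_inverse: "cst (inverse a) = inverse (cst a)"
proof (cases "a = 0")
  case False
  then have "cst a * cst (inverse a) = 1" by (simp add: cst_mult[symmetric] cst_1)
  then show ?thesis by (metis inverse_unique)
qed (simp add: cst_0)

lemma cst_eq_0_iff: "cst a = 0 \<longleftrightarrow> a = 0"
proof
  assume "cst a = 0"
  show "a = 0"
  proof (rule ccontr)
    assume "a \<noteq> 0"
    then have "cst a * cst (inverse a) = 1" by (simp add: cst_mult[symmetric] cst_1)
    then show False using \<open>cst a = 0\<close> by simp
  qed
qed (simp add: cst_0)

lemma cst_power: "cst (a ^ n) = cst a ^ n"
  by (induction n) (auto simp: cst_1 cst_mult)

definition k :: "'a set" where "k = range cst"

lemma closed_field_k: "closed_field k"
proof -
  have "cst a - cst b \<in> k" "cst a * cst b \<in> k" "inverse (cst a) \<in> k" "1 \<in> k" for a b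
  proof -
    have "cst a - cst b = cst (a - b)"
      using cst_add[of a "- b"] by (simp add: cst_uminus)
    then show "cst a - cst b \<in> k" by (simp add: k_def)
    show "1 \<in> k" unfolding k_def by (metis cst_1 rangeI)
  qed (auto simp: k_def cst_mult[symmetric] cst_inverse[symmetric])
  then show ?thesis by (auto simp: closed_field_def closed_ring_def k_def)
qed

lemmas k_intros = closed_ring_intros[OF closed_fieldD[OF closed_field_k]]

lemma cst_k: "cst a \<in> k"
  by (simp add: k_def)

definition R :: "'a set" where "R = adjoin (adjoin k y) z"

lemma closed_ring_R: "closed_ring R"
  unfolding R_def by (intro closed_ring_adjoin closed_fieldD closed_field_k)

lemmas R_intros = closed_ring_intros[OF closed_ring_R]

lemma adjoin_k_R: "adjoin k y \<subseteq> R"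
  unfolding R_def by (intro adjoin_superset closed_ring_adjoin closed_fieldD closed_field_k)

lemma k_R: "c \<in> k \<Longrightarrow> c \<in> R" and y_R: "y \<in> R" and z_R: "z \<in> R"
proof -
  show "c \<in> R" if "c \<in> k"
    using adjoin_superset[OF closed_fieldD[OF closed_field_k]] adjoin_k_R that by blast
  show "y \<in> R" using adjoin_self[OF closed_fieldD[OF closed_field_k]] adjoin_k_R by blast
  show "z \<in> R" unfolding R_def by (intro adjoin_self closed_ring_adjoin closed_fieldD closed_field_k)
qed

lemma R_least: "closed_ring S \<Longrightarrow> k \<subseteq> S \<Longrightarrow> y \<in> S \<Longrightarrow> z \<in> S \<Longrightarrow> R \<subseteq> S"
  unfolding R_def using closed_fieldD[OF closed_field_k] by (intro adjoin_subset closed_ring_adjoin)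

text \<open>A zero denominator only yields 0, because division by zero gives 0; \<open>FE\<close>
  always supplies a nonzero denominator.\<close>

definition F :: "'a set" where "F = {r / s | r s. r \<in> R \<and> s \<in> R}"

lemma FE: 
  assumes "f \<in> F" obtains r s where "r \<in> R" "s \<in> R" "s \<noteq> 0" "f = r / s"
proof -
  obtain r s where "r \<in> R" "s \<in> R" "f = r / s" using assms by (auto simp: F_def)
  then show ?thesis using that[of r s] that[of 0 1] R_intros(1,2) by (cases "s = 0") auto
qed

lemma FI: "r \<in> R \<Longrightarrow> s \<in> R \<Longrightarrow> r / s \<in> F"
  by (auto simp: F_def)

lemma R_F: "r \<in> R \<Longrightarrow> r \<in> F"
  using FI[OF _ R_intros(2), of r] by simp

lemma closed_field_F: "closed_field F"
  unfolding closed_field_def closed_ring_def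
proof (intro conjI ballI)
  show "1 \<in> F" by (intro R_F R_intros)
  fix f g assume f: "f \<in> F" and g: "g \<in> F"
  obtain r s where rs: "r \<in> R" "s \<in> R" "s \<noteq> 0" "f = r / s" using f by (rule FE)
  obtain r' s' where rs': "r' \<in> R" "s' \<in> R" "s' \<noteq> 0" "g = r' / s'" using g by (rule FE)
  have "f - g = (r * s' - r' * s) / (s * s')"
    unfolding rs(4) rs'(4) using rs(3) rs'(3) by (simp add: field_simps)
  also have "\<dots> \<in> F" using rs rs' by (intro FI R_intros)
  finally show "f - g \<in> F" .
  have "f * g = (r * r') / (s * s')" using rs rs' by simp
  also have "\<dots> \<in> F" using rs rs' by (intro FI R_intros)
  finally show "f * g \<in> F" .
  have "inverse f = s / r" using rs by simp
  also have "\<dots> \<in> F" using rs by (intro FI)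
  finally show "inverse f \<in> F" .
qed

lemmas F_intros = closed_ring_intros[OF closed_fieldD[OF closed_field_F]]
  closed_field_inverse[OF closed_field_F] closed_field_divide[OF closed_field_F]

lemma k_F: "c \<in> k \<Longrightarrow> c \<in> F" and y_F: "y \<in> F" and z_F: "z \<in> F"
  using R_F k_R y_R z_R by auto

lemma F_least:
  assumes "closed_field S" "k \<subseteq> S" "y \<in> S" "z \<in> S" shows "F \<subseteq> S"
proof -
  have "R \<subseteq> S" using assms by (intro R_least closed_fieldD)
  then show ?thesis by (auto simp: F_def intro!: closed_field_divide[OF assms(1)])
qed

definition h1 :: 'a where "h1 = z ^ (2 * q0) + y ^ (2 * q0 + 1)"
definition h2 :: 'a where "h2 = y * h1 + z\<^sup>2"

lemma h1_R: "h1 \<in> R" and h2_R: "h2 \<in> R"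
  unfolding h1_def h2_def using y_R z_R by (intro R_intros; simp)+

text \<open>The q0-th power turns z^(2 q0) into z^q, which the curve equation lowers to z; the two
  terms y^(q+q0) cancel.\<close>

lemma h1_pow: "h1 ^ q0 = z + y ^ (q0 + 1)"
proof -
  have "h1 ^ q0 = z ^ q + y ^ (q + q0)"
    unfolding h1_def frob by (simp add: power_mult[symmetric] power_add[symmetric] q_def power2_eq_square algebra_simps)
  also have "z ^ q = z + y ^ q0 * (y ^ q + y)"
    using suzuki_eq by (metis add_self' add.commute)
  finally have "h1 ^ q0 = z + y ^ (q0 + 1) + (y ^ (q + q0) + y ^ (q + q0))"
    by (simp add: power_add algebra_simps)
  then show ?thesis by (simp only: add_self add_0_right)
qed

text \<open>After \<open>h1_pow\<close>, the remaining terms z^(2 q0) and y^(2 q0 + 1) reassemble to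
  h1.\<close>

lemma h2_pow: "h2 ^ q0 = y ^ q0 * z + h1"
proof -
  have "h2 ^ q0 = y ^ q0 * (z + y ^ (q0 + 1)) + z ^ (2 * q0)"
    unfolding h2_def frob power_mult_distrib h1_pow by (simp add: power_mult[symmetric])
  also have "\<dots> = y ^ q0 * z + (z ^ (2 * q0) + y ^ (q0 + (q0 + 1)))"
    unfolding power_add[of y q0 "q0 + 1"] by (simp add: algebra_simps)
  also have "q0 + (q0 + 1) = 2 * q0 + 1" by simp
  finally show ?thesis by (simp only: h1_def)
qed

type_synonym index = "nat \<times> nat \<times> nat \<times> nat"

fun mon :: "index \<Rightarrow> 'a" where "mon (a, b, c, d) = y ^ a * z ^ b * h1 ^ c * h2 ^ d"

text \<open>The pole order of \<open>mon\<close> at infinity.\<close>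

fun wt :: "index \<Rightarrow> nat"
  where "wt (a, b, c, d) = a * q + b * (q + q0) + c * (q + 2 * q0) + d * (q + 2 * q0 + 1)"

definition IX :: "nat \<Rightarrow> index set"
  where "IX n = {(a, b, c, d). b \<le> 1 \<and> c < q0 \<and> d < q0 \<and> wt (a, b, c, d) \<le> n}"

lemma finite_IX: "finite (IX n)"
proof (rule finite_subset)
  show "IX n \<subseteq> {..n} \<times> {..1} \<times> {..<q0} \<times> {..<q0}"
  proof
    fix i assume "i \<in> IX n"
    moreover obtain a b c d where abcd: "i = (a, b, c, d)" by (cases i)
    ultimately have i: "(a, b, c, d) \<in> IX n" by simp
    have "a \<le> a * q" using q_gt by simp
    also have "\<dots> \<le> wt (a, b, c, d)" by (simp only: wt.simps)
    also have "\<dots> \<le> n" using i by (simp add: IX_def)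
    finally show "i \<in> {..n} \<times> {..1} \<times> {..<q0} \<times> {..<q0}" using i by (simp add: abcd IX_def)
  qed
qed auto

text \<open>Defined as a span, so that its dimension can be counted. The description by pole orders
  follows from \<open>L_lead\<close> and \<open>R_lead\<close>.\<close>

definition L :: "nat \<Rightarrow> 'a set"
  where "L n = {\<Sum>i\<in>IX n. c i * mon i | c. \<forall>i\<in>IX n. c i \<in> k}"

lemma L_add: "v \<in> L n \<Longrightarrow> w \<in> L n \<Longrightarrow> v + w \<in> L n"
proof -
  assume "v \<in> L n" "w \<in> L n"
  then obtain c d where "\<forall>i\<in>IX n. c i \<in> k" "v = (\<Sum>i\<in>IX n. c i * mon i)"
    "\<forall>i\<in>IX n. d i \<in> k" "w = (\<Sum>i\<in>IX n. d i * mon i)" by (auto simp: L_def)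
  then show ?thesis unfolding L_def
    by (intro CollectI exI[of _ "\<lambda>i. c i + d i"]) (auto simp: algebra_simps sum.distrib k_intros(6))
qed

lemma L_smult: "a \<in> k \<Longrightarrow> v \<in> L n \<Longrightarrow> a * v \<in> L n"
proof -
  assume a: "a \<in> k" and "v \<in> L n"
  then obtain c where "\<forall>i\<in>IX n. c i \<in> k" "v = (\<Sum>i\<in>IX n. c i * mon i)" by (auto simp: L_def)
  then show ?thesis unfolding L_def using a
    by (intro CollectI exI[of _ "\<lambda>i. a * c i"]) (auto simp: algebra_simps sum_distrib_left k_intros(4))
qed

lemma L_0: "0 \<in> L n"
  unfolding L_def by (intro CollectI exI[of _ "\<lambda>_. 0"]) (auto simp: k_intros(1))

lemma L_sum: "(\<And>i. i \<in> I \<Longrightarrow> f i \<in> L n) \<Longrightarrow> sum f I \<in> L n"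
  by (induction I rule: infinite_finite_induct) (auto simp: L_0 L_add)

lemma mon_IX: "i \<in> IX n \<Longrightarrow> mon i \<in> L n"
proof -
  assume i: "i \<in> IX n"
  have "(\<Sum>j\<in>IX n. (if j = i then 1 else 0) * mon j) = mon i"
    using i finite_IX[of n] by (simp add: if_distrib if_distribR cong: if_cong)
  then show ?thesis unfolding L_def using i
    by (intro CollectI exI[of _ "\<lambda>j. if j = i then 1 else 0"]) (auto simp: k_intros(1,2))
qed

text \<open>The relations \<open>z\<^sup>2 = y h\<^sub>1 + h\<^sub>2\<close>, \<open>h\<^sub>1\<^bsup>q0\<^esup> = y\<^bsup>q0+1\<^esup> + z\<close> and \<open>h\<^sub>2\<^bsup>q0\<^esup> = y\<^bsup>q0\<^esup> z + h\<^sub>1\<close>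
  do not increase the weight, and they lower the sum of the weight and the three last exponents.\<close>

lemma mon_L: "wt i \<le> n \<Longrightarrow> mon i \<in> L n"
proof (induction i rule: measure_induct_rule[where f = "\<lambda>(a, b, c, d). wt (a, b, c, d) + b + c + d"])
  case (less i)
  obtain a b c d where i: "i = (a, b, c, d)" by (cases i)
  have IH: "mon j \<in> L n" 
    if "wt j \<le> n" "(\<lambda>(a, b, c, d). wt (a, b, c, d) + b + c + d) j < wt (a, b, c, d) + b + c + d" for j
    using less.IH[of j] that i by simp
  have le: "wt (a, b, c, d) \<le> n" using less.prems i by simp
  \<comment> \<open>Replacing h1^q0 by z, or h2^q0 by h1, removes weight at least q q0 and adds less
    than 2q. The number e makes q q0 \<ge> 2q available to linear arithmetic.\<close>
  have "2 * q \<le> q * q0" using q0_ge by simp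
  then obtain e where "q * q0 = 2 * q + e" by (auto simp: le_iff_add)
  then have e: "q * q0 = 2 * q + e" "q0 * (q0 * 2) = q" by (auto simp: q_def power2_eq_square)
  consider "b \<ge> 2" | "c \<ge> q0" | "d \<ge> q0" | "b \<le> 1 \<and> c < q0 \<and> d < q0" by linarith
  then show ?case
  proof cases
    case 1
    then obtain b' where b': "b = b' + 2" by (metis add.commute le_Suc_ex)
    have "z\<^sup>2 = y * h1 + h2" by (simp only: h2_def add_self')
    moreover have "mon i = y ^ a * z ^ b' * z\<^sup>2 * h1 ^ c * h2 ^ d"
      by (simp only: i b' mon.simps power_add mult.assoc)
    ultimately have "mon i = mon (a + 1, b', c + 1, d) + mon (a, b', c, d + 1)"
      by (simp add: algebra_simps)
    moreover have "mon (a + 1, b', c + 1, d) \<in> L n"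
      by (rule IH) (use le in \<open>auto simp: b' algebra_simps\<close>)
    moreover have "mon (a, b', c, d + 1) \<in> L n"
      by (rule IH) (use le q_gt in \<open>auto simp: b' algebra_simps\<close>)
    ultimately show ?thesis using L_add by simp
  next
    case 2
    then obtain c' where c': "c = c' + q0" by (metis add.commute le_Suc_ex)
    have "mon i = mon (a + q0 + 1, b, c', d) + mon (a, b + 1, c', d)"
      unfolding i c' by (simp add: h1_pow power_add algebra_simps)
    moreover have "mon (a + q0 + 1, b, c', d) \<in> L n"
      by (rule IH) (use le q0_ge in \<open>auto simp: c' algebra_simps q_def power2_eq_square\<close>)
    moreover have "mon (a, b + 1, c', d) \<in> L n"
      by (rule IH) (use le q_gt e in \<open>auto simp: c' algebra_simps\<close>)
    ultimately show ?thesis using L_add by simp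
  next
    case 3
    then obtain d' where d': "d = d' + q0" by (metis add.commute le_Suc_ex)
    have "mon i = mon (a + q0, b + 1, c, d') + mon (a, b, c + 1, d')"
      unfolding i d' by (simp add: h2_pow power_add algebra_simps)
    moreover have "mon (a + q0, b + 1, c, d') \<in> L n"
      by (rule IH) (use le q0_ge in \<open>auto simp: d' algebra_simps q_def power2_eq_square\<close>)
    moreover have "mon (a, b, c + 1, d') \<in> L n"
      by (rule IH) (use le q_gt e in \<open>auto simp: d' algebra_simps\<close>)
    ultimately show ?thesis using L_add by simp
  next
    case 4
    then have "i \<in> IX n" using le by (simp add: IX_def i)
    then show ?thesis by (rule mon_IX)
  qed
qed

lemma mon_R: "mon i \<in> R"
  using y_R z_R h1_R h2_R by (cases i) (auto intro!: R_intros(4,7))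

lemma L_R: "v \<in> L n \<Longrightarrow> v \<in> R"
  using k_R by (auto simp: L_def intro!: R_intros(8) R_intros(4) mon_R)

lemma L_mono: "n \<le> n' \<Longrightarrow> v \<in> L n \<Longrightarrow> v \<in> L n'"
proof -
  assume n: "n \<le> n'" and "v \<in> L n"
  then obtain c where c: "\<forall>i\<in>IX n. c i \<in> k" "v = (\<Sum>i\<in>IX n. c i * mon i)" by (auto simp: L_def)
  have "c i * mon i \<in> L n'" if "i \<in> IX n" for i
    using c that n by (intro L_smult mon_L) (auto simp: IX_def)
  then show ?thesis using c by (auto intro!: L_sum)
qed

fun add_index :: "index \<Rightarrow> index \<Rightarrow> index"
  where "add_index (a, b, c, d) (a', b', c', d') = (a + a', b + b', c + c', d + d')"

text \<open>A product of two basis monomials may violate the exponent bounds; \<open>mon_L\<close>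
  rewrites it within the same weight.\<close>

lemma L_mult: "v \<in> L n \<Longrightarrow> w \<in> L n' \<Longrightarrow> v * w \<in> L (n + n')"
proof -
  assume "v \<in> L n" "w \<in> L n'"
  then obtain c d where c: "\<forall>i\<in>IX n. c i \<in> k" "v = (\<Sum>i\<in>IX n. c i * mon i)"
    and d: "\<forall>i\<in>IX n'. d i \<in> k" "w = (\<Sum>i\<in>IX n'. d i * mon i)" by (auto simp: L_def)
  have "c i * mon i * (d j * mon j) \<in> L (n + n')" if ij: "i \<in> IX n" "j \<in> IX n'" for i j
  proof -
    have "mon (add_index i j) = mon i * mon j"
      by (cases i; cases j) (simp add: power_add mult_ac)
    moreover have "wt (add_index i j) = wt i + wt j"
      by (cases i; cases j) (simp add: algebra_simps)
    moreover have "wt i \<le> n" "wt j \<le> n'" using ij by (auto simp: IX_def)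
    ultimately have "mon i * mon j \<in> L (n + n')"
      using mon_L[of "add_index i j" "n + n'"] by simp
    moreover have "c i * d j \<in> k" using c d ij by (auto intro!: k_intros(4))
    ultimately have "(c i * d j) * (mon i * mon j) \<in> L (n + n')" using L_smult by blast
    then show ?thesis by (simp add: mult_ac)
  qed
  then show ?thesis unfolding c d sum_product by (intro L_sum)
qed

lemma R_eq: "R = (\<Union>n. L n)"
proof
  have *: "cst a \<in> L 0" for a
  proof -
    have "cst a * mon (0, 0, 0, 0) \<in> L 0" by (intro L_smult mon_L cst_k) simp
    then show ?thesis by simp
  qed
  have "closed_ring (\<Union>n. L n)"
    unfolding closed_ring_def
  proof (intro conjI ballI)
    show "1 \<in> (\<Union>n. L n)" using *[of 1] cst_1 by auto
    fix v w assume "v \<in> (\<Union>n. L n)" "w \<in> (\<Union>n. L n)"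
    then obtain n n' where vw: "v \<in> L n" "w \<in> L n'" by auto
    then have "v + w \<in> L (max n n')"
      using L_add[OF L_mono[OF max.cobounded1 vw(1)] L_mono[OF max.cobounded2 vw(2)]] by blast
    then show "v - w \<in> (\<Union>n. L n)" unfolding minus_eq_plus by blast
    show "v * w \<in> (\<Union>n. L n)" using L_mult[OF vw] by blast
  qed
  moreover have "k \<subseteq> (\<Union>n. L n)" using * by (auto simp: k_def)
  moreover have "y \<in> (\<Union>n. L n)" using mon_L[of "(1, 0, 0, 0)", OF order.refl] by auto
  moreover have "z \<in> (\<Union>n. L n)" using mon_L[of "(0, 1, 0, 0)", OF order.refl] by auto
  ultimately show "R \<subseteq> (\<Union>n. L n)" by (rule R_least)
qed (use L_R in auto)

end

subsection \<open>The place at infinity\<close>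

context suzuki
begin

lemma q_sq: "q = 2 * (q0 * q0)"
  by (simp add: q_def power2_eq_square)

lemma power_eqI: "i * j = n \<Longrightarrow> ((x::'a) ^ i) ^ j = x ^ n"
  by (simp add: power_mult[symmetric])

text \<open>As q = 2 q0^2, the weight is a mixed-radix number. Its residue modulo q0 is d, the
  parity of the quotient is b, and once d is subtracted c is again a residue modulo q0; the last
  quotient is a + b + c + d.\<close>

lemma wt_inj:
  assumes "b \<le> 1" "c < q0" "d < q0" "b' \<le> 1" "c' < q0" "d' < q0"
    and eq: "wt (a, b, c, d) = wt (a', b', c', d')"
  shows "(a, b, c, d) = (a', b', c', d')"
proof -
  have wt: "wt (a, b, c, d) = (2 * ((a + b + c + d) * q0 + c + d) + b) * q0 + d" for a b c d
    by (simp add: q_def power2_eq_square algebra_simps)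
  let ?S = "\<lambda>a b c d. 2 * ((a + b + c + d) * q0 + c + d) + b"
  have d: "d = d'" using arg_cong[OF eq, of "\<lambda>n. n mod q0"] assms unfolding wt by simp
  have S: "?S a b c d = ?S a' b' c' d'" using arg_cong[OF eq, of "\<lambda>n. n div q0"] assms unfolding wt by simp
  have "2 * u + b = 2 * u' + b' \<Longrightarrow> b = b'" for u u' using assms(1,4) by presburger
  then have b: "b = b'" using S by blast
  have T: "(a + b + c + d) * q0 + c = (a' + b' + c' + d') * q0 + c'" using S d b by simp
  have c: "c = c'" using arg_cong[OF T, of "\<lambda>n. n mod q0"] assms by simp
  have "a + b + c + d = a' + b' + c' + d'" using arg_cong[OF T, of "\<lambda>n. n div q0"] assms by simp
  then show ?thesis using b c d by simp
qed

lemma wt_inj_IX: "i \<in> IX n \<Longrightarrow> j \<in> IX n \<Longrightarrow> wt i = wt j \<Longrightarrow> i = j"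
proof -
  assume ij: "i \<in> IX n" "j \<in> IX n" "wt i = wt j"
  obtain a b c d a' b' c' d' where "i = (a, b, c, d)" "j = (a', b', c', d')" by (cases i; cases j)
  with ij show ?thesis using wt_inj[of b c d b' c' d' a a'] by (simp add: IX_def del: wt.simps)
qed

definition t :: 'a where "t = h1 / h2"

lemma t_F: "t \<in> F"
  unfolding t_def by (intro F_intros(10) R_F h1_R h2_R)

text \<open>Multiplying such a representation by y^n gives a monic equation of degree n + 1 for y
  over k, against transcendence.\<close>

lemma y_notin_adjoin: "y \<notin> adjoin k (inverse y)"
proof
  assume "y \<in> adjoin k (inverse y)"
  then obtain p where p: "p \<in> polys_over k" "y = poly p (inverse y)" by (auto simp: adjoin_def)
  have y0: "y \<noteq> 0" using transc[of "[:0, 1:]"] by (auto simp: cst_0 cst_1 map_poly_pCons)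
  define n where "n = Polynomial.degree p"
  have "\<forall>i. \<exists>a. poly.coeff p i = cst a" using p by (auto simp: polys_over_def k_def)
  then obtain a where a: "\<And>i. poly.coeff p i = cst (a i)" by metis
  define P where "P = Polynomial.monom 1 (Suc n) + (\<Sum>i\<le>n. Polynomial.monom (a i) (n - i))"
  have ev: "poly (map_poly cst P) y = (\<Sum>i\<le>Suc n. cst (poly.coeff P i) * y ^ i)"
  proof -
    have "Polynomial.degree P \<le> Suc n"
      unfolding P_def by (intro degree_add_le degree_sum_le order.trans[OF Polynomial.degree_monom_le]) auto
    then have "Polynomial.degree (map_poly cst P) \<le> Suc n" 
      by (intro degree_le allI impI) (simp add: coeff_map_poly cst_0 coeff_eq_0)
    then have "poly (map_poly cst P) y = (\<Sum>i\<le>Suc n. poly.coeff (map_poly cst P) i * y ^ i)"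
      unfolding poly_altdef by (intro sum.mono_neutral_left) (auto simp: coeff_eq_0)
    then show ?thesis by (simp add: coeff_map_poly cst_0)
  qed
  have coeff: "poly.coeff P i = (if i = Suc n then 1 else 0) + (if i \<le> n then a (n - i) else 0)" for i
  proof -
    have "(\<Sum>j\<le>n. if n - j = i then a j else 0) = (\<Sum>j\<in>(if i \<le> n then {n - i} else {}). a j)"
      by (rule sum.mono_neutral_cong_right) (auto split: if_splits)
    then show ?thesis by (auto simp: P_def coeff_sum Polynomial.coeff_monom)
  qed
  have "poly.coeff P (Suc n) = 1" by (simp add: coeff)
  then have "P \<noteq> 0" by auto
  moreover have "poly (map_poly cst P) y = y ^ Suc n + (\<Sum>i\<le>n. cst (a (n - i)) * y ^ i)"
    unfolding ev by (simp add: coeff cst_1 algebra_simps)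
  moreover have "(\<Sum>i\<le>n. cst (a (n - i)) * y ^ i) = (\<Sum>i\<le>n. cst (a i) * y ^ (n - i))"
    by (rule sum.reindex_bij_witness[of _ "\<lambda>i. n - i" "\<lambda>i. n - i"]) auto
  moreover have "\<dots> = y ^ n * (\<Sum>i\<le>n. cst (a i) * inverse y ^ i)"
    unfolding sum_distrib_left using y0 by (intro sum.cong refl) (auto simp: power_diff field_simps)
  moreover have "(\<Sum>i\<le>n. cst (a i) * inverse y ^ i) = y"
    using p(2) by (simp add: poly_altdef a n_def)
  ultimately show False using transc[of P] add_self[of "y ^ Suc n"] by (simp add: mult.commute)
qed

text \<open>\<open>exists_valuation_ring\<close> is applied to k[1/y] with u = 1/y, so the excluded
  inverse is y itself.\<close>

lemma exists_infinite_place: "\<exists>A. val_ring F A \<and> k \<subseteq> A \<and> y \<notin> A"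
proof -
  let ?B = "adjoin k (inverse y)"
  note kc = closed_fieldD[OF closed_field_k]
  have "?B \<subseteq> F" using k_F y_F by (intro adjoin_subset kc closed_fieldD closed_field_F F_intros(9)) auto
  then obtain A where "?B \<subseteq> A" "closed_ring A" "A \<subseteq> F" "y \<notin> A" "\<And>x. x \<in> F \<Longrightarrow> x \<in> A \<or> inverse x \<in> A"
    using exists_valuation_ring[OF closed_field_F closed_ring_adjoin[OF kc] _ adjoin_self[OF kc], of "inverse y"]
      y_notin_adjoin by auto
  moreover have "k \<subseteq> ?B" by (rule adjoin_superset[OF kc])
  ultimately show ?thesis using closed_field_F by (intro exI[of _ A]) (auto simp: val_ring_def)
qed

end

text \<open>All estimates are made at an arbitrary valuation ring without y, so the uniqueness of
  the point at infinity is not presupposed.\<close>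

locale suzuki_infinite_place = suzuki cst y z m + V: val_ring "suzuki.F cst y z" A
  for cst :: "'k::alg_closed_field \<Rightarrow> 'a::field" and y z :: 'a and m :: nat and A :: "'a set" +
  assumes k_A: "k \<subseteq> A" and y_A: "y \<notin> A"
begin

lemma const_unit: "c \<in> k \<Longrightarrow> c \<noteq> 0 \<Longrightarrow> c \<in> A \<and> c \<notin> V.mx"
  using k_A closed_field_inverse[OF closed_field_k, of c] by (auto simp: V.mx_def)

lemma y_nonzero: "y \<noteq> 0"
  using y_A V.A_intros(1) by auto

lemma w_mx: "inverse y \<in> V.mx"
  using V.inverse_in_mx[OF y_F y_A] .

lemma power_ratio_mx: "inverse x \<in> V.mx \<Longrightarrow> x \<noteq> 0 \<Longrightarrow> i < j \<Longrightarrow> x ^ i / x ^ j \<in> V.mx"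
proof -
  assume x: "inverse x \<in> V.mx" "x \<noteq> 0" "i < j"
  then have "x ^ i / x ^ j = inverse x ^ (j - i)" by (simp add: power_diff field_simps)
  then show ?thesis using V.mx_power[OF x(1), of "j - i"] x(3) by simp
qed

lemma approx_root_q0: "x \<in> F \<Longrightarrow> x' \<in> F \<Longrightarrow> V.approx (x ^ q0) (x' ^ q0) \<Longrightarrow> V.approx x x'"
  using V.approx_root[OF char, of x x' m] by (simp add: q0_def)

lemma approx_root_2q0: "x \<in> F \<Longrightarrow> x' \<in> F \<Longrightarrow> V.approx (x ^ (2 * q0)) (x' ^ (2 * q0)) \<Longrightarrow> V.approx x x'"
  using V.approx_root[OF char, of x x' "Suc m"] by (simp add: q0_def)

lemma mx_of_power: "x \<in> F \<Longrightarrow> n > 0 \<Longrightarrow> V.approx (x ^ n) x' \<Longrightarrow> x' \<in> V.mx \<Longrightarrow> x \<in> V.mx"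
  using V.approx_in_mx V.mx_power_iff by blast

lemma rhs_approx: "V.approx (y ^ q0 * (y ^ q + y)) (y ^ (q + q0))"
proof -
  have "V.approx (y ^ q + y) (y ^ q)"
    using y_nonzero y_F power_ratio_mx[OF w_mx, of 1 q] q_gt by (intro V.approx_add F_intros(7)) auto
  then have "V.approx (y ^ q0 * (y ^ q + y)) (y ^ q0 * y ^ q)"
    using y_nonzero y_F by (intro V.approx_mult V.approx_refl F_intros(7)) auto
  then show ?thesis by (simp add: power_add mult.commute)
qed

lemma z_A: "z \<notin> A"
proof
  assume "z \<in> A"
  then have "z ^ q + z \<in> A" by (intro V.A_intros(6,7))
  then have "y ^ (q + q0) \<in> A" using V.approx_in_A[OF rhs_approx] suzuki_eq by simp
  then have "y \<in> A" using V.integrally_closed_power[OF y_F, of "q + q0"] q_gt by simp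
  then show False using y_A by simp
qed

lemma z_nonzero: "z \<noteq> 0"
  using z_A V.A_intros(1) by auto

text \<open>The leading terms of the curve equation give z^q ~ y^(q+q0), and both sides are q0-th
  powers.\<close>

lemma z_approx_y: "V.approx (z ^ (2 * q0)) (y ^ (2 * q0 + 1))"
proof -
  have "V.approx (z ^ q + z) (z ^ q)"
    using z_nonzero z_F power_ratio_mx[OF V.inverse_in_mx[OF z_F z_A], of 1 q] q_gt
    by (intro V.approx_add F_intros(7)) auto
  from V.approx_trans[OF V.approx_sym[OF this]] have "V.approx (z ^ q) (y ^ (q + q0))"
    using rhs_approx suzuki_eq by simp
  moreover have "(z ^ (2 * q0)) ^ q0 = z ^ q" "(y ^ (2 * q0 + 1)) ^ q0 = y ^ (q + q0)"
    by (intro power_eqI; simp add: q_sq algebra_simps)+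
  ultimately have "V.approx ((z ^ (2 * q0)) ^ q0) ((y ^ (2 * q0 + 1)) ^ q0)" by (simp only:)
  then show ?thesis by (rule approx_root_q0[OF F_intros(7)[OF z_F] F_intros(7)[OF y_F]])
qed

text \<open>In h1^q0 = z + y^(q0+1) the second term dominates. This is checked on 2 q0-th powers,
  where \<open>z_approx_y\<close> expresses z through y.\<close>

lemma h1_approx_y: "V.approx (h1 ^ q0) (y ^ (q0 + 1))"
proof -
  have "V.approx ((z / y ^ (q0 + 1)) ^ (2 * q0)) (y ^ (2 * q0 + 1) / (y ^ (q0 + 1)) ^ (2 * q0))"
    unfolding power_divide using z_approx_y y_F y_nonzero
    by (intro V.approx_divide V.approx_refl F_intros(7)) auto
  moreover have "(y ^ (q0 + 1)) ^ (2 * q0) = y ^ (q + 2 * q0)"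
    by (intro power_eqI) (simp add: q_sq algebra_simps)
  moreover have "y ^ (2 * q0 + 1) / y ^ (q + 2 * q0) \<in> V.mx"
    using q_gt by (intro power_ratio_mx w_mx y_nonzero) auto
  moreover have "z / y ^ (q0 + 1) \<in> F" using y_F z_F by (intro F_intros(7,10))
  ultimately have "z / y ^ (q0 + 1) \<in> V.mx" using mx_of_power[of _ "2 * q0"] q0_ge by simp
  then have "V.approx (y ^ (q0 + 1) + z) (y ^ (q0 + 1))"
    using y_F z_F y_nonzero by (intro V.approx_add F_intros(7)) auto
  then show ?thesis unfolding h1_pow by (simp add: add.commute)
qed

lemma h1_F: "h1 \<in> F"
  by (rule R_F[OF h1_R])

lemma h1_nonzero: "h1 \<noteq> 0"
  using h1_approx_y q0_ge by (auto simp: V.approx_def power_0_left)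

text \<open>In h2^q0 = y^q0 z + h1 the first term dominates, again by comparing 2 q0-th
  powers.\<close>

lemma h2_approx_yz: "V.approx (h2 ^ q0) (y ^ q0 * z)"
proof -
  have eq: "(h1 / (y ^ q0 * z)) ^ (2 * q0) = (h1 ^ q0)\<^sup>2 / (y ^ q * z ^ (2 * q0))"
    unfolding power_divide power_mult_distrib
    by (intro arg_cong2[where f = "(/)"] arg_cong2[where f = "(*)"] refl power_eqI)
      (simp_all add: power_mult[symmetric] q_sq mult_ac)
  have "V.approx ((h1 ^ q0)\<^sup>2 / (y ^ q * z ^ (2 * q0))) ((y ^ (q0 + 1))\<^sup>2 / (y ^ q * y ^ (2 * q0 + 1)))"
    using z_approx_y h1_approx_y y_F y_nonzero
    by (intro V.approx_divide V.approx_mult V.approx_power V.approx_refl F_intros(7)) auto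
  moreover have "(y ^ (q0 + 1))\<^sup>2 / (y ^ q * y ^ (2 * q0 + 1)) = y ^ (2 * q0 + 2) / y ^ (q + (2 * q0 + 1))"
    unfolding power_add[of y q, symmetric] by (intro arg_cong2[where f = "(/)"] refl power_eqI) simp
  moreover have "y ^ (2 * q0 + 2) / y ^ (q + (2 * q0 + 1)) \<in> V.mx"
    using q_gt by (intro power_ratio_mx w_mx y_nonzero) auto
  moreover have "h1 / (y ^ q0 * z) \<in> F" using y_F z_F h1_F by (intro F_intros(4,7,10))
  moreover have "0 < 2 * q0" using q0_ge by simp
  ultimately have "h1 / (y ^ q0 * z) \<in> V.mx" using mx_of_power[of "h1 / (y ^ q0 * z)" "2 * q0"] eq by metis
  then show ?thesis unfolding h2_pow
    using y_F z_F h1_F y_nonzero z_nonzero by (intro V.approx_add F_intros(4,7)) auto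
qed

lemma h2_nonzero: "h2 \<noteq> 0"
  using h2_approx_yz q0_ge by (auto simp: V.approx_def power_0_left)

lemma t_nonzero: "t \<noteq> 0"
  by (simp add: t_def h1_nonzero h2_nonzero)

text \<open>Here t^q0 ~ y/z, and the 2 q0-th power of y/z is ~ 1/y because z^(2 q0) ~ y^(2 q0 +
  1).\<close>

lemma t_approx: "V.approx (t ^ q) (inverse y)"
proof -
  have "V.approx (t ^ q0) (y ^ (q0 + 1) / (y ^ q0 * z))"
    unfolding t_def power_divide by (intro V.approx_divide h1_approx_y h2_approx_yz)
  then have "V.approx (t ^ q0) (y / z)" using y_nonzero by simp
  then have "V.approx ((t ^ q0) ^ (2 * q0)) ((y / z) ^ (2 * q0))" by (rule V.approx_power)
  also have "V.approx ((y / z) ^ (2 * q0)) (y ^ (2 * q0) / y ^ (2 * q0 + 1))"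
    unfolding power_divide using z_approx_y y_F y_nonzero by (intro V.approx_divide V.approx_refl F_intros(7)) auto
  also have "y ^ (2 * q0) / y ^ (2 * q0 + 1) = inverse y" using y_nonzero by (simp add: field_simps)
  also have "(t ^ q0) ^ (2 * q0) = t ^ q" by (intro power_eqI) (simp add: q_sq)
  finally show ?thesis .
qed

text \<open>The inverse of t, so that pole orders are natural exponents.\<close>

definition \<tau> :: 'a where "\<tau> = inverse t"

lemma \<tau>_F: "\<tau> \<in> F" and \<tau>_nonzero: "\<tau> \<noteq> 0"
  using t_F t_nonzero by (auto simp: \<tau>_def intro: F_intros(9))

lemma t_mx: "t \<in> V.mx"
  using mx_of_power[OF t_F _ t_approx w_mx] q_gt by simp

lemma y_\<tau>: "V.approx y (\<tau> ^ q)"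
  using V.approx_sym[OF V.approx_inverse[OF t_approx]] by (simp add: \<tau>_def power_inverse)

lemma z_\<tau>: "V.approx z (\<tau> ^ (q + q0))"
proof -
  have "V.approx (z ^ (2 * q0)) ((\<tau> ^ q) ^ (2 * q0 + 1))"
    by (rule V.approx_trans[OF z_approx_y V.approx_power[OF y_\<tau>]])
  also have "(\<tau> ^ q) ^ (2 * q0 + 1) = (\<tau> ^ (q + q0)) ^ (2 * q0)"
    unfolding power_mult[symmetric] by (intro arg_cong[where f = "(^) \<tau>"]) (simp add: q_sq algebra_simps)
  finally show ?thesis by (rule approx_root_2q0[OF z_F F_intros(7)[OF \<tau>_F]])
qed

lemma h1_\<tau>: "V.approx h1 (\<tau> ^ (q + 2 * q0))"
proof -
  have "V.approx (h1 ^ q0) ((\<tau> ^ q) ^ (q0 + 1))"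
    by (rule V.approx_trans[OF h1_approx_y V.approx_power[OF y_\<tau>]])
  also have "(\<tau> ^ q) ^ (q0 + 1) = (\<tau> ^ (q + 2 * q0)) ^ q0"
    unfolding power_mult[symmetric] by (intro arg_cong[where f = "(^) \<tau>"]) (simp add: q_sq algebra_simps)
  finally show ?thesis by (rule approx_root_q0[OF h1_F F_intros(7)[OF \<tau>_F]])
qed

lemma h2_\<tau>: "V.approx h2 (\<tau> ^ (q + 2 * q0 + 1))"
proof -
  have "V.approx (h1 * \<tau>) (\<tau> ^ (q + 2 * q0) * \<tau>)"
    using \<tau>_F \<tau>_nonzero by (intro V.approx_mult h1_\<tau> V.approx_refl)
  moreover have "h1 * \<tau> = h2" using h1_nonzero by (simp add: \<tau>_def t_def)
  ultimately show ?thesis by (simp only: power_add power_one_right)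
qed

lemma mon_\<tau>: "V.approx (mon i) (\<tau> ^ wt i)"
proof -
  obtain a b c d where i: "i = (a, b, c, d)" by (cases i)
  have "V.approx (mon i) ((\<tau> ^ q) ^ a * (\<tau> ^ (q + q0)) ^ b * (\<tau> ^ (q + 2 * q0)) ^ c * (\<tau> ^ (q + 2 * q0 + 1)) ^ d)"
    unfolding i mon.simps by (intro V.approx_mult V.approx_power y_\<tau> z_\<tau> h1_\<tau> h2_\<tau>)
  also have "\<dots> = \<tau> ^ wt i"
    unfolding power_mult[symmetric] power_add[symmetric] i wt.simps by (simp only: mult.commute)
  finally show ?thesis .
qed

lemma \<tau>_ratio: "i < j \<Longrightarrow> \<tau> ^ i / \<tau> ^ j \<in> V.mx"
  using power_ratio_mx[of \<tau>] t_mx \<tau>_nonzero by (simp add: \<tau>_def)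

text \<open>The weights in \<open>IX n\<close> are distinct, so a single term with nonzero
  coefficient has the largest weight and dominates the sum.\<close>

lemma lincomb_lead:
  assumes c: "\<And>i. i \<in> IX n \<Longrightarrow> c i \<in> k" and ne: "\<exists>i\<in>IX n. c i \<noteq> 0"
  obtains i where "i \<in> IX n" "c i \<noteq> 0" "V.approx (\<Sum>j\<in>IX n. c j * mon j) (c i * \<tau> ^ wt i)"
    "\<And>j. j \<in> IX n \<Longrightarrow> c j \<noteq> 0 \<Longrightarrow> wt j \<le> wt i"
proof -
  define J where "J = {j \<in> IX n. c j \<noteq> 0}"
  have J: "finite J" "J \<noteq> {}" using finite_IX[of n] ne by (auto simp: J_def)
  have "Max (wt ` J) \<in> wt ` J" using J by (intro Max_in) auto
  then obtain i where i: "i \<in> J" "wt i = Max (wt ` J)" by auto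
  have mx: "wt j \<le> wt i" if "j \<in> J" for j using i J that by simp
  have iI: "i \<in> IX n" "c i \<noteq> 0" using i by (auto simp: J_def)
  have ap: "V.approx (c j * mon j) (c j * \<tau> ^ wt j)" if "j \<in> J" for j
    using that c k_F by (intro V.approx_mult V.approx_refl mon_\<tau>) (auto simp: J_def)
  have lead: "c i * mon i \<in> F" "c i * mon i \<noteq> 0" using ap[OF i(1)] by (auto simp: V.approx_def)
  have small: "c j * mon j / (c i * mon i) \<in> V.mx" if j: "j \<in> J - {i}" for j
  proof -
    have "j \<in> IX n" using j by (auto simp: J_def)
    then have "wt j \<noteq> wt i" using wt_inj_IX[of j n i] iI j by auto
    then have lt: "wt j < wt i" using mx[of j] j by auto
    have "V.approx (c j * mon j / (c i * mon i)) (c j * \<tau> ^ wt j / (c i * \<tau> ^ wt i))"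
      using j i by (intro V.approx_divide ap) auto
    moreover have "c j * \<tau> ^ wt j / (c i * \<tau> ^ wt i) = (c j / c i) * (\<tau> ^ wt j / \<tau> ^ wt i)" by simp
    moreover have "c j / c i \<in> A"
      using closed_field_divide[OF closed_field_k c[OF \<open>j \<in> IX n\<close>] c[OF iI(1)]] k_A by blast
    then have "(c j / c i) * (\<tau> ^ wt j / \<tau> ^ wt i) \<in> V.mx" by (rule V.mx_mult'[OF \<tau>_ratio[OF lt]])
    ultimately show ?thesis using V.approx_in_mx by metis
  qed
  have "(\<Sum>j\<in>IX n. c j * mon j) = (\<Sum>j\<in>J. c j * mon j)"
    using finite_IX[of n] by (intro sum.mono_neutral_right) (auto simp: J_def)
  also have "\<dots> = c i * mon i + (\<Sum>j\<in>J - {i}. c j * mon j)" by (rule sum.remove[OF J(1) i(1)])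
  finally have eq: "(\<Sum>j\<in>IX n. c j * mon j) = c i * mon i + (\<Sum>j\<in>J - {i}. c j * mon j)" .
  have "(\<Sum>j\<in>J - {i}. c j * mon j) / (c i * mon i) \<in> V.mx"
    unfolding sum_divide_distrib using small by (rule V.mx_sum)
  moreover have "(\<Sum>j\<in>J - {i}. c j * mon j) \<in> F"
    using c k_R by (intro R_F R_intros(8) R_intros(4) mon_R) (auto simp: J_def)
  ultimately have "V.approx (\<Sum>j\<in>IX n. c j * mon j) (c i * mon i)"
    unfolding eq using lead by (intro V.approx_add) simp_all
  then have "V.approx (\<Sum>j\<in>IX n. c j * mon j) (c i * \<tau> ^ wt i)"
    using V.approx_trans[OF _ ap[OF i(1)]] by simp
  then show ?thesis using that[of i] iI mx by (auto simp: J_def)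
qed

lemma lincomb_indep:
  assumes "\<And>i. i \<in> IX n \<Longrightarrow> c i \<in> k" "(\<Sum>i\<in>IX n. c i * mon i) = 0"
  shows "\<forall>i\<in>IX n. c i = 0"
proof (rule ccontr)
  assume "\<not> ?thesis"
  then obtain i where "V.approx (\<Sum>j\<in>IX n. c j * mon j) (c i * \<tau> ^ wt i)"
    using lincomb_lead[of n c] assms(1) by blast
  then show False using assms(2) by (simp add: V.approx_def)
qed

text \<open>The last conclusion lets the pole order decide membership: f already lies in
  \<open>L N\<close> for its own pole order N, since no term of larger weight has a nonzero
  coefficient.\<close>

lemma L_lead:
  assumes "f \<in> L n" "f \<noteq> 0"
  obtains N c where "N \<le> n" "c \<in> k" "c \<noteq> 0" "V.approx f (c * \<tau> ^ N)" "f \<in> L N"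
proof -
  obtain c where c: "\<forall>i\<in>IX n. c i \<in> k" "f = (\<Sum>i\<in>IX n. c i * mon i)" using assms(1) by (auto simp: L_def)
  have ne: "\<exists>i\<in>IX n. c i \<noteq> 0" using assms(2) c(2) by (auto intro!: sum.neutral)
  obtain i where i: "i \<in> IX n" "c i \<noteq> 0" "V.approx (\<Sum>j\<in>IX n. c j * mon j) (c i * \<tau> ^ wt i)"
    "\<And>j. j \<in> IX n \<Longrightarrow> c j \<noteq> 0 \<Longrightarrow> wt j \<le> wt i"
    using lincomb_lead[of n c] c(1) ne by blast
  have "c j * mon j \<in> L (wt i)" if "j \<in> IX n" for j
    using i(4)[OF that] c(1) that by (cases "c j = 0") (auto simp: L_0 intro!: L_smult mon_L)
  then have "f \<in> L (wt i)" unfolding c(2) by (rule L_sum)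
  moreover have "wt i \<le> n" using i(1) by (auto simp: IX_def)
  ultimately show ?thesis using that[of "wt i" "c i"] i c by auto
qed

lemma R_lead:
  assumes "f \<in> R" "f \<noteq> 0"
  obtains N c where "c \<in> k" "c \<noteq> 0" "V.approx f (c * \<tau> ^ N)" "f \<in> L N"
  using assms L_lead unfolding R_eq by blast

text \<open>By \<open>R_lead\<close> every nonzero element of R is a unit times a power of t, and F
  consists of quotients of elements of R.\<close>

lemma uniformizer_t: "V.uniformizer t"
  unfolding V.uniformizer_def
proof (intro conjI ballI impI t_mx t_nonzero)
  fix f assume f: "f \<in> F" "f \<noteq> 0"
  obtain r s where rs: "r \<in> R" "s \<in> R" "s \<noteq> 0" "f = r / s" using f(1) by (rule FE)
  then have r0: "r \<noteq> 0" using f by auto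
  obtain N c where c: "c \<in> k" "c \<noteq> 0" "V.approx r (c * \<tau> ^ N)" using R_lead[OF rs(1) r0] .
  obtain N' c' where c': "c' \<in> k" "c' \<noteq> 0" "V.approx s (c' * \<tau> ^ N')" using R_lead[OF rs(2,3)] .
  obtain e where e: "e \<in> V.mx" "f = (c * \<tau> ^ N) / (c' * \<tau> ^ N') * (1 + e)"
    using V.approxE[OF V.approx_divide[OF c(3) c'(3)]] rs(4) by blast
  have cc: "c / c' \<in> A" "c / c' \<notin> V.mx"
    using const_unit[of "c / c'"] closed_field_divide[OF closed_field_k] c c' by auto
  have u: "c / c' * (1 + e) \<in> A" using cc V.one_plus_mx[OF e(1)] by (intro V.A_intros(4)) auto
  have u': "c / c' * (1 + e) \<notin> V.mx"
  proof
    assume "c / c' * (1 + e) \<in> V.mx"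
    then have "c / c' * (1 + e) * inverse (1 + e) \<in> V.mx"
      by (rule V.mx_mult) (use V.one_plus_mx[OF e(1)] in auto)
    moreover have "c / c' * (1 + e) * inverse (1 + e) = c / c'"
      using V.one_plus_mx[OF e(1)] by (simp add: mult.assoc del: times_divide_eq_left)
    ultimately show False using cc by metis
  qed
  have "\<tau> ^ N / \<tau> ^ N' = t powi (int N' - int N)"
    using t_nonzero by (simp add: \<tau>_def power_int_diff power_inverse field_simps)
  moreover have "f = (c / c' * (1 + e)) * (\<tau> ^ N / \<tau> ^ N')" unfolding e(2) by simp
  ultimately have "f = (c / c' * (1 + e)) * t powi (int N' - int N)" by (simp only:)
  then show "\<exists>n u. u \<in> A \<and> u \<notin> V.mx \<and> f = u * t powi n" using u u' by blast
qed

end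

subsection \<open>Integral closedness of the coordinate ring\<close>

text \<open>A common linear factor is split off H and G. As it is simple, its root is not a root of
  the cofactor of H, so the hypotheses pass to the cofactors.\<close>

lemma simple_roots_dvd:
  fixes H G :: "'k::alg_closed_field poly"
  assumes "H \<noteq> 0" "\<And>a. \<not> [:- a, 1:]\<^sup>2 dvd H" "\<And>a. poly H a = 0 \<Longrightarrow> poly G a = 0"
  shows "H dvd G"
  using assms
proof (induction "Polynomial.degree H" arbitrary: H G)
  case 0
  then obtain c where "H = [:c:]" by (metis degree_eq_zeroE)
  with 0 have "is_unit H" by (simp add: is_unit_const_poly_iff dvd_field_iff)
  then show ?case by (rule unit_imp_dvd)
next
  case (Suc n)
  then obtain a where a: "poly H a = 0" using alg_closed_imp_poly_has_root[of H] by auto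
  then obtain H' where H': "H = [:- a, 1:] * H'" using poly_eq_0_iff_dvd by (metis dvdE)
  obtain G' where G': "G = [:- a, 1:] * G'" using Suc.prems(3)[OF a] poly_eq_0_iff_dvd by (metis dvdE)
  have H'0: "H' \<noteq> 0" using Suc.prems(1) H' by auto
  have H'a: "poly H' a \<noteq> 0"
  proof
    assume "poly H' a = 0"
    then have "[:- a, 1:] dvd H'" using poly_eq_0_iff_dvd by blast
    then have "[:- a, 1:]\<^sup>2 dvd H" unfolding H' power2_eq_square by (intro mult_dvd_mono) auto
    then show False using Suc.prems(2) by blast
  qed
  have "H' dvd G'"
  proof (rule Suc.hyps(1))
    have "Polynomial.degree H = Suc (Polynomial.degree H')"
      unfolding H' using H'0 by (subst Polynomial.degree_mult_eq) auto
    then show "n = Polynomial.degree H'" using Suc.hyps(2) by simp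
    show "\<not> [:- b, 1:]\<^sup>2 dvd H'" for b using Suc.prems(2)[of b] H' dvd_mult by metis
    show "poly G' b = 0" if "poly H' b = 0" for b
    proof -
      have "b \<noteq> a" using H'a that by auto
      moreover have "poly G b = 0" using Suc.prems(3)[of b] that H' by simp
      ultimately show ?thesis by (simp add: G')
    qed
  qed fact
  then show ?case unfolding H' G' by (rule mult_dvd_mono[OF dvd_refl])
qed

context suzuki
begin

section \<open>Evaluation of polynomials with constant coefficients\<close>

definition ev :: "'a \<Rightarrow> 'k poly \<Rightarrow> 'a"
  where "ev x p = poly (map_poly cst p) x"

lemma ev_0: "ev x 0 = 0"
  by (simp add: ev_def)

lemma ev_pCons: "ev x (pCons a p) = cst a + x * ev x p"
  by (simp add: ev_def map_poly_pCons cst_0)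

lemma ev_add: "ev x (p + r) = ev x p + ev x r"
  by (induction p r rule: poly_induct2) (simp_all add: ev_0 ev_pCons cst_add algebra_simps)

lemma ev_smult: "ev x (Polynomial.smult a p) = cst a * ev x p"
  by (induction p) (simp_all add: ev_0 ev_pCons cst_mult algebra_simps)

lemma ev_mult: "ev x (p * r) = ev x p * ev x r"
  by (induction p) (simp_all add: ev_0 ev_pCons ev_add ev_smult cst_0 algebra_simps)

lemma ev_1: "ev x 1 = 1"
  using ev_pCons[of x 1 0] by (simp add: ev_0 cst_1 one_pCons)

lemma ev_power: "ev x (p ^ n) = ev x p ^ n"
  by (induction n) (auto simp: ev_1 ev_mult)

lemma ev_linear: "ev x [:- a, 1:] = x - cst a"
  by (simp add: ev_pCons ev_0 cst_uminus cst_1)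

lemma ev_monom: "ev x (Polynomial.monom 1 n) = x ^ n"
  by (induction n) (simp_all add: Polynomial.monom_Suc ev_pCons cst_0 ev_0 monom_0 cst_1)

lemma ev_const: "ev x [:a:] = cst a"
  by (simp add: ev_pCons ev_0)

lemma ev_in: "closed_ring S \<Longrightarrow> k \<subseteq> S \<Longrightarrow> x \<in> S \<Longrightarrow> ev x p \<in> S"
  by (induction p) (auto simp: ev_0 ev_pCons cst_k subsetD closed_ring_0 closed_ring_add closed_ring_mult)

lemma ev_R: "x \<in> R \<Longrightarrow> ev x p \<in> R"
  using k_R by (intro ev_in closed_ring_R) auto

lemma ev_factor: obtains s where "ev x p = cst (poly p a) + (x - cst a) * ev x s"
proof -
  have "poly (p - [:poly p a:]) a = 0" by simp
  then obtain s where "p - [:poly p a:] = [:- a, 1:] * s" using poly_eq_0_iff_dvd by (metis dvdE)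
  then have "p = [:poly p a:] + [:- a, 1:] * s" by (simp add: algebra_simps)
  then have "ev x p = cst (poly p a) + (x - cst a) * ev x s"
    by (metis ev_add ev_const ev_mult ev_linear)
  then show ?thesis by (rule that)
qed

lemma ev_y_nonzero: "p \<noteq> 0 \<Longrightarrow> ev y p \<noteq> 0"
  unfolding ev_def by (rule transc)

text \<open>In an equation for r over k[y], powers of r are cancelled until the constant term is
  nonzero; that term is a multiple of r.\<close>

lemma divides_ev_y:
  assumes "r \<in> R" "r \<noteq> 0"
  obtains P r' where "P \<noteq> 0" "r' \<in> R" "r * r' = ev y P"
proof -
  obtain P where "P \<noteq> 0" "poly (map_poly (ev y) P) r = 0"
    using algebraic[of r] unfolding ev_def by blast
  then have "\<exists>P r'. P \<noteq> 0 \<and> r' \<in> R \<and> r * r' = ev y P"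
  proof (induction P)
    case (pCons p0 P)
    have eq: "ev y p0 + r * poly (map_poly (ev y) P) r = 0"
      using pCons.prems by (simp add: map_poly_pCons ev_0)
    show ?case
    proof (cases "p0 = 0")
      case True
      then have "P \<noteq> 0" "poly (map_poly (ev y) P) r = 0" using eq assms pCons.prems by (auto simp: ev_0)
      then show ?thesis by (rule pCons.IH)
    next
      case False
      have "map_poly (ev y) P \<in> polys_over R"
        by (auto simp: polys_over_def coeff_map_poly ev_0 ev_R y_R)
      then have "poly (map_poly (ev y) P) r \<in> R" using assms(1) by (rule polys_over_poly[OF closed_ring_R])
      moreover have "r * poly (map_poly (ev y) P) r = ev y p0"
        using eq add_self' by (metis add.commute add_0_left)
      ultimately show ?thesis using False by blast
    qed
  qed simp
  then show ?thesis using that by blast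
qed

text \<open>The right-hand side of the curve equation as a polynomial in y.
  \<open>Ep (poly Cp a)\<close> is then the polynomial for z on the fibre over y = a.\<close>

definition Cp :: "'k poly"
  where "Cp = Polynomial.monom 1 q0 * (Polynomial.monom 1 q + [:0, 1:])"

definition Ep :: "'k \<Rightarrow> 'k poly"
  where "Ep a = Polynomial.monom 1 q + [:- a, 1:]"

lemma ev_Cp: "ev y Cp = y ^ q0 * (y ^ q + y)"
  by (simp add: Cp_def ev_mult ev_add ev_monom ev_pCons ev_0 cst_0 cst_1)

lemma ev_Ep: "ev z (Ep a) = ev y Cp - cst a"
  by (simp add: Ep_def ev_add ev_monom ev_linear ev_Cp suzuki_eq[symmetric])

text \<open>By the curve equation this value is Cp(y) - Cp(a), which y - a divides.\<close>

lemma ev_Ep_factor: obtains s where "s \<in> R" "ev z (Ep (poly Cp a)) = (y - cst a) * s"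
proof -
  obtain s where "ev y Cp = cst (poly Cp a) + (y - cst a) * ev y s" by (rule ev_factor)
  then have "ev z (Ep (poly Cp a)) = (y - cst a) * ev y s" by (simp add: ev_Ep)
  then show ?thesis using that ev_R[OF y_R] by blast
qed

lemma Ep_nonzero: "Ep a \<noteq> 0"
proof -
  have "poly.coeff (Ep a) q = 1"
    using q_gt by (simp add: Ep_def coeff_pCons split: nat.split)
  then show ?thesis by auto
qed

text \<open>As q is even, only the linear term survives. Simple roots of the fibre polynomials
  follow.\<close>

lemma pderiv_Ep: "pderiv (Ep a) = 1"
proof -
  have "cst 2 = 0" using cst_add[of 1 1] by (simp add: cst_1 two)
  then have "(2::'k) = 0" using cst_eq_0_iff by blast
  moreover have "(of_nat q :: 'k) = 2 * of_nat (q0\<^sup>2)" by (simp add: q_def)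
  ultimately have "(of_nat q :: 'k) = 0" by simp
  then show ?thesis by (simp add: Ep_def pderiv_add pderiv_monom pderiv_pCons one_pCons)
qed

lemma Ep_no_square: "\<not> [:- b, 1:]\<^sup>2 dvd Ep a"
proof
  assume "[:- b, 1:]\<^sup>2 dvd Ep a"
  then obtain w where w: "Ep a = [:- b, 1:] * ([:- b, 1:] * w)"
    unfolding power2_eq_square by (metis dvdE mult.assoc)
  have "poly (pderiv (Ep a)) b = 0" unfolding w pderiv_mult by simp
  then show False by (simp add: pderiv_Ep)
qed

text \<open>The ring \<open>R / (y - a)\<close> is reduced because it is a quotient of \<open>k[Z] / (Z\<^sup>q + Z - c)\<close>,
  and \<open>Z\<^sup>q + Z - c\<close> has no multiple roots.\<close>

lemma fibre_reduced:
  fixes a :: 'k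
  defines "\<pi> \<equiv> y - cst a"
  assumes r: "r \<in> R" and n: "\<exists>u\<in>R. r ^ n = \<pi> * u"
  shows "\<exists>u\<in>R. r = \<pi> * u"
proof -
  have \<pi>R: "\<pi> \<in> R" unfolding \<pi>_def using y_R k_R cst_k by (intro R_intros(3)) auto
  \<comment> \<open>T consists of the elements that are polynomials in z modulo y - a. It is a ring
    containing k, y and z, hence all of R.\<close>
  define T where "T = {r \<in> R. \<exists>G. \<exists>u\<in>R. r = ev z G + \<pi> * u}"
  have TI: "r \<in> T" if "r = ev z G + \<pi> * u" "u \<in> R" for r G u
    using that ev_R[OF z_R] \<pi>R by (auto simp: T_def intro!: R_intros(4,6))
  have Tmult: "r * r' = ev z (G * G') + \<pi> * (ev z G * u' + u * ev z G' + \<pi> * u * u')"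
    if "r = ev z G + \<pi> * u" "r' = ev z G' + \<pi> * u'" for r r' G G' u u'
    unfolding that ev_mult by (simp add: algebra_simps)
  have Tmult_R: "ev z G * u' + u * ev z G' + \<pi> * u * u' \<in> R" if "u \<in> R" "u' \<in> R" for G G' u u'
    using that ev_R[OF z_R] \<pi>R by (intro R_intros(4,6))
  have "closed_ring T"
    unfolding closed_ring_def
  proof (intro conjI ballI)
    show "1 \<in> T" by (rule TI[of _ 1 0]) (simp_all add: ev_1 R_intros(1))
    fix r r' assume "r \<in> T" "r' \<in> T"
    then obtain G u G' u' where G: "r = ev z G + \<pi> * u" "u \<in> R" "r' = ev z G' + \<pi> * u'" "u' \<in> R"
      by (auto simp: T_def)
    show "r * r' \<in> T" by (rule TI[OF Tmult[OF G(1,3)] Tmult_R[OF G(2,4)]])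
    have "r - r' = ev z (G + G') + \<pi> * (u + u')"
      unfolding minus_eq_plus G ev_add by (simp add: algebra_simps)
    then show "r - r' \<in> T" by (rule TI) (rule R_intros(6)[OF G(2,4)])
  qed
  moreover have "k \<subseteq> T"
    using TI[of _ _ 0] R_intros(1) by (auto simp: k_def simp flip: ev_const[of z])
  moreover have "y \<in> T" by (rule TI[of _ "[:a:]" 1]) (simp_all add: ev_const \<pi>_def R_intros(2))
  moreover have "z \<in> T"
    by (rule TI[of _ "Polynomial.monom 1 1" 0]) (simp_all only: ev_monom R_intros(1), simp)
  ultimately have "R \<subseteq> T" by (rule R_least)
  then obtain G u where G: "r = ev z G + \<pi> * u" "u \<in> R" using r by (auto simp: T_def)
  have "\<exists>w\<in>R. r ^ n = ev z (G ^ n) + \<pi> * w"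
  proof (induction n)
    case (Suc n)
    then obtain w where w: "r ^ n = ev z (G ^ n) + \<pi> * w" "w \<in> R" by blast
    show ?case using Tmult[OF G(1) w(1)] Tmult_R[OF G(2) w(2)] by (metis power_Suc)
  qed (auto simp: ev_1 intro!: bexI[of _ 0] R_intros(1))
  then obtain w where w: "w \<in> R" "r ^ n = ev z (G ^ n) + \<pi> * w" by blast
  \<comment> \<open>J is the ideal of polynomials whose value at z vanishes modulo y - a. It
    contains the fibre polynomial and G^n; a generator H of J suffices, without identifying
    it.\<close>
  define J where "J = {H. \<exists>u\<in>R. ev z H = \<pi> * u}"
  have J_diff_mult: "H - K * H' \<in> J" if HJ: "H \<in> J" "H' \<in> J" for H K H'
  proof -
    obtain u u' where u: "ev z H = \<pi> * u" "ev z H' = \<pi> * u'" "u \<in> R" "u' \<in> R" using HJ by (auto simp: J_def)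
    have "ev z (H - K * H') = ev z H - ev z K * ev z H'"
      using ev_add[of z "H - K * H'" "K * H'"] by (simp add: ev_mult)
    also have "\<dots> = \<pi> * (u - ev z K * u')" by (simp add: u algebra_simps)
    finally show ?thesis unfolding J_def using u ev_R[OF z_R]
      by (auto intro!: bexI[of _ "u - ev z K * u'"] R_intros(3,4))
  qed
  have J_mult: "K * H \<in> J" if HJ: "H \<in> J" for H K
  proof -
    obtain u where "ev z H = \<pi> * u" "u \<in> R" using HJ by (auto simp: J_def)
    then show ?thesis unfolding J_def using ev_R[OF z_R]
      by (auto simp: ev_mult intro!: bexI[of _ "ev z K * u"] R_intros(4))
  qed
  have Gn: "G ^ n \<in> J"
  proof -
    obtain u' where u': "u' \<in> R" "r ^ n = \<pi> * u'" using n by blast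
    have "ev z (G ^ n) = \<pi> * (u' - w)" using w u' by (simp add: algebra_simps)
    then show ?thesis unfolding J_def using R_intros(3)[OF u'(1) w(1)] by blast
  qed
  let ?E = "Ep (poly Cp a)"
  have E: "?E \<in> J" using ev_Ep_factor[of a] unfolding J_def \<pi>_def by blast
  define d where "d = (LEAST d. \<exists>H\<in>J. H \<noteq> 0 \<and> Polynomial.degree H = d)"
  have "\<exists>d. \<exists>H\<in>J. H \<noteq> 0 \<and> Polynomial.degree H = d" using E Ep_nonzero by blast
  then have "\<exists>H\<in>J. H \<noteq> 0 \<and> Polynomial.degree H = d" unfolding d_def by (rule LeastI_ex)
  then obtain H where H: "H \<in> J" "H \<noteq> 0" "Polynomial.degree H = d" by blast
  have Hdvd: "H dvd K" if "K \<in> J" for K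
  proof (rule ccontr)
    assume "\<not> H dvd K"
    then have ne: "K mod H \<noteq> 0" by (simp add: mod_eq_0_iff_dvd)
    have "K mod H = K - (K div H) * H" by (simp add: minus_div_mult_eq_mod)
    then have "K mod H \<in> J" using J_diff_mult[OF that H(1)] by simp
    then have "d \<le> Polynomial.degree (K mod H)" unfolding d_def using ne by (intro Least_le) blast
    moreover have "Polynomial.degree (K mod H) < Polynomial.degree H"
      using degree_mod_less[OF H(2), of K] ne by simp
    ultimately show False using H(3) by simp
  qed
  \<comment> \<open>H divides the fibre polynomial, so its roots are simple, and it divides G^n, so
    its roots are roots of G.\<close>
  have "H dvd G"
  proof (rule simple_roots_dvd[OF H(2)])
    show "\<not> [:- b, 1:]\<^sup>2 dvd H" for b using Ep_no_square Hdvd[OF E] dvd_trans by blast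
    show "poly G b = 0" if "poly H b = 0" for b
    proof -
      obtain K where "G ^ n = H * K" using Hdvd[OF Gn] by (rule dvdE)
      then have "poly (G ^ n) b = 0" by (simp only: poly_mult \<open>poly H b = 0\<close> mult_zero_left)
      then show ?thesis by (simp add: poly_power)
    qed
  qed
  then have "G \<in> J" using J_mult[OF H(1)] by (metis dvdE mult.commute)
  then obtain v where "v \<in> R" "ev z G = \<pi> * v" by (auto simp: J_def)
  then show ?thesis using G by (intro bexI[of _ "v + u"]) (auto simp: algebra_simps intro: R_intros(6))
qed

text \<open>Membership in R[1/f] is an integral equation for f. Multiplied by (y - a)^(n+1) f^n it
  shows that y - a divides a power of (y - a) f in R, hence (y - a) f itself because the fibre is
  reduced.\<close>

lemma integral_step:
  assumes f: "f \<in> adjoin R (inverse f)" "f \<noteq> 0" and r: "(y - cst a) * f \<in> R"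
  shows "f \<in> R"
proof -
  let ?\<pi> = "y - cst a"
  let ?r = "?\<pi> * f"
  have \<pi>R: "?\<pi> \<in> R" using y_R k_R cst_k by (intro R_intros(3)) auto
  have \<pi>0: "?\<pi> \<noteq> 0" using ev_y_nonzero[of "[:- a, 1:]"] by (simp add: ev_linear)
  obtain p where p: "p \<in> polys_over R" "f = poly p (inverse f)" using f(1) by (auto simp: adjoin_def)
  define n where "n = Polynomial.degree p"
  have "?r ^ Suc n = ?\<pi> ^ Suc n * f ^ n * f" by (simp add: power_mult_distrib mult_ac)
  also have "\<dots> = ?\<pi> ^ Suc n * f ^ n * (\<Sum>i\<le>n. poly.coeff p i * inverse f ^ i)"
    using p(2) by (simp add: poly_altdef n_def)
  also have "\<dots> = (\<Sum>i\<le>n. ?\<pi> * (poly.coeff p i * ?r ^ (n - i) * ?\<pi> ^ i))"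
    unfolding sum_distrib_left
  proof (rule sum.cong[OF refl])
    fix i assume "i \<in> {..n}"
    then have "f ^ n * inverse f ^ i = f ^ (n - i)" "?\<pi> ^ n = ?\<pi> ^ (n - i) * ?\<pi> ^ i"
      using f(2) by (auto simp: power_diff field_simps simp flip: power_add)
    then show "?\<pi> ^ Suc n * f ^ n * (poly.coeff p i * inverse f ^ i)
        = ?\<pi> * (poly.coeff p i * ?r ^ (n - i) * ?\<pi> ^ i)"
      by (simp add: power_mult_distrib mult_ac)
  qed
  also have "\<dots> = ?\<pi> * (\<Sum>i\<le>n. poly.coeff p i * ?r ^ (n - i) * ?\<pi> ^ i)"
    by (simp add: sum_distrib_left)
  finally have "?r ^ Suc n = ?\<pi> * (\<Sum>i\<le>n. poly.coeff p i * ?r ^ (n - i) * ?\<pi> ^ i)" .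
  moreover have "(\<Sum>i\<le>n. poly.coeff p i * ?r ^ (n - i) * ?\<pi> ^ i) \<in> R"
  proof (rule R_intros(8))
    fix i
    have "poly.coeff p i \<in> R" using p(1) by (auto simp: polys_over_def)
    then show "poly.coeff p i * ?r ^ (n - i) * ?\<pi> ^ i \<in> R"
      by (intro R_intros(4)[OF R_intros(4)[OF _ R_intros(7)[OF r]] R_intros(7)[OF \<pi>R]])
  qed
  ultimately obtain u where u: "u \<in> R" "?r = ?\<pi> * u"
    using fibre_reduced[OF r, of "Suc n" a] by blast
  then show ?thesis using \<pi>0 by simp
qed

text \<open>If f were outside R[1/f], this ring would extend to a valuation ring without f; so f is
  integral over R. A denominator of f in k[y] is then removed one linear factor at a time.\<close>

lemma R_integrally_closed:
  assumes f: "f \<in> F" and all: "\<And>A. val_ring F A \<Longrightarrow> k \<subseteq> A \<Longrightarrow> A \<noteq> F \<Longrightarrow> y \<in> A \<Longrightarrow> f \<in> A"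
  shows "f \<in> R"
proof -
  define O' where "O' = {f \<in> F. \<forall>A. val_ring F A \<longrightarrow> k \<subseteq> A \<longrightarrow> A \<noteq> F \<longrightarrow> y \<in> A \<longrightarrow> f \<in> A}"
  have integral: "g \<in> adjoin R (inverse g)" if g: "g \<in> O'" for g
  proof (rule ccontr)
    assume ng: "g \<notin> adjoin R (inverse g)"
    have gF: "g \<in> F" using g by (simp add: O'_def)
    have sub: "adjoin R (inverse g) \<subseteq> F"
      using R_F gF by (intro adjoin_subset closed_ring_R closed_fieldD closed_field_F F_intros(9)) auto
    obtain A where A: "adjoin R (inverse g) \<subseteq> A" "closed_ring A" "A \<subseteq> F" "g \<notin> A" "\<And>x. x \<in> F \<Longrightarrow> x \<in> A \<or> inverse x \<in> A"
      using exists_valuation_ring[OF closed_field_F closed_ring_adjoin[OF closed_ring_R] sub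
          adjoin_self[OF closed_ring_R]] ng by auto
    have RA: "R \<subseteq> A" using adjoin_superset[OF closed_ring_R] A(1) by blast
    have "val_ring F A" using A closed_field_F by (simp add: val_ring_def)
    moreover have "k \<subseteq> A" "y \<in> A" "A \<noteq> F" using RA k_R y_R A(4) gF by auto
    ultimately show False using g A(4) by (auto simp: O'_def)
  qed
  have main: "g \<in> R" if "P \<noteq> 0" "g \<in> O'" "ev y P * g \<in> R" for P g
    using that
  proof (induction "Polynomial.degree P" arbitrary: P g)
    case 0
    then obtain c where c: "P = [:c:]" "c \<noteq> 0" by (metis degree_eq_zeroE pCons_0_0)
    then have "cst (inverse c) * (ev y P * g) \<in> R" using R_intros(4)[OF k_R[OF cst_k] 0(4)] by simp
    moreover have "cst (inverse c) * (ev y P * g) = g"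
      using c cst_eq_0_iff[of c] by (simp add: ev_const cst_inverse)
    ultimately show ?case by simp
  next
    case (Suc n)
    then obtain a where "poly P a = 0" using alg_closed_imp_poly_has_root[of P] by auto
    then obtain Q where Q: "P = [:- a, 1:] * Q" using poly_eq_0_iff_dvd by (metis dvdE)
    then have Q0: "Q \<noteq> 0" using Suc.prems by auto
    have dQ: "n = Polynomial.degree Q"
      using Suc.hyps(2) Q0 unfolding Q by (subst (asm) Polynomial.degree_mult_eq) auto
    \<comment> \<open>The partial product stays in all finite valuation rings, so it is integral as
      well and \<open>integral_step\<close> applies to it.\<close>
    have QO: "ev y Q * g \<in> O'"
    proof -
      have "ev y Q * g \<in> F" using Suc.prems ev_R[OF y_R] R_F by (auto simp: O'_def intro!: F_intros(4))
      moreover have "ev y Q * g \<in> A" if "val_ring F A" "k \<subseteq> A" "A \<noteq> F" "y \<in> A" for A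
      proof -
        interpret V: val_ring F A by fact
        have "g \<in> A" using Suc.prems that by (auto simp: O'_def)
        then show ?thesis using that by (intro V.A_intros(4) ev_in V.A(1))
      qed
      ultimately show ?thesis by (simp add: O'_def)
    qed
    have "ev y Q * g \<in> R"
    proof (cases "ev y Q * g = 0")
      case False
      have "(y - cst a) * (ev y Q * g) \<in> R" using Suc.prems(3) by (simp only: Q ev_mult ev_linear mult.assoc)
      then show ?thesis by (rule integral_step[OF integral[OF QO] False])
    qed (auto simp: R_intros(1))
    then show ?case using Suc.hyps(1)[OF dQ Q0] Suc.prems by blast
  qed
  obtain r s where rs: "r \<in> R" "s \<in> R" "s \<noteq> 0" "f = r / s" using f by (rule FE)
  obtain P s' where P: "P \<noteq> 0" "s' \<in> R" "s * s' = ev y P" using divides_ev_y[OF rs(2,3)] .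
  have "ev y P * f = r * s'" using rs P(3)[symmetric] by simp
  then have "ev y P * f \<in> R" using rs P by (simp add: R_intros(4))
  moreover have "f \<in> O'" using f all by (simp add: O'_def)
  ultimately show ?thesis using main P(1) by blast
qed

end

subsection \<open>The differential structure of the function field\<close>

context suzuki
begin

lemma k_sqrt: "c \<in> k \<Longrightarrow> \<exists>e\<in>k. c = e\<^sup>2"
proof -
  assume "c \<in> k"
  then obtain a where a: "c = cst a" by (auto simp: k_def)
  obtain b where "poly [:- a, 0, 1:] b = 0" using alg_closed_imp_poly_has_root[of "[:- a, 0, 1:]"] by auto
  then have "b\<^sup>2 = a" by (simp add: power2_eq_square)
  then show ?thesis using a cst_k cst_power by blast
qed

text \<open>F^2 + F^2 y is a field, as 1/x = x/x^2 lies in it. It contains z because z = z^q + y^q0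
  (y^q + y) with q and q0 even.\<close>

lemma F_decomp:
  assumes "x \<in> F" shows "\<exists>a\<in>F. \<exists>b\<in>F. x = a\<^sup>2 + b\<^sup>2 * y"
proof -
  define S where "S = {a\<^sup>2 + b\<^sup>2 * y | a b. a \<in> F \<and> b \<in> F}"
  have SI: "x \<in> S" if "x = a\<^sup>2 + b\<^sup>2 * y" "a \<in> F" "b \<in> F" for x a b
    using that unfolding S_def by blast
  have mult: "(a\<^sup>2 + b\<^sup>2 * y) * (a'\<^sup>2 + b'\<^sup>2 * y) = (a * a' + b * b' * y)\<^sup>2 + (a * b' + a' * b)\<^sup>2 * y" for a b a' b'
    unfolding square_add power_mult_distrib by (simp add: algebra_simps power2_eq_square)
  have "closed_field S"
    unfolding closed_field_def closed_ring_def
  proof (intro conjI ballI)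
    show "1 \<in> S" by (rule SI[of _ 1 0]) (simp_all add: F_intros(1,2))
    fix x x' assume "x \<in> S" "x' \<in> S"
    then obtain a b a' b' where *: "x = a\<^sup>2 + b\<^sup>2 * y" "x' = a'\<^sup>2 + b'\<^sup>2 * y" "a \<in> F" "b \<in> F" "a' \<in> F" "b' \<in> F"
      unfolding S_def by blast
    have "x - x' = (a + a')\<^sup>2 + (b + b')\<^sup>2 * y"
      unfolding minus_eq_plus * square_add by (simp add: algebra_simps)
    then show "x - x' \<in> S" by (rule SI) (use * in \<open>auto intro: F_intros(6)\<close>)
    have "x * x' = (a * a' + b * b' * y)\<^sup>2 + (a * b' + a' * b)\<^sup>2 * y"
      unfolding *(1,2) by (rule mult)
    then show "x * x' \<in> S" by (rule SI) (use * y_F in \<open>auto intro: F_intros(4,6)\<close>)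
    have xF: "x \<in> F" unfolding *(1) using * y_F by (intro F_intros(4,6,7))
    have "inverse x = (a / x)\<^sup>2 + (b / x)\<^sup>2 * y"
    proof (cases "x = 0")
      case False
      have "(a / x)\<^sup>2 + (b / x)\<^sup>2 * y = (a\<^sup>2 + b\<^sup>2 * y) / x\<^sup>2" by (simp add: power_divide add_divide_distrib)
      also have "\<dots> = x / x\<^sup>2" by (simp only: *(1))
      also have "\<dots> = inverse x" using False by (simp add: power2_eq_square field_simps)
      finally show ?thesis by simp
    qed simp
    then show "inverse x \<in> S" by (rule SI) (use * xF in \<open>auto intro: F_intros(10)\<close>)
  qed
  moreover have "k \<subseteq> S"
  proof
    fix c assume "c \<in> k"
    then obtain e where "e \<in> k" "c = e\<^sup>2" using k_sqrt by blast
    then show "c \<in> S" by (intro SI[of c e 0]) (auto simp: k_F F_intros(1))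
  qed
  moreover have "y \<in> S" by (rule SI[of _ 0 1]) (simp_all add: F_intros(1,2))
  moreover have "z \<in> S"
  proof -
    obtain i where i: "q = 2 * i" using q_even by (rule evenE)
    obtain j where j: "q0 = 2 * j" using q0_even by (rule evenE)
    have "z = z ^ q + y ^ q0 * (y ^ q + y)" using suzuki_eq add_self'[of "z ^ q" z] by simp
    also have "\<dots> = (z ^ i + y ^ (j + i))\<^sup>2 + (y ^ j)\<^sup>2 * y"
      unfolding square_add i j power_mult[symmetric] by (simp add: power_add algebra_simps mult_2)
    finally show ?thesis by (rule SI) (use y_F z_F in \<open>auto intro!: F_intros(6,7)\<close>)
  qed
  ultimately have "F \<subseteq> S" by (rule F_least)
  then show ?thesis using assms unfolding S_def by blast
qed

text \<open>If y = e^2, then t = a^2 + b^2 y is the square of a + b e, whereas a uniformizer has odd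
  order.\<close>

lemma y_not_square: "e \<in> F \<Longrightarrow> e\<^sup>2 \<noteq> y"
proof
  assume e: "e \<in> F" "e\<^sup>2 = y"
  obtain A where A: "val_ring F A" "k \<subseteq> A" "y \<notin> A" using exists_infinite_place by blast
  interpret P: suzuki_infinite_place cst y z m A
    using A by (intro suzuki_infinite_place.intro suzuki_axioms suzuki_infinite_place_axioms.intro)
  obtain a b where ab: "a \<in> F" "b \<in> F" "t = a\<^sup>2 + b\<^sup>2 * y" using F_decomp[OF t_F] by blast
  define w where "w = a + b * e"
  have w: "t = w\<^sup>2" unfolding ab w_def square_add power_mult_distrib e(2) ..
  have wF: "w \<in> F" unfolding w_def using ab e by (intro F_intros(4,6))
  have w0: "w \<noteq> 0" using P.t_nonzero w by auto
  obtain n u where u: "u \<in> A" "u \<notin> P.V.mx" "w = u * t powi n"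
    using P.uniformizer_t wF w0 unfolding P.V.uniformizer_def by blast
  note tp = power_int_add[OF disjI1[OF P.t_nonzero], symmetric]
  have "u\<^sup>2 * t powi (n + n) = (u * t powi n)\<^sup>2"
    unfolding tp[symmetric] by (simp add: power2_eq_square mult_ac)
  then have tn: "t = u\<^sup>2 * t powi (n + n)" using w u(3) by metis
  have u2: "u\<^sup>2 \<in> A" "u\<^sup>2 \<notin> P.V.mx"
    using u P.V.mx_power_iff[of u 2] P.V.A(2) P.V.A_intros(7) by auto
  have "t * t powi (- 1) = 1" using P.t_nonzero by (simp add: power_int_minus)
  then have one: "1 = u\<^sup>2 * t powi (n + n - 1)"
    using arg_cong[OF tn, of "\<lambda>x. x * t powi (- 1)"] unfolding mult.assoc tp by simp
  show False
  proof (cases "n + n - 1 > 0")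
    case True
    then have "u\<^sup>2 * t powi (n + n - 1) \<in> P.V.mx" by (intro P.V.mx_mult'[OF P.V.powi_in_mx[OF P.t_mx] u2(1)])
    then show False using one P.V.one_notin_mx by simp
  next
    case False
    then have "t powi (1 - (n + n)) \<in> P.V.mx"
      by (intro P.V.powi_in_mx P.t_mx) presburger
    moreover have "u\<^sup>2 = t powi (1 - (n + n))"
      using arg_cong[OF one, of "\<lambda>x. x * t powi (1 - (n + n))"] unfolding mult.assoc tp by simp
    ultimately show False using u2 by simp
  qed
qed

sublocale K: char2_ext k F y
proof
  show "CHAR('a) = 2" by (rule char)
  show "closed_field F" by (rule closed_field_F)
  show "closed_field k" by (rule closed_field_k)
  show "k \<subseteq> F" using k_F by auto
  show "y \<in> F" by (rule y_F)
  show "a\<^sup>2 \<noteq> y" if "a \<in> F" for a using y_not_square that .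
  show "\<exists>a\<in>F. \<exists>b\<in>F. x = a\<^sup>2 + b\<^sup>2 * y" if "x \<in> F" for x using F_decomp that .
  show "\<exists>e\<in>F. c = e\<^sup>2" if "c \<in> k" for c using k_sqrt[OF that] k_F by blast
qed

lemma D_h1: "K.D h1 = y ^ (2 * q0)"
proof -
  have "K.D h1 = K.D (z ^ (2 * q0)) + K.D (y ^ (2 * q0) * y)"
    unfolding h1_def using y_F z_F by (simp add: K.D_add F_intros(4,7) mult.commute)
  then show ?thesis using y_F z_F by (simp add: K.D_power_even K.D_mult K.D_y F_intros(7))
qed

lemma D_h2: "K.D h2 = h1 + y ^ (2 * q0 + 1)"
proof -
  have "K.D h2 = K.D (y * h1) + K.D (z\<^sup>2)"
    unfolding h2_def using y_F z_F R_F[OF h1_R] by (simp add: K.D_add F_intros(4,7))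
  then show ?thesis using y_F z_F R_F[OF h1_R]
    by (simp add: K.D_power_even K.D_mult K.D_y D_h1 add.commute)
qed

text \<open>The quotient rule gives h2^2 dt/dy = h2 y^(2 q0) + h1 (h1 + y^(2 q0 + 1)). Inserting h2
  = y h1 + z^2 makes this the square of y^q0 z + h1, which is h2^q0.\<close>

lemma D_t:
  assumes "h2 \<noteq> 0" shows "K.D t = h2 ^ (2 * q0) / h2\<^sup>2"
proof -
  have "h1 = t * h2" using assms by (simp add: t_def)
  then have "K.D h1 = t * K.D h2 + h2 * K.D t"
    using K.D_mult[OF t_F R_F[OF h2_R]] by simp
  then have "h2 * K.D t = K.D h1 + t * K.D h2" using add_self' by (metis add.commute)
  then have "h2\<^sup>2 * K.D t = h2 * K.D h1 + h1 * K.D h2"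
    using assms by (simp add: t_def power2_eq_square algebra_simps)
  also have "\<dots> = y ^ (2 * q0) * z\<^sup>2 + h1\<^sup>2 + 2 * (h1 * y ^ (2 * q0 + 1))"
    unfolding D_h1 D_h2 by (simp add: h2_def algebra_simps power2_eq_square)
  also have "\<dots> = (y ^ q0 * z + h1)\<^sup>2"
    unfolding square_add two power_mult_distrib power_mult[symmetric] by (simp add: mult.commute)
  also have "\<dots> = h2 ^ (2 * q0)" unfolding h2_pow[symmetric] power_mult[symmetric] by (simp add: mult.commute)
  finally show ?thesis using assms by (simp add: field_simps)
qed

end

subsection \<open>The finite places\<close>

locale suzuki_finite_place = suzuki cst y z m + V: val_ring "suzuki.F cst y z" A
  for cst :: "'k::alg_closed_field \<Rightarrow> 'a::field" and y z :: 'a and m :: nat and A :: "'a set" +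
  assumes k_A: "k \<subseteq> A" and A_F: "A \<noteq> F" and y_A: "y \<in> A"
begin

lemma const_mx: "cst c \<in> V.mx \<longleftrightarrow> c = 0"
proof
  assume "cst c \<in> V.mx"
  moreover have "inverse (cst c) \<in> A" using k_A cst_k cst_inverse by (metis subsetD)
  ultimately show "c = 0" by (auto simp: V.mx_def cst_eq_0_iff)
qed (simp add: cst_0 V.mx_zero)

lemma z_A: "z \<in> A"
proof (rule ccontr)
  assume z: "z \<notin> A"
  then have z0: "z \<noteq> 0" using V.A_intros(1) by auto
  have "z / z ^ q = inverse z ^ (q - 1)" using z0 q_gt by (simp add: power_diff field_simps)
  moreover have "inverse z ^ (q - 1) \<in> V.mx"
    using V.mx_power[OF V.inverse_in_mx[OF z_F z], of "q - 1"] q_gt by simp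
  ultimately have "V.approx (z ^ q + z) (z ^ q)"
    using z_F z0 by (intro V.approx_add F_intros(7)) auto
  moreover have "z ^ q + z \<in> A" unfolding suzuki_eq using y_A by (intro V.A_intros(4,6,7))
  ultimately have "z ^ q \<in> A" using V.approx_in_A by blast
  then show False using V.integrally_closed_power[OF z_F, of q] z q_gt by simp
qed

lemma R_A: "r \<in> R \<Longrightarrow> r \<in> A"
  using R_least[OF V.A(1) k_A y_A z_A] by auto

lemma root_in_mx:
  assumes x: "x \<in> A" and P: "P \<noteq> 0" "ev x P \<in> V.mx"
  shows "\<exists>a. x - cst a \<in> V.mx"
  using P
proof (induction "Polynomial.degree P" arbitrary: P)
  case 0
  then obtain c where "P = [:c:]" by (metis degree_eq_zeroE)
  then show ?case using 0 by (simp add: ev_const const_mx)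
next
  case (Suc n)
  then obtain a where "poly P a = 0" using alg_closed_imp_poly_has_root[of P] by auto
  then obtain Q where Q: "P = [:- a, 1:] * Q" using poly_eq_0_iff_dvd by (metis dvdE)
  then have Q0: "Q \<noteq> 0" using Suc.prems by auto
  have dQ: "n = Polynomial.degree Q"
    using Suc.hyps(2) Q0 unfolding Q by (subst (asm) Polynomial.degree_mult_eq) auto
  have "(x - cst a) * ev x Q \<in> V.mx" using Suc.prems unfolding Q ev_mult ev_linear by simp
  moreover have "x - cst a \<in> A" "ev x Q \<in> A" using x k_A cst_k
    by (auto intro!: V.A_intros(3) ev_in V.A(1))
  ultimately have "x - cst a \<in> V.mx \<or> ev x Q \<in> V.mx" using V.mx_prime by blast
  then show ?case using Suc.hyps(1)[OF dQ Q0] by blast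
qed

text \<open>Properness of A yields a denominator in the maximal ideal. A multiple of it lies in k[y]
  and splits into linear factors, one of which is in the maximal ideal. The fibre polynomial then
  does the same for z.\<close>

lemma exists_center: "\<exists>a b. y - cst a \<in> V.mx \<and> z - cst b \<in> V.mx \<and> b ^ q + b = poly Cp a"
proof -
  obtain f where f: "f \<in> F" "f \<notin> A" using A_F V.A(2) by blast
  obtain r s where rs: "r \<in> R" "s \<in> R" "s \<noteq> 0" "f = r / s" using f(1) by (rule FE)
  have "r \<noteq> 0" using f rs V.A_intros(1) by auto
  then have "s = inverse f * r" using rs by simp
  then have "s \<in> V.mx" using V.mx_mult[OF V.inverse_in_mx[OF f] R_A[OF rs(1)]] by simp
  obtain P s' where P: "P \<noteq> 0" "s' \<in> R" "s * s' = ev y P" using divides_ev_y[OF rs(2,3)] .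
  have "ev y P \<in> V.mx" using V.mx_mult[OF \<open>s \<in> V.mx\<close> R_A[OF P(2)]] P(3) by simp
  then obtain a where a: "y - cst a \<in> V.mx" using root_in_mx[OF y_A P(1)] by blast
  let ?E = "Ep (poly Cp a)"
  obtain s where "s \<in> R" "ev z ?E = (y - cst a) * s" by (rule ev_Ep_factor)
  then have E: "ev z ?E \<in> V.mx" using V.mx_mult[OF a R_A] by simp
  then obtain b where b: "z - cst b \<in> V.mx" using root_in_mx[OF z_A Ep_nonzero] by blast
  obtain s where s: "ev z ?E = cst (poly ?E b) + (z - cst b) * ev z s" by (rule ev_factor)
  have "(z - cst b) * ev z s \<in> V.mx" using b z_R ev_R R_A by (intro V.mx_mult) auto
  then have "cst (poly ?E b) \<in> V.mx" using V.mx_diff[OF E] s by (metis add_diff_cancel_right')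
  then have "poly ?E b = 0" by (simp add: const_mx)
  then have "b ^ q + b = poly Cp a" by (simp add: Ep_def poly_monom algebra_simps)
  then show ?thesis using a b by blast
qed

text \<open>The curve equation expresses z - b through y - a near the centre (a, b), so y - a
  generates the maximal ideal there. That exponents are finite comes from multiples in k[y], where
  the order at a is finite.\<close>

lemma exists_uniformizer: "\<exists>a. V.uniformizer (y - cst a)"
proof -
  obtain a b where a: "y - cst a \<in> V.mx" and b: "z - cst b \<in> V.mx" and ab: "b ^ q + b = poly Cp a"
    using exists_center by blast
  define \<pi> where "\<pi> = y - cst a"
  define \<zeta> where "\<zeta> = z - cst b"
  have cR: "cst c \<in> R" for c using k_R cst_k by blast
  have \<pi>R: "\<pi> \<in> R" and \<zeta>R: "\<zeta> \<in> R" unfolding \<pi>_def \<zeta>_def using y_R z_R cR by (auto intro: R_intros(3))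
  have \<pi>mx: "\<pi> \<in> V.mx" and \<zeta>mx: "\<zeta> \<in> V.mx" using a b by (auto simp: \<pi>_def \<zeta>_def)
  have \<pi>0: "\<pi> \<noteq> 0" using ev_y_nonzero[of "[:- a, 1:]"] by (simp add: ev_linear \<pi>_def)
  \<comment> \<open>The localization of R at the centre of A.\<close>
  define S where "S = {r / s | r s. r \<in> R \<and> s \<in> R \<and> s \<notin> V.mx}"
  have SI: "r / s \<in> S" if "r \<in> R" "s \<in> R" "s \<notin> V.mx" for r s using that unfolding S_def by blast
  have nz: "s \<noteq> 0" if "s \<notin> V.mx" for s using that V.mx_zero by auto
  have prod: "s * s' \<in> R \<and> s * s' \<notin> V.mx" if "s \<in> R" "s' \<in> R" "s \<notin> V.mx" "s' \<notin> V.mx" for s s'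
    using that V.mx_prime[of s s'] R_A R_intros(4) by blast
  have RS: "r \<in> S" if "r \<in> R" for r using SI[OF that R_intros(2) V.one_notin_mx] by simp
  have Sadd: "x + x' \<in> S" and Smult: "x * x' \<in> S" if x: "x \<in> S" "x' \<in> S" for x x'
  proof -
    obtain r s r' s' where *: "x = r / s" "x' = r' / s'" "r \<in> R" "s \<in> R" "s \<notin> V.mx" "r' \<in> R" "s' \<in> R" "s' \<notin> V.mx"
      using x unfolding S_def by blast
    have "x + x' = (r * s' + r' * s) / (s * s')" using * nz by (simp add: add_frac_eq)
    also have "\<dots> \<in> S" using * prod by (intro SI R_intros(4,6)) auto
    finally show "x + x' \<in> S" .
    have "x * x' = (r * r') / (s * s')" using * by simp
    also have "\<dots> \<in> S" using * prod by (intro SI R_intros(4)) auto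
    finally show "x * x' \<in> S" .
  qed
  have SA: "x \<in> A" if x: "x \<in> S" for x
  proof -
    obtain r s where "x = r / s" "r \<in> R" "s \<in> R" "s \<notin> V.mx" using x unfolding S_def by blast
    then show ?thesis unfolding divide_inverse using R_A V.unit_inverse by (auto intro: V.A_intros(4))
  qed
  have Sdiv: "x / s \<in> S" if x: "x \<in> S" "s \<in> R" "s \<notin> V.mx" for x s
  proof -
    have "1 / s \<in> S" using x R_intros(2) by (intro SI) auto
    then show ?thesis using Smult[OF x(1)] by fastforce
  qed
  \<comment> \<open>The equation becomes \<zeta> (1 + \<zeta>^(q-1)) = \<pi> s, and the second
    factor on the left is a unit.\<close>
  have "\<exists>s\<in>S. \<zeta> = \<pi> * s"
  proof -
    obtain s where s: "s \<in> R" "ev z (Ep (poly Cp a)) = (y - cst a) * s" by (rule ev_Ep_factor)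
    have "\<zeta> ^ q + \<zeta> = (z ^ q + cst b ^ q) + (z + cst b)"
      unfolding \<zeta>_def minus_eq_plus q_alt char2_frobenius_add[OF char] ..
    also have "\<dots> = z ^ q + z - cst (b ^ q + b)"
      unfolding minus_eq_plus cst_add cst_power by (simp add: algebra_simps)
    also have "\<dots> = \<pi> * s" using s(2) by (simp add: ab \<pi>_def ev_Ep ev_Cp suzuki_eq)
    finally have "\<zeta> * (1 + \<zeta> ^ (q - 1)) = \<pi> * s"
      using q_gt by (simp add: algebra_simps flip: power_Suc)
    moreover have u: "1 + \<zeta> ^ (q - 1) \<in> R" using \<zeta>R by (intro R_intros(2,6,7))
    moreover have u': "1 + \<zeta> ^ (q - 1) \<notin> V.mx"
      using V.mx_diff[of "1 + \<zeta> ^ (q - 1)" "\<zeta> ^ (q - 1)"] V.mx_power[OF \<zeta>mx, of "q - 1"] q_gt V.one_notin_mx by auto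
    ultimately have "\<zeta> = \<pi> * (s / (1 + \<zeta> ^ (q - 1)))" using nz[OF u'] by (simp add: field_simps)
    then show ?thesis using SI[OF s(1) u u'] by blast
  qed
  then obtain s\<zeta> where s\<zeta>: "s\<zeta> \<in> S" "\<zeta> = \<pi> * s\<zeta>" by blast
  \<comment> \<open>The elements that are constant modulo \<pi> S form a ring containing k, y and z.
    Hence an element of S in the maximal ideal is divisible by \<pi> in S.\<close>
  define T where "T = {r \<in> R. \<exists>c. \<exists>s\<in>S. r = cst c + \<pi> * s}"
  have "R \<subseteq> T"
  proof (rule R_least)
    show "closed_ring T"
      unfolding closed_ring_def
    proof (intro conjI ballI)
      show "1 \<in> T" unfolding T_def using R_intros(1,2) RS cst_1 by (intro CollectI conjI exI[of _ 1] bexI[of _ 0]) auto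
      fix r r' assume "r \<in> T" "r' \<in> T"
      then obtain c s c' s' where *: "r \<in> R" "r' \<in> R" "r = cst c + \<pi> * s" "r' = cst c' + \<pi> * s'" "s \<in> S" "s' \<in> S"
        unfolding T_def by blast
      have "r - r' = cst (c + c') + \<pi> * (s + s')"
        unfolding minus_eq_plus *(3,4) cst_add by (simp add: algebra_simps)
      then show "r - r' \<in> T" unfolding T_def using R_intros(3)[OF *(1,2)] Sadd[OF *(5,6)] by blast
      have "r * r' = cst (c * c') + \<pi> * (cst c * s' + s * r')"
        unfolding cst_mult *(3,4) by (simp add: algebra_simps)
      moreover have "cst c * s' + s * r' \<in> S" using * RS cR by (intro Sadd Smult) auto
      ultimately show "r * r' \<in> T" unfolding T_def using R_intros(4)[OF *(1,2)] by blast
    qed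
    have S0: "0 \<in> S" and S1: "1 \<in> S" using RS R_intros(1,2) by auto
    show "k \<subseteq> T" unfolding T_def k_def using cR S0 by (auto intro!: bexI[of _ 0])
    show "y \<in> T" unfolding T_def using y_R S1 by (intro CollectI conjI exI[of _ a] bexI[of _ 1]) (auto simp: \<pi>_def)
    have "z = cst b + \<pi> * s\<zeta>" using s\<zeta>(2) by (simp add: \<zeta>_def algebra_simps)
    then show "z \<in> T" unfolding T_def using z_R s\<zeta>(1) by blast
  qed
  then have Rdec: "\<exists>c. \<exists>s\<in>S. r = cst c + \<pi> * s" if "r \<in> R" for r using that unfolding T_def by blast
  have Sdec: "\<exists>s\<in>S. x = \<pi> * s" if x: "x \<in> S" "x \<in> V.mx" for x
  proof -
    obtain r s where rs: "x = r / s" "r \<in> R" "s \<in> R" "s \<notin> V.mx" using x unfolding S_def by blast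
    obtain c s1 where c: "s1 \<in> S" "r = cst c + \<pi> * s1" using Rdec[OF rs(2)] by blast
    have "r = x * s" using rs nz by simp
    then have "r \<in> V.mx" using V.mx_mult[OF x(2) R_A[OF rs(3)]] by simp
    moreover have "\<pi> * s1 \<in> V.mx" using V.mx_mult[OF \<pi>mx SA[OF c(1)]] .
    ultimately have "cst c \<in> V.mx" using V.mx_diff c(2) by (metis add_diff_cancel_right')
    then have "c = 0" by (simp add: const_mx)
    then have "x = \<pi> * (s1 / s)" using rs c by (simp add: cst_0)
    then show ?thesis using Sdiv[OF c(1) rs(3,4)] by blast
  qed
  \<comment> \<open>Factors \<pi> are stripped from s while s lies in the maximal ideal. Each one
    lowers N, and for N = 0 the divisor s of a unit is a unit.\<close>
  have val: "\<exists>n u. u \<in> A \<and> u \<notin> V.mx \<and> s = u * \<pi> ^ n"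
    if "s \<in> S" "s' \<in> S" "s * s' = \<pi> ^ N * u" "u \<in> A" "u \<notin> V.mx" for s s' N u
    using that
  proof (induction N arbitrary: s)
    case 0
    have "s \<notin> V.mx" using V.mx_mult[of s s'] SA 0 by auto
    then show ?case using SA[OF 0(1)] by (intro exI[of _ 0] exI[of _ s]) auto
  next
    case (Suc N)
    show ?case
    proof (cases "s \<in> V.mx")
      case True
      then obtain s1 where s1: "s1 \<in> S" "s = \<pi> * s1" using Sdec Suc.prems(1) by blast
      have "s1 * s' = \<pi> ^ N * u" using Suc.prems(3) \<pi>0 s1(2) by (simp add: mult.assoc)
      then obtain n u where "u \<in> A" "u \<notin> V.mx" "s1 = u * \<pi> ^ n" using Suc.IH[OF s1(1)] Suc.prems by blast
      then show ?thesis using s1(2) by (intro exI[of _ "Suc n"] exI[of _ u]) auto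
    next
      case False
      then show ?thesis using SA[OF Suc.prems(1)] by (intro exI[of _ 0] exI[of _ s]) auto
    qed
  qed
  \<comment> \<open>Every nonzero r divides some P(y), and P(y) is a power of \<pi> times a
    unit.\<close>
  have valR: "\<exists>n u. u \<in> A \<and> u \<notin> V.mx \<and> r = u * \<pi> ^ n" if r: "r \<in> R" "r \<noteq> 0" for r
  proof -
    obtain P r' where P: "P \<noteq> 0" "r' \<in> R" "r * r' = ev y P" using divides_ev_y[OF r] .
    obtain Q where Q: "P = [:- a, 1:] ^ order a P * Q" "\<not> [:- a, 1:] dvd Q" using order_decomp[OF P(1)] by blast
    obtain s where s: "ev y Q = cst (poly Q a) + (y - cst a) * ev y s" by (rule ev_factor)
    have "poly Q a \<noteq> 0" using Q(2) poly_eq_0_iff_dvd by blast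
    then have "cst (poly Q a) \<notin> V.mx" by (simp add: const_mx)
    moreover have "(y - cst a) * ev y s \<in> V.mx" using a y_R ev_R R_A by (intro V.mx_mult) auto
    ultimately have "ev y Q \<notin> V.mx" using V.mx_diff s by (metis add_diff_cancel_right')
    moreover have "r * r' = \<pi> ^ order a P * ev y Q"
      unfolding P(3) by (subst Q(1)) (simp only: ev_mult ev_power ev_linear \<pi>_def)
    ultimately show ?thesis using val[OF RS[OF r(1)] RS[OF P(2)]] R_A[OF ev_R[OF y_R]] by blast
  qed
  have "V.uniformizer \<pi>"
    unfolding V.uniformizer_def
  proof (intro conjI ballI impI \<pi>mx \<pi>0)
    fix f assume f: "f \<in> F" "f \<noteq> 0"
    obtain r s where rs: "r \<in> R" "s \<in> R" "s \<noteq> 0" "f = r / s" using f(1) by (rule FE)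
    then have r0: "r \<noteq> 0" using f by auto
    obtain n u where u: "u \<in> A" "u \<notin> V.mx" "r = u * \<pi> ^ n" using valR[OF rs(1) r0] by blast
    obtain n' u' where u': "u' \<in> A" "u' \<notin> V.mx" "s = u' * \<pi> ^ n'" using valR[OF rs(2,3)] by blast
    have i: "inverse u' \<in> A" using V.unit_inverse[OF u'(1,2)] .
    have "u / u' \<in> A" unfolding divide_inverse by (rule V.A_intros(4)[OF u(1) i])
    moreover have "u / u' \<notin> V.mx"
    proof
      assume "u / u' \<in> V.mx"
      from V.mx_mult[OF this u'(1)] show False using u nz[OF u'(2)] by simp
    qed
    moreover have "f = (u / u') * \<pi> powi (int n - int n')"
      using rs(4) \<pi>0 unfolding u(3) u'(3) by (simp add: power_int_diff)
    ultimately show "\<exists>n u. u \<in> A \<and> u \<notin> V.mx \<and> f = u * \<pi> powi n" by blast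
  qed
  then show ?thesis unfolding \<pi>_def by blast
qed

lemma span_at_finite_place: "module.span (as_ring A) (kaehler k F) (kaehler_d k F ` A) = K.fib ` A"
proof -
  obtain a where t: "V.uniformizer (y - cst a)" using exists_uniformizer by blast
  have "y - cst a \<in> A" using t V.mx_subset by (auto simp: V.uniformizer_def)
  moreover have "K.D (y - cst a) = 1"
    unfolding minus_eq_plus using K.D_add[OF y_F k_F[OF cst_k]] by (simp add: K.D_y K.D_const cst_k)
  ultimately show ?thesis
    using K.span_d_eq[OF V.A] K.uniformizer_generates[OF V.val_ring_axioms t] by auto
qed

end

subsection \<open>Regular differentials\<close>

context suzuki_infinite_place
begin

lemma D_t_\<tau>: "V.approx (K.D t) (\<tau> ^ ((2 * q0 - 2) * (q + 2 * q0 + 1)))"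
proof -
  let ?w = "q + 2 * q0 + 1"
  have "V.approx (K.D t) ((\<tau> ^ ?w) ^ (2 * q0) / (\<tau> ^ ?w)\<^sup>2)"
    unfolding D_t[OF h2_nonzero] by (intro V.approx_divide V.approx_power h2_\<tau>)
  also have "(\<tau> ^ ?w) ^ (2 * q0) / (\<tau> ^ ?w)\<^sup>2 = (\<tau> ^ ?w) ^ (2 * q0 - 2)"
    using \<tau>_nonzero q0_ge by (simp add: power_diff)
  also have "\<dots> = \<tau> ^ ((2 * q0 - 2) * ?w)" unfolding power_mult[symmetric] by (simp only: mult.commute)
  finally show ?thesis .
qed

lemma span_at_infinite_place:
  "module.span (as_ring A) (kaehler k F) (kaehler_d k F ` A) = K.fib ` {a * K.D t | a. a \<in> A}"
proof (rule K.span_d_eq[OF V.A])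
  show "t \<in> A" using t_mx V.mx_subset by blast
  have "K.D t \<noteq> 0" using D_t_\<tau> by (simp add: V.approx_def)
  then show "\<exists>a\<in>A. K.D x = a * K.D t" if "x \<in> A" for x
    by (rule K.uniformizer_generates[OF V.val_ring_axioms uniformizer_t _ that])
qed

text \<open>The bound is the pole order of dt/dy, and dt generates the regular differentials at this
  place.\<close>

lemma pole_bound_iff:
  assumes c: "c \<in> k" "c \<noteq> 0" and f: "V.approx f (c * \<tau> ^ N)"
  shows "(\<exists>a\<in>A. f = a * K.D t) \<longleftrightarrow> N \<le> (2 * q0 - 2) * (q + 2 * q0 + 1)"
proof -
  let ?G = "(2 * q0 - 2) * (q + 2 * q0 + 1)"
  have D0: "K.D t \<noteq> 0" using D_t_\<tau> by (simp add: V.approx_def)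
  have fD: "V.approx (f / K.D t) (c * \<tau> ^ N / \<tau> ^ ?G)"
    by (rule V.approx_divide[OF f D_t_\<tau>])
  have "(\<exists>a\<in>A. f = a * K.D t) \<longleftrightarrow> f / K.D t \<in> A"
    using D0 by (auto intro: bexI[of _ "f / K.D t"])
  also have "\<dots> \<longleftrightarrow> c * \<tau> ^ N / \<tau> ^ ?G \<in> A" by (rule V.approx_in_A[OF fD])
  also have "\<dots> \<longleftrightarrow> N \<le> ?G"
  proof
    assume le: "N \<le> ?G"
    then have "c * \<tau> ^ N / \<tau> ^ ?G = c * t ^ (?G - N)"
      using t_nonzero by (simp add: \<tau>_def power_diff power_inverse field_simps)
    moreover have "c * t ^ (?G - N) \<in> A"
      using const_unit[OF c] V.mx_subset[OF t_mx] by (intro V.A_intros(4,7)) auto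
    ultimately show "c * \<tau> ^ N / \<tau> ^ ?G \<in> A" by simp
  next
    assume inA: "c * \<tau> ^ N / \<tau> ^ ?G \<in> A"
    show "N \<le> ?G"
    proof (rule ccontr)
      assume "\<not> N \<le> ?G"
      then have "\<tau> ^ ?G / \<tau> ^ N \<in> V.mx" by (intro \<tau>_ratio) simp
      then have "\<tau> ^ ?G / \<tau> ^ N * (c * \<tau> ^ N / \<tau> ^ ?G) \<in> V.mx" by (rule V.mx_mult[OF _ inA])
      moreover have "\<tau> ^ ?G / \<tau> ^ N * (c * \<tau> ^ N / \<tau> ^ ?G) = c" using \<tau>_nonzero by simp
      ultimately show False using const_unit[OF c] by simp
    qed
  qed
  finally show ?thesis .
qed

end

context suzuki
begin

lemma finite_placeI:
  "val_ring F A \<Longrightarrow> k \<subseteq> A \<Longrightarrow> A \<noteq> F \<Longrightarrow> y \<in> A \<Longrightarrow> suzuki_finite_place cst y z m A"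
  by (intro suzuki_finite_place.intro suzuki_axioms suzuki_finite_place_axioms.intro)

lemma infinite_placeI:
  "val_ring F A \<Longrightarrow> k \<subseteq> A \<Longrightarrow> y \<notin> A \<Longrightarrow> suzuki_infinite_place cst y z m A"
  by (intro suzuki_infinite_place.intro suzuki_axioms suzuki_infinite_place_axioms.intro)

text \<open>This number is \<open>g - 1\<close>.\<close>

definition half_canonical_degree :: nat
  where "half_canonical_degree = (q0 - 1) * (q + 2 * q0 + 1)"

lemma canonical_degree: "(2 * q0 - 2) * (q + 2 * q0 + 1) = 2 * half_canonical_degree"
  by (simp add: half_canonical_degree_def diff_mult_distrib2)

text \<open>Regularity at the finite places puts f into R by integral closedness, and a single place
  at infinity then bounds its pole order. The converse tests every place.\<close>

lemma regular_eq: "regular_differentials k F = K.fib ` L (2 * half_canonical_degree)"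
proof -
  let ?G = "2 * half_canonical_degree"
  have vr: "valuation_ring k F A \<longleftrightarrow> val_ring F A \<and> k \<subseteq> A \<and> A \<noteq> F" for A
    by (rule valuation_ring_iff[OF closed_field_F])
  have mem: "K.fib f \<in> K.fib ` S \<longleftrightarrow> f \<in> S" if "f \<in> F" for f S
    using K.fib_inject[OF that] by (auto simp: image_iff)
  have "K.fib f \<in> regular_differentials k F \<longleftrightarrow> f \<in> L ?G" if f: "f \<in> F" for f
  proof
    assume "K.fib f \<in> regular_differentials k F"
    then have reg: "K.fib f \<in> module.span (as_ring A) (kaehler k F) (kaehler_d k F ` A)"
      if "val_ring F A" "k \<subseteq> A" "A \<noteq> F" for A
      using that vr by (auto simp: regular_differentials_def)
    have "f \<in> A" if A: "val_ring F A" "k \<subseteq> A" "A \<noteq> F" "y \<in> A" for A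
      using reg[OF A(1-3)] mem[OF f] suzuki_finite_place.span_at_finite_place[OF finite_placeI[OF A]] by simp
    then have fR: "f \<in> R" using R_integrally_closed[OF f] by blast
    show "f \<in> L ?G"
    proof (cases "f = 0")
      case False
      obtain A where A: "val_ring F A" "k \<subseteq> A" "y \<notin> A" using exists_infinite_place by blast
      interpret P: suzuki_infinite_place cst y z m A by (rule infinite_placeI[OF A])
      have AF: "A \<noteq> F" using A(3) y_F by auto
      obtain N c where N: "c \<in> k" "c \<noteq> 0" "P.V.approx f (c * P.\<tau> ^ N)" "f \<in> L N"
        using P.R_lead[OF fR False] .
      have "f \<in> {a * K.D t | a. a \<in> A}" using reg[OF A(1,2) AF] mem[OF f] P.span_at_infinite_place by simp
      then have "N \<le> ?G" using P.pole_bound_iff[OF N(1-3)] canonical_degree by auto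
      then show ?thesis using L_mono N(4) by blast
    qed (simp add: L_0)
  next
    assume L: "f \<in> L ?G"
    have "K.fib f \<in> module.span (as_ring A) (kaehler k F) (kaehler_d k F ` A)"
      if A: "val_ring F A" "k \<subseteq> A" "A \<noteq> F" for A
    proof (cases "y \<in> A")
      case True
      interpret P: suzuki_finite_place cst y z m A by (rule finite_placeI[OF A True])
      show ?thesis unfolding P.span_at_finite_place using P.R_A[OF L_R[OF L]] by blast
    next
      case False
      interpret P: suzuki_infinite_place cst y z m A by (rule infinite_placeI[OF A(1,2) False])
      have "\<exists>a\<in>A. f = a * K.D t"
      proof (cases "f = 0")
        case True
        then show ?thesis using P.V.A_intros(1) by (intro bexI[of _ 0]) auto
      next
        case False
        obtain N c where "N \<le> ?G" "c \<in> k" "c \<noteq> 0" "P.V.approx f (c * P.\<tau> ^ N)"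
          using P.L_lead[OF L False] .
        then show ?thesis using P.pole_bound_iff canonical_degree by simp
      qed
      then show ?thesis unfolding P.span_at_infinite_place by blast
    qed
    then show "K.fib f \<in> regular_differentials k F"
      using f vr by (auto simp: regular_differentials_def K.carrier_kaehler)
  qed
  moreover have "regular_differentials k F \<subseteq> K.fib ` F"
    by (auto simp: regular_differentials_def K.carrier_kaehler)
  ultimately show ?thesis using L_R R_F by (intro equalityI subsetI) blast+
qed

lemma monomials_independent:
  assumes "\<And>i. i \<in> IX n \<Longrightarrow> c i \<in> k" "(\<Sum>i\<in>IX n. c i * mon i) = 0"
  shows "\<forall>i\<in>IX n. c i = 0"
proof -
  obtain A where A: "val_ring F A" "k \<subseteq> A" "y \<notin> A" using exists_infinite_place by blast
  interpret P: suzuki_infinite_place cst y z m A by (rule infinite_placeI[OF A])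
  show ?thesis by (rule P.lincomb_indep[OF assms])
qed

lemma genus_eq: "curve_genus k F = card (IX (2 * half_canonical_degree))"
  unfolding curve_genus_def regular_eq
  using finite_IX monomials_independent R_F[OF mon_R] by (intro K.dim_fib_image[where e = mon]) (auto simp: L_def)

lemma square_sum: "(\<Sum>i\<in>I. f i)\<^sup>2 = (\<Sum>i\<in>I. (f i :: 'a)\<^sup>2)"
  by (induction I rule: infinite_finite_induct) (auto simp: square_add)

text \<open>The kernel condition makes f a square a^2. A finite valuation ring that contains a^2
  contains a, and the pole order of a is half that of f.\<close>

lemma exact_regular_eq:
  "{\<omega> \<in> regular_differentials k F. cartier k F \<omega> = \<zero>\<^bsub>kaehler k F\<^esub>} = K.fib ` {a\<^sup>2 | a. a \<in> L half_canonical_degree}"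
proof -
  let ?H = half_canonical_degree
  have "f \<in> L (2 * ?H) \<and> K.odd_root f = 0 \<longleftrightarrow> f \<in> {a\<^sup>2 | a. a \<in> L ?H}" if fF: "f \<in> F" for f
  proof
    assume "f \<in> L (2 * ?H) \<and> K.odd_root f = 0"
    then have f: "f \<in> L (2 * ?H)" and "K.odd_root f = 0" by auto
    then obtain a where a: "a \<in> F" "f = a\<^sup>2" using K.odd_root_eq_0_iff[OF fF] by blast
    have aR: "a \<in> R"
    proof (rule R_integrally_closed[OF a(1)])
      fix A assume A: "val_ring F A" "k \<subseteq> A" "A \<noteq> F" "y \<in> A"
      interpret P: suzuki_finite_place cst y z m A by (rule finite_placeI[OF A])
      have "a\<^sup>2 \<in> A" using P.R_A[OF L_R[OF f]] a(2) by simp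
      then show "a \<in> A" using P.V.integrally_closed_power[OF a(1)] by simp
    qed
    have "a \<in> L ?H"
    proof (cases "a = 0")
      case False
      obtain A where A: "val_ring F A" "k \<subseteq> A" "y \<notin> A" using exists_infinite_place by blast
      interpret P: suzuki_infinite_place cst y z m A by (rule infinite_placeI[OF A])
      obtain N c where N: "c \<in> k" "c \<noteq> 0" "P.V.approx a (c * P.\<tau> ^ N)" "a \<in> L N"
        using P.R_lead[OF aR False] .
      have f0: "f \<noteq> 0" using a False by simp
      obtain N' c' where "N' \<le> 2 * ?H" "c' \<in> k" "c' \<noteq> 0" "P.V.approx f (c' * P.\<tau> ^ N')"
        using P.L_lead[OF f f0] .
      \<comment> \<open>The condition in \<open>pole_bound_iff\<close> concerns f alone, so it
        passes from the leading term of f with exponent N' to that of a^2 with exponent 2N.\<close>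
      then have "\<exists>b\<in>A. f = b * K.D t" using P.pole_bound_iff canonical_degree by simp
      moreover have "P.V.approx f (c\<^sup>2 * P.\<tau> ^ (2 * N))"
        using P.V.approx_power[OF N(3), of 2] a(2) by (simp add: power_mult_distrib power_mult[symmetric] mult.commute)
      moreover have "c\<^sup>2 \<in> k" "c\<^sup>2 \<noteq> 0" using N k_intros(7) by auto
      ultimately have "2 * N \<le> 2 * ?H" using P.pole_bound_iff canonical_degree by metis
      then show ?thesis using L_mono N(4) by simp
    qed (simp add: L_0)
    then show "f \<in> {a\<^sup>2 | a. a \<in> L ?H}" using a(2) by blast
  next
    assume "f \<in> {a\<^sup>2 | a. a \<in> L ?H}"
    then obtain a where a: "f = a\<^sup>2" "a \<in> L ?H" by blast
    then have "f \<in> L (2 * ?H)" using L_mult[OF a(2,2)] by (simp add: power2_eq_square mult_2)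
    then show "f \<in> L (2 * ?H) \<and> K.odd_root f = 0"
      using a K.odd_root_square[OF R_F[OF L_R[OF a(2)]]] by simp
  qed
  moreover have "cartier k F (K.fib f) = \<zero>\<^bsub>kaehler k F\<^esub> \<longleftrightarrow> K.odd_root f = 0" if "f \<in> F" for f
    using K.cartier_fib[OF that] K.fib_inject[OF K.odd_root_F[OF that]] by (simp add: K.zero_kaehler)
  ultimately have *: "f \<in> L (2 * ?H) \<and> cartier k F (K.fib f) = \<zero>\<^bsub>kaehler k F\<^esub> \<longleftrightarrow> f \<in> {a\<^sup>2 | a. a \<in> L ?H}"
    if "f \<in> F" for f using that by simp
  have sub: "L (2 * ?H) \<subseteq> F" "{a\<^sup>2 | a. a \<in> L ?H} \<subseteq> F" using L_R R_F R_intros(7) by auto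
  show ?thesis unfolding regular_eq
  proof (intro equalityI subsetI)
    fix \<omega> assume "\<omega> \<in> {\<omega> \<in> K.fib ` L (2 * ?H). cartier k F \<omega> = \<zero>\<^bsub>kaehler k F\<^esub>}"
    then obtain f where f: "f \<in> L (2 * ?H)" "\<omega> = K.fib f" "cartier k F (K.fib f) = \<zero>\<^bsub>kaehler k F\<^esub>" by auto
    then show "\<omega> \<in> K.fib ` {a\<^sup>2 | a. a \<in> L ?H}" using *[of f] sub by blast
  next
    fix \<omega> assume "\<omega> \<in> K.fib ` {a\<^sup>2 | a. a \<in> L ?H}"
    then obtain f where f: "f \<in> {a\<^sup>2 | a. a \<in> L ?H}" "\<omega> = K.fib f" by auto
    then show "\<omega> \<in> {\<omega> \<in> K.fib ` L (2 * ?H). cartier k F \<omega> = \<zero>\<^bsub>kaehler k F\<^esub>}" using *[of f] sub by blast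
  qed
qed

text \<open>Every constant is a square, so a combination of squared monomials is the square of a
  combination of monomials. Independence and span pass to the squares.\<close>

lemma a_number_eq: "a_number k F = card (IX half_canonical_degree)"
  unfolding a_number_def exact_regular_eq
proof (rule K.dim_fib_image[where e = "\<lambda>i. (mon i)\<^sup>2"])
  let ?I = "IX half_canonical_degree"
  show "finite ?I" by (rule finite_IX)
  show "(mon i)\<^sup>2 \<in> F" for i by (intro R_F R_intros(7) mon_R)
  have root: "\<exists>e. \<forall>i\<in>?I. e i \<in> k \<and> c i = (e i)\<^sup>2" if "\<forall>i\<in>?I. c i \<in> k" for c
    using that k_sqrt by (intro bchoice) blast
  have sq: "(\<Sum>i\<in>?I. (e i)\<^sup>2 * (mon i)\<^sup>2) = (\<Sum>i\<in>?I. e i * mon i)\<^sup>2" for e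
    by (simp add: square_sum power_mult_distrib)
  show "\<forall>i\<in>?I. c i = 0" if c: "\<And>i. i \<in> ?I \<Longrightarrow> c i \<in> k" "(\<Sum>i\<in>?I. c i * (mon i)\<^sup>2) = 0" for c
  proof -
    obtain e where e: "\<forall>i\<in>?I. e i \<in> k \<and> c i = (e i)\<^sup>2" using root c(1) by blast
    then have "(\<Sum>i\<in>?I. c i * (mon i)\<^sup>2) = (\<Sum>i\<in>?I. e i * mon i)\<^sup>2" by (simp flip: sq)
    then have "\<forall>i\<in>?I. e i = 0" using c(2) e by (intro monomials_independent) auto
    then show ?thesis using e by simp
  qed
  show "{a\<^sup>2 | a. a \<in> L half_canonical_degree} = {\<Sum>i\<in>?I. c i * (mon i)\<^sup>2 | c. \<forall>i\<in>?I. c i \<in> k}"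
  proof (intro equalityI subsetI)
    fix f assume "f \<in> {a\<^sup>2 | a. a \<in> L half_canonical_degree}"
    then obtain c where c: "\<forall>i\<in>?I. c i \<in> k" "f = (\<Sum>i\<in>?I. c i * mon i)\<^sup>2" unfolding L_def by blast
    then show "f \<in> {\<Sum>i\<in>?I. c i * (mon i)\<^sup>2 | c. \<forall>i\<in>?I. c i \<in> k}"
      using k_intros(7) by (intro CollectI exI[of _ "\<lambda>i. (c i)\<^sup>2"]) (auto simp: sq)
  next
    fix f assume "f \<in> {\<Sum>i\<in>?I. c i * (mon i)\<^sup>2 | c. \<forall>i\<in>?I. c i \<in> k}"
    then obtain c where c: "\<forall>i\<in>?I. c i \<in> k" "f = (\<Sum>i\<in>?I. c i * (mon i)\<^sup>2)" by blast
    obtain e where e: "\<forall>i\<in>?I. e i \<in> k \<and> c i = (e i)\<^sup>2" using root c(1) by blast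
    then have "f = (\<Sum>i\<in>?I. e i * mon i)\<^sup>2" unfolding c(2) by (simp flip: sq)
    moreover have "(\<Sum>i\<in>?I. e i * mon i) \<in> L half_canonical_degree" unfolding L_def using e by blast
    ultimately show "f \<in> {a\<^sup>2 | a. a \<in> L half_canonical_degree}" by blast
  qed
qed

end

subsection \<open>Counting exponents\<close>

text \<open>Terms with d \<ge> k vanish by truncated subtraction; what remains is a triangular
  number.\<close>

lemma sum_truncated:
  assumes "k \<le> (n::nat)" shows "2 * (\<Sum>d<n. k - d) = k * (k + 1)"
proof -
  have "(\<Sum>d<n. k - d) = (\<Sum>d<k. k - d)"
    using assms by (intro sum.mono_neutral_right) auto
  moreover have "2 * (\<Sum>d<k. k - d) = k * (k + 1)"
    by (induction k) (auto simp: sum.lessThan_Suc_shift simp del: sum.lessThan_Suc)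
  ultimately show ?thesis by simp
qed

text \<open>Summing triangular numbers gives a tetrahedral number.\<close>

lemma sum_truncated_triangular:
  fixes f :: "nat \<Rightarrow> nat"
  assumes f: "\<And>j. j \<le> n \<Longrightarrow> 2 * f j = j * (j + 1)" and "k \<le> n"
  shows "6 * (\<Sum>c<n. f (k - c)) = k * (k + 1) * (k + 2)"
proof -
  have f0: "f 0 = 0" using f[of 0] by simp
  have "(\<Sum>c<n. f (k - c)) = (\<Sum>c<k. f (k - c))"
    using assms(2) f0 by (intro sum.mono_neutral_right) auto
  moreover have "6 * (\<Sum>c<k. f (k - c)) = k * (k + 1) * (k + 2)" using assms(2)
  proof (induction k)
    case (Suc k)
    have "6 * (\<Sum>c<Suc k. f (Suc k - c)) = 3 * (2 * f (Suc k)) + 6 * (\<Sum>c<k. f (k - c))"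
      by (simp add: sum.lessThan_Suc_shift del: sum.lessThan_Suc)
    then show ?case using Suc f[of "Suc k"] by (simp add: algebra_simps)
  qed simp
  ultimately show ?thesis by simp
qed

lemma mult_diff_add: "i \<le> n \<Longrightarrow> w * (n - i) + w * i = w * (n::nat)"
  by (simp flip: add_mult_distrib2)

text \<open>A remainder between 1 and q does not carry past the next multiple of q.\<close>

lemma mult_bound_iff:
  assumes "0 < x" "x \<le> (q::nat)" shows "e * q + x \<le> N * q \<longleftrightarrow> e < N"
proof
  assume "e * q + x \<le> N * q"
  then have "e * q < N * q" using assms by linarith
  then show "e < N" by simp
next
  assume "e < N"
  then have "(e + 1) * q \<le> N * q" by (intro mult_le_mono1) simp
  then show "e * q + x \<le> N * q" using assms by simp
qed

context suzuki
begin

abbreviation exponents :: "(nat \<times> nat \<times> nat) set"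
  where "exponents \<equiv> {..1} \<times> {..<q0} \<times> {..<q0}"

text \<open>For fixed b, c, d the admissible a form an initial segment of length
  \<open>f b c d\<close>.\<close>

lemma card_IX:
  assumes "\<And>a b c d. b \<le> 1 \<Longrightarrow> c < q0 \<Longrightarrow> d < q0 \<Longrightarrow> wt (a, b, c, d) \<le> n \<longleftrightarrow> a < f b c d"
  shows "card (IX n) = (\<Sum>b\<le>1. \<Sum>c<q0. \<Sum>d<q0. f b c d)"
proof -
  let ?S = "SIGMA (b, c, d) : exponents. {..<f b c d}"
  have "card (IX n) = card ?S"
  proof (rule bij_betw_same_card[of "\<lambda>(a, i). (i, a)"])
    show "bij_betw (\<lambda>(a, i). (i, a)) (IX n) ?S"
      by (rule bij_betwI[where g = "\<lambda>(i, a). (a, i)"]) (use assms in \<open>auto simp: IX_def simp del: wt.simps\<close>)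
  qed
  also have "\<dots> = (\<Sum>(b, c, d)\<in>exponents. f b c d)"
    by (subst card_SigmaI) (auto intro!: sum.cong)
  also have "\<dots> = (\<Sum>b\<le>1. \<Sum>c<q0. \<Sum>d<q0. f b c d)"
    by (simp add: sum.cartesian_product')
  finally show ?thesis .
qed

lemma wt_split: "wt (a, b, c, d) = (a + b + (c + d)) * q + (b * q0 + 2 * q0 * (c + d) + d)"
  by (simp add: algebra_simps)

text \<open>The bound falls short of a multiple of q by q0 + 1, so weights can be compared with it
  through their multiples of q.\<close>

lemma half_canonical_degree_eq: "half_canonical_degree + (q0 + 1) = q0 * q"
proof -
  obtain n where "q0 = Suc n" using q0_ge by (cases q0) auto
  then show ?thesis unfolding half_canonical_degree_def q_sq by (simp add: algebra_simps)
qed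

text \<open>For b = 1 the number s is at most j - 1, which saves 2 q0 and outweighs the added
  q0.\<close>

lemma residue_bound:
  assumes "b \<le> 1" "d < q0" "b + s \<le> j" shows "b * q0 + 2 * q0 * s + d < 2 * q0 * j + q0"
proof (cases "b = 0")
  case True
  then have "2 * q0 * s \<le> 2 * q0 * j" using assms by (intro mult_le_mono2) simp
  moreover have "b * q0 = 0" using True by simp
  ultimately show ?thesis using assms by linarith
next
  case False
  then have b: "b = 1" using assms by simp
  then have "2 * q0 * (s + 1) \<le> 2 * q0 * j" using assms by (intro mult_le_mono2) simp
  then have "2 * q0 * s + 2 * q0 \<le> 2 * q0 * j" by (simp add: algebra_simps)
  moreover have "b * q0 = q0" using b by simp
  ultimately show ?thesis using assms q0_ge by linarith
qed

text \<open>The weight bound amounts to total degree below q0: in such degrees the rest of the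
  weight plus the defect q0 + 1 is at most q.\<close>

lemma a_number_bound:
  assumes "b \<le> 1" "c < q0" "d < q0"
  shows "wt (a, b, c, d) \<le> half_canonical_degree \<longleftrightarrow> a < (q0 - b - c) - d"
proof -
  let ?e = "a + b + (c + d)" and ?r = "b * q0 + 2 * q0 * (c + d) + d"
  have eq: "wt (a, b, c, d) \<le> half_canonical_degree \<longleftrightarrow> ?e * q + (?r + (q0 + 1)) \<le> q0 * q"
    unfolding wt_split half_canonical_degree_eq[symmetric] by linarith
  have "wt (a, b, c, d) \<le> half_canonical_degree \<longleftrightarrow> ?e < q0"
  proof
    assume "wt (a, b, c, d) \<le> half_canonical_degree"
    then have "?e * q < q0 * q" using eq by linarith
    then show "?e < q0" by simp
  next
    assume e: "?e < q0"
    then have "?r < 2 * q0 * (q0 - 1) + q0" using assms by (intro residue_bound) auto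
    moreover have "2 * q0 * (q0 - 1) + 2 * q0 = q"
      using mult_diff_add[of 1 q0 "2 * q0"] q0_ge by (simp add: q_sq)
    ultimately have "?r + (q0 + 1) \<le> q" by linarith
    then show "wt (a, b, c, d) \<le> half_canonical_degree"
      unfolding eq using e by (subst mult_bound_iff) auto
  qed
  then show ?thesis by linarith
qed

text \<open>The rest of the weight plus the defect 2 q0 + 2 is at most q if c + d + 1 < q0.
  Otherwise it exceeds q, but is at most 2q in the relevant degrees, which costs one degree.\<close>

lemma genus_bound:
  assumes "b \<le> 1" "c < q0" "d < q0"
  shows "wt (a, b, c, d) \<le> 2 * half_canonical_degree \<longleftrightarrow>
    a < 2 * q0 - b - c - d - (if q0 \<le> c + d + 1 then 1 else 0)"
proof -
  let ?e = "a + b + (c + d)" and ?r = "b * q0 + 2 * q0 * (c + d) + d"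
  have "2 * half_canonical_degree + (2 * q0 + 2) = (2 * q0) * q"
    using half_canonical_degree_eq by simp
  then have eq: "wt (a, b, c, d) \<le> 2 * half_canonical_degree \<longleftrightarrow> ?e * q + (?r + (2 * q0 + 2)) \<le> (2 * q0) * q"
    unfolding wt_split by linarith
  show ?thesis
  proof (cases "q0 \<le> c + d + 1")
    case False
    then have s: "c + d \<le> q0 - 2" by linarith
    then have "2 * q0 * (c + d) \<le> 2 * q0 * (q0 - 2)" by (rule mult_le_mono2)
    moreover have "b * q0 \<le> 1 * q0" using assms by (intro mult_le_mono1)
    moreover have "2 * q0 * (q0 - 2) + 4 * q0 = q"
      using mult_diff_add[of 2 q0 "2 * q0"] q0_ge by (simp add: q_sq)
    ultimately have "?r + (2 * q0 + 2) \<le> q" using s False by linarith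
    then have "wt (a, b, c, d) \<le> 2 * half_canonical_degree \<longleftrightarrow> ?e < 2 * q0"
      unfolding eq by (intro mult_bound_iff) auto
    then show ?thesis using False by auto
  next
    case True
    have "wt (a, b, c, d) \<le> 2 * half_canonical_degree \<longleftrightarrow> ?e + 1 < 2 * q0"
    proof
      assume "wt (a, b, c, d) \<le> 2 * half_canonical_degree"
      then have "?e * q + (?r + (2 * q0 + 2)) \<le> (2 * q0) * q" using eq by simp
      moreover have "2 * q0 * (c + d + 1) \<ge> 2 * q0 * q0" using True by (rule mult_le_mono2)
      then have "q < ?r + (2 * q0 + 2)" by (simp add: q_sq algebra_simps)
      ultimately have "(?e + 1) * q < (2 * q0) * q" by (simp add: algebra_simps)
      then show "?e + 1 < 2 * q0" using mult_less_cancel2 by blast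
    next
      assume e: "?e + 1 < 2 * q0"
      then have "?r < 2 * q0 * (2 * q0 - 2) + q0" using assms by (intro residue_bound) auto
      moreover have "2 * q0 * (2 * q0 - 2) + 4 * q0 = 2 * q"
        using mult_diff_add[of 2 "2 * q0" "2 * q0"] q0_ge by (simp add: q_sq)
      ultimately have "?r + (2 * q0 + 2) \<le> 2 * q" using q0_ge by linarith
      moreover have "(?e + 2) * q \<le> (2 * q0) * q" using e by (intro mult_le_mono1) simp
      ultimately show "wt (a, b, c, d) \<le> 2 * half_canonical_degree"
        unfolding eq by (simp add: algebra_simps)
    qed
    then show ?thesis using True by auto
  qed
qed

text \<open>The cases b = 0 and b = 1 contribute consecutive tetrahedral numbers; their sum is the
  square pyramidal number 1^2 + ... + q0^2.\<close>

lemma card_a_number: "6 * card (IX half_canonical_degree) = q0 * (q0 + 1) * (2 * q0 + 1)"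
proof -
  define f where "f j = (\<Sum>d<q0. j - d)" for j
  have f: "2 * f j = j * (j + 1)" if "j \<le> q0" for j unfolding f_def by (rule sum_truncated[OF that])
  have "card (IX half_canonical_degree) = (\<Sum>b\<le>1. \<Sum>c<q0. f (q0 - b - c))"
    unfolding f_def by (rule card_IX) (rule a_number_bound)
  then have "6 * card (IX half_canonical_degree) = 6 * (\<Sum>c<q0. f (q0 - c)) + 6 * (\<Sum>c<q0. f (q0 - 1 - c))"
    by simp
  also have "\<dots> = q0 * (q0 + 1) * (q0 + 2) + (q0 - 1) * (q0 - 1 + 1) * (q0 - 1 + 2)"
    by (intro arg_cong2[where f = "(+)"] sum_truncated_triangular f) auto
  also have "\<dots> = q0 * (q0 + 1) * (2 * q0 + 1)"
  proof -
    obtain n where "q0 = Suc n" using q0_ge by (cases q0) auto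
    then show ?thesis by (simp add: algebra_simps)
  qed
  finally show ?thesis .
qed

lemma card_genus: "card (IX (2 * half_canonical_degree)) = q0 * (q - 1)"
proof -
  let ?i = "\<lambda>c d. if q0 \<le> c + d + 1 then 1 else 0 :: int"
  have inner: "(\<Sum>d<q0. ?i c d) = int c + 1" if "c < q0" for c
  proof -
    have "(\<Sum>d<q0. ?i c d) = (\<Sum>d\<in>{q0 - 1 - c..<q0}. 1)"
      by (intro sum.mono_neutral_cong_right) auto
    then show ?thesis using that by simp
  qed
  have gauss: "2 * (\<Sum>c<n. int c) = int n * (int n - 1)" for n
    by (induction n) (auto simp: algebra_simps)
  have "int (card (IX (2 * half_canonical_degree))) =
      (\<Sum>b\<le>1. \<Sum>c<q0. \<Sum>d<q0. int (2 * q0 - b - c - d - (if q0 \<le> c + d + 1 then 1 else 0)))"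
    by (subst card_IX[OF genus_bound]) (simp_all del: sum.atMost_Suc)
  \<comment> \<open>Truncation never occurs: in the extreme case b = 1, c = d = q0 - 1 the
    difference is exactly 0.\<close>
  also have "\<dots> = (\<Sum>b\<le>1. \<Sum>c<q0. \<Sum>d<q0. 2 * int q0 - int b - int c - int d - ?i c d)"
    by (intro sum.cong refl) auto
  also have "\<dots> = (\<Sum>b\<le>1. \<Sum>c<q0. int q0 * (2 * int q0 - int b - int c) - (\<Sum>d<q0. int d) - (int c + 1))"
    by (intro sum.cong refl) 
      (simp only: sum_subtractf inner lessThan_iff sum_constant card_lessThan, simp add: algebra_simps)
  also have "\<dots> = (\<Sum>b\<le>1. int q0 * (int q0 * (2 * int q0 - int b)) - int q0 * (\<Sum>c<q0. int c)
      - int q0 * (\<Sum>d<q0. int d) - ((\<Sum>c<q0. int c) + int q0))"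
    by (intro sum.cong refl) (simp add: sum_subtractf sum.distrib right_diff_distrib sum_distrib_left)
  also have "\<dots> = 4 * int q0 ^ 3 - int q0 ^ 2 - 2 * int q0 * (2 * (\<Sum>c<q0. int c)) - (2 * (\<Sum>c<q0. int c)) - 2 * int q0"
    by (simp add: algebra_simps power2_eq_square power3_eq_cube)
  also have "\<dots> = int q0 * (2 * (int q0 * int q0) - 1)"
    unfolding gauss by (simp add: algebra_simps power2_eq_square power3_eq_cube)
  also have "\<dots> = int (q0 * (q - 1))"
    using q_gt by (simp add: q_sq of_nat_diff)
  finally show ?thesis by (simp only: of_nat_eq_iff)
qed

lemma genus: "curve_genus k F = q0 * (q - 1)"
  using genus_eq card_genus by simp

lemma a_number: "6 * a_number k F = q0 * (q0 + 1) * (2 * q0 + 1)"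
  using a_number_eq card_a_number by simp

end

subsection \<open>The Suzuki function field\<close>

lemma uminus_ring_of_type_algebra: "\<ominus>\<^bsub>ring_of_type_algebra\<^esub> x = - (x::'a::field)"
  and inv_ring_of_type_algebra: "x \<noteq> 0 \<Longrightarrow> inv\<^bsub>ring_of_type_algebra\<^esub> x = inverse x"
proof -
  interpret K: field "ring_of_type_algebra :: 'a ring" by (rule field_from_type_algebra)
  show "\<ominus>\<^bsub>ring_of_type_algebra\<^esub> x = - x" by (rule K.minus_equality) auto
  show "inv\<^bsub>ring_of_type_algebra\<^esub> x = inverse x" if "x \<noteq> 0"
    using that by (intro K.comm_inv_char) auto
qed

lemma closed_field_generate_field: "closed_field (generate_field (ring_of_type_algebra :: 'a::field ring) S)"
proof -
  let ?K = "ring_of_type_algebra :: 'a ring"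
  \<comment> \<open>\<open>closed_field\<close> also asks for \<open>inverse 0\<close>, which is 0,
    while \<open>generate_field.m_inv\<close> handles nonzero elements.\<close>
  have "0 \<in> generate_field ?K S"
    using field.zero_in_generate[OF field_from_type_algebra, of S] by simp
  then show ?thesis
    using generate_field.one[of ?K S] generate_field.a_inv[of _ ?K S] generate_field.m_inv[of _ ?K S]
      generate_field.eng_add[of _ ?K S] generate_field.eng_mult[of _ ?K S]
    unfolding closed_field_def closed_ring_def uminus_ring_of_type_algebra
    by (auto, metis add_uminus_conv_diff, metis inverse_zero inv_ring_of_type_algebra)
qed

lemma generate_field_least:
  fixes S T :: "'a::field set"
  assumes T: "closed_field T" and "S \<subseteq> T"
  shows "generate_field ring_of_type_algebra S \<subseteq> T"
proof
  fix x assume "x \<in> generate_field ring_of_type_algebra S"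
  then show "x \<in> T"
    by induction (use assms in \<open>auto simp: uminus_ring_of_type_algebra inv_ring_of_type_algebra
        closed_field_inverse closed_ring_intros[OF closed_fieldD[OF T]]\<close>)
qed

lemma poly_const_embedding: "poly (map_poly const_embedding p) coord_y = to_ac (to_fract p)"
proof (induction p)
  case (pCons a p)
  have "pCons a p = [:a:] + [:0, 1:] * p" by simp
  then have "to_ac (to_fract (pCons a p)) = const_embedding a + coord_y * to_ac (to_fract p)"
    unfolding const_embedding_def coord_y_def by (metis to_fract_add to_fract_mult to_ac_add to_ac_mult)
  then show ?case using pCons by (simp add: map_poly_pCons const_embedding_def)
qed simp

text \<open>An equation over the rational function field is a scalar multiple of one with polynomial
  coefficients, by \<open>content_decompose_fract\<close>.\<close>

lemma suzuki_ambient_algebraic: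
  fixes x :: suzuki_ambient
  shows "\<exists>P. P \<noteq> 0 \<and> poly (map_poly (\<lambda>p. poly (map_poly const_embedding p) coord_y) P) x = 0"
proof -
  obtain p where p: "p \<noteq> 0" "poly (map_poly to_ac p) x = 0" using alg_closure_algebraic[of x] .
  obtain c P where P: "p = Polynomial.smult c (map_poly to_fract P)" using content_decompose_fract[of p] .
  have c: "c \<noteq> 0" "P \<noteq> 0" using p(1) P by auto
  have "map_poly to_ac p = Polynomial.smult (to_ac c) (map_poly (\<lambda>p. to_ac (to_fract p)) P)"
    unfolding P by (intro poly_eqI) (simp add: coeff_map_poly)
  then have "poly (map_poly (\<lambda>p. to_ac (to_fract p)) P) x = 0" using p(2) c by simp
  then show ?thesis using c(2) by (auto simp: poly_const_embedding)
qed

lemma CHAR_suzuki_ambient: "CHAR(suzuki_ambient) = 2"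
proof -
  have "(1 + 1 :: suzuki_ambient) = to_ac (to_fract (1 + 1))"
    by (simp only: to_fract_add to_fract_1 to_ac_add to_ac_1)
  also have "(1 + 1 :: bit alg_closure poly) = [:1 + 1:]" by (simp add: one_pCons)
  also have "(1 + 1 :: bit alg_closure) = to_ac (1 + 1)" by (simp only: to_ac_add to_ac_1)
  also have "(1 + 1 :: bit) = 0" by simp
  finally have "(1 + 1 :: suzuki_ambient) = 0" by simp
  then have "(of_nat 2 :: suzuki_ambient) = 0"
    by (simp only: numeral_2_eq_2 of_nat_Suc of_nat_0 add_0_right)
  then have "CHAR(suzuki_ambient) dvd 2" by (simp only: of_nat_eq_0_iff_char_dvd)
  moreover have "CHAR(suzuki_ambient) \<noteq> 1" by simp
  ultimately show ?thesis using two_is_prime_nat by (auto simp: prime_nat_iff)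
qed

lemma suzuki_interpretation:
  assumes "m > 0" "suzuki_equation m z"
  shows "suzuki const_embedding coord_y z m"
proof
  fix a b :: "bit alg_closure"
  have "[:a + b:] = [:a:] + [:b:]" "[:a * b:] = [:a:] * [:b:]" by simp_all
  then show "const_embedding (a + b) = const_embedding a + const_embedding b"
    "const_embedding (a * b) = const_embedding a * const_embedding b"
    unfolding const_embedding_def by (simp_all only: to_fract_add to_fract_mult to_ac_add to_ac_mult)
  show "const_embedding 1 = 1" by (simp add: const_embedding_def flip: one_pCons)
  show "CHAR(suzuki_ambient) = 2" by (rule CHAR_suzuki_ambient)
  show "poly (map_poly const_embedding p) coord_y \<noteq> 0" if "p \<noteq> 0" for p
    using that by (simp add: poly_const_embedding)
qed (use assms suzuki_ambient_algebraic in \<open>auto simp: suzuki_equation_def Let_def\<close>)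

theorem theorem4p1:
  fixes m q q0 g a :: nat and z :: suzuki_ambient
  assumes "m > 0"
    and "q = 2 ^ (2 * m + 1)"
    and "q0 = 2 ^ m"
    and "suzuki_equation m z"
    and "g = curve_genus constant_field (suzuki_function_field z)"
    and "a = a_number constant_field (suzuki_function_field z)"
  shows "g = q0 * (q - 1)
    \<and> real a = real q0 * (real q0 + 1) * (2 * real q0 + 1) / 6
    \<and> 1 / 6 < real a / real g
    \<and> real a / real g < 1 / 6 + 1 / 2 ^ (m + 1)"
proof -
  interpret S: suzuki const_embedding coord_y z m
    by (rule suzuki_interpretation[OF assms(1,4)])
  have q0: "q0 = S.q0" and q: "q = S.q" using assms(2,3) by (simp_all add: S.q0_def S.q_alt)
  have k: "constant_field = S.k" by (simp add: constant_field_def S.k_def)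
  have F: "suzuki_function_field z = S.F"
  proof
    show "suzuki_function_field z \<subseteq> S.F"
      unfolding suzuki_function_field_def k
      using S.k_F S.y_F S.z_F by (intro generate_field_least S.closed_field_F) auto
    show "S.F \<subseteq> suzuki_function_field z"
      unfolding suzuki_function_field_def k
      by (intro S.F_least closed_field_generate_field) (auto intro: generate_field.incl)
  qed
  have g: "g = q0 * (q - 1)" using assms(5) S.genus unfolding k F q0 q by simp
  have "6 * a = q0 * (q0 + 1) * (2 * q0 + 1)" using assms(6) S.a_number unfolding k F q0 by simp
  then have "real (6 * a) = real (q0 * (q0 + 1) * (2 * q0 + 1))" by (rule arg_cong)
  then have "6 * real a = real q0 * (real q0 + 1) * (2 * real q0 + 1)"
    by (simp only: of_nat_mult of_nat_add of_nat_1 of_nat_numeral)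
  then have a: "real a = real q0 * (real q0 + 1) * (2 * real q0 + 1) / 6" by simp
  define x where "x = real q0"
  have x: "x \<ge> 2" using S.q0_ge q0 by (simp add: x_def)
  have gx: "real g = x * (2 * (x * x) - 1)"
  proof -
    have "real (S.q - 1) = 2 * (x * x) - 1"
      using of_nat_diff[of 1 S.q, where 'a = real] S.q_gt(2) arg_cong[OF S.q_sq, of real]
      by (simp add: x_def q0)
    then show ?thesis by (simp add: g q x_def)
  qed
  have xx: "x * x \<ge> 2 * x" using x by (intro mult_right_mono) auto
  have pos: "2 * (x * x) - 1 > 0" using x xx by linarith
  have ratio: "real a / real g = (x + 1) * (2 * x + 1) / (6 * (2 * (x * x) - 1))"
    unfolding a gx x_def[symmetric] using x by simp
  have "1 / 6 < real a / real g"
    unfolding ratio using pos x by (simp add: field_simps)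
  moreover have "(2::real) ^ (m + 1) = 2 * x" using assms(3) by (simp add: x_def)
  moreover have "real a / real g < 1 / 6 + 1 / (2 * x)"
  proof -
    \<comment> \<open>The upper bound equals (x + 3)/(6x). After cross-multiplication the difference
      is 3x^2 - 2x - 3, which is positive for x \<ge> 2.\<close>
    have "(x + 1) * (2 * x + 1) * x < (x + 3) * (2 * (x * x) - 1)"
    proof -
      have "(x + 3) * (2 * (x * x) - 1) - (x + 1) * (2 * x + 1) * x = 3 * (x * x) - 2 * x - 3"
        by (simp add: algebra_simps)
      then show ?thesis using x xx by linarith
    qed
    then have "(x + 1) * (2 * x + 1) / (2 * (x * x) - 1) < (x + 3) / x"
      using pos x by (simp add: divide_simps mult_ac)
    then have "(x + 1) * (2 * x + 1) / (2 * (x * x) - 1) / 6 < (x + 3) / x / 6"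
      by (rule divide_strict_right_mono) simp
    then have "(x + 1) * (2 * x + 1) / (6 * (2 * (x * x) - 1)) < (x + 3) / (6 * x)"
      by (simp add: mult.commute)
    also have "(x + 3) / (6 * x) = 1 / 6 + 1 / (2 * x)" using x by (simp add: field_simps)
    finally show ?thesis unfolding ratio .
  qed
  ultimately show ?thesis using g a by (simp only:)
qed

end
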